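(* Let $0<p,q\le\infty$ and let $\mu\in C^1(\mathbb{R}^n)$ be real-valued such that $\partial_j\mu\in W^{\infty,\infty}_{n/(\dot p\wedge\dot q)+\epsilon}$ for $j=1,\dots,n$, for some $\epsilon>0$. Then $e^{i\mu(D)}$ is bounded on $W^{p,q}$, i.e. there is $C>0$ with $\|e^{i\mu(D)}f\|_{W^{p,q}}\le C\|f\|_{W^{p,q}}$ for all $f\in\mathcal S(\mathbb{R}^n)$.
   Context: Fourier transform: $\hat f(\xi)=\int_{\mathbb{R}^n} f(x)e^{-2\pi i x\cdot\xi}dx$. $\langle x\rangle=(1+|x|^2)^{1/2}$. For a fixed nonzero Schwartz window $\phi$, the short-time Fourier transform of $f\in\mathcal S'(\mathbb{R}^n)$ is $V_\phi f(x,\xi)=\int f(y)\overline{\phi(y-x)}e^{-2\pi i y\cdot\xi}dy$. For $0<p,q\le\infty$, $s\in\mathbb{R}$, the Wiener amalgam space $W^{p,q}_s$ consists of $f\in\mathcal S'$ with $\|f\|_{W^{p,q}_s}=\big\|\,\|V_\phi f(x,\xi)\langle\xi\rangle^s\|_{L^q_\xi}\big\|_{L^p_x}<\infty$ (usual modifications for $p$ or $q=\infty$); the space is independent of $\phi$, with equivalent quasi-norms; $W^{p,q}=W^{p,q}_0$. Notation: $\dot p=\min\{1,p\}$, $\dot q=\min\{1,q\}$, $\dot p\wedge\dot q=\min\{\dot p,\dot q\}$. For real-valued $\mu$, $e^{i\mu(D)}f=\mathcal F^{-1}(e^{i\mu}\hat f)$. *)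

theory Defs
  imports "HOL-Analysis.Analysis" "HOL-Probability.Essential_Supremum"
begin

definition partial :: "'n::finite \<Rightarrow> (real^'n \<Rightarrow> 'b::real_normed_vector) \<Rightarrow> real^'n \<Rightarrow> 'b" where
  "partial j f x = frechet_derivative f (at x) (axis j 1)"

fun pderivs :: "'n::finite list \<Rightarrow> (real^'n \<Rightarrow> 'b::real_normed_vector) \<Rightarrow> real^'n \<Rightarrow> 'b" where
  "pderivs [] f = f"
| "pderivs (j # js) f = partial j (pderivs js f)"

definition C1_fun :: "(real^'n::finite \<Rightarrow> real) \<Rightarrow> bool" where
  "C1_fun mu \<longleftrightarrow> (\<forall>x. mu differentiable (at x)) \<and> (\<forall>j. continuous_on UNIV (partial j mu))"

definition schwartz :: "(real^'n::finite \<Rightarrow> complex) \<Rightarrow> bool" where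
  "schwartz f \<longleftrightarrow> (\<forall>js. (\<forall>x. pderivs js f differentiable (at x)) \<and>
      (\<forall>k::nat. bounded (range (\<lambda>x. (1 + norm x) ^ k * norm (pderivs js f x)))))"

definition japan :: "real^'n::finite \<Rightarrow> real" where
  "japan x = sqrt (1 + (norm x)\<^sup>2)"

text \<open>Fixed Schwartz window: the Gaussian (the spaces do not depend on the window).\<close>
definition window :: "real^'n::finite \<Rightarrow> real" where
  "window y = exp (- pi * (norm y)\<^sup>2)"

definition stft_integrand :: "(real^'n::finite \<Rightarrow> complex) \<Rightarrow> real^'n \<Rightarrow> real^'n \<Rightarrow> real^'n \<Rightarrow> complex" where
  "stft_integrand f x \<xi> y = f y * complex_of_real (window (y - x)) * cis (- 2 * pi * (y \<bullet> \<xi>))"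

definition stft :: "(real^'n::finite \<Rightarrow> complex) \<Rightarrow> real^'n \<Rightarrow> real^'n \<Rightarrow> complex" where
  "stft f x \<xi> = (\<integral>y. stft_integrand f x \<xi> y \<partial>lborel)"

definition enn_rpow :: "ennreal \<Rightarrow> real \<Rightarrow> ennreal" where
  "enn_rpow x r = (if x = \<infinity> then \<infinity> else ennreal (enn2real x powr r))"

definition Lp_qnorm :: "ennreal \<Rightarrow> (real^'n::finite \<Rightarrow> ennreal) \<Rightarrow> ennreal" where
  "Lp_qnorm p F = (if p = \<infinity> then esssup lborel F
     else enn_rpow (\<integral>\<^sup>+x. enn_rpow (F x) (enn2real p) \<partial>lborel) (1 / enn2real p))"

definition wa_norm :: "ennreal \<Rightarrow> ennreal \<Rightarrow> real \<Rightarrow> (real^'n::finite \<Rightarrow> complex) \<Rightarrow> ennreal" where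
  "wa_norm p q s f = Lp_qnorm p (\<lambda>x. Lp_qnorm q (\<lambda>\<xi>. ennreal (norm (stft f x \<xi>) * japan \<xi> powr s)))"

definition in_W :: "ennreal \<Rightarrow> ennreal \<Rightarrow> real \<Rightarrow> (real^'n::finite \<Rightarrow> complex) \<Rightarrow> bool" where
  "in_W p q s f \<longleftrightarrow> (\<forall>x \<xi>. integrable lborel (stft_integrand f x \<xi>)) \<and> wa_norm p q s f < \<infinity>"

definition fourier :: "(real^'n::finite \<Rightarrow> complex) \<Rightarrow> real^'n \<Rightarrow> complex" where
  "fourier f \<xi> = (\<integral>x. f x * cis (- 2 * pi * (x \<bullet> \<xi>)) \<partial>lborel)"

definition fourier_mult :: "(real^'n::finite \<Rightarrow> real) \<Rightarrow> (real^'n \<Rightarrow> complex) \<Rightarrow> real^'n \<Rightarrow> complex" where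
  "fourier_mult mu f x = (\<integral>\<xi>. cis (mu \<xi>) * fourier f \<xi> * cis (2 * pi * (x \<bullet> \<xi>)) \<partial>lborel)"

definition pq_dot :: "ennreal \<Rightarrow> ennreal \<Rightarrow> real" where
  "pq_dot p q = enn2real (min 1 (min p q))"

end

theory Submission
  imports Defs "HOL-Probability.Characteristic_Functions"
begin

text \<open>On the Fourier side the short-time Fourier transform of \<open>f\<close> is, up to a phase,
  \<open>VV (fourier f) x \<xi>\<close>, the inverse transform of \<open>fourier f\<close> localised near \<open>\<xi>\<close>, and the multiplier
  acts as multiplication of \<open>fourier f\<close> by \<open>cis \<circ> mu\<close>. Write \<open>s\<close> for the exponent in the hypothesis,
  \<open>n\<close> for the dimension and \<open>r = pq_dot p q\<close>, so that \<open>s r > n\<close>. Near almost every point \<open>x\<close> the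
  hypothesis represents \<open>partial j mu\<close> as the Fourier transform of a function that is
  \<open>O(japan powr - s)\<close>. Integrating along rays and exponentiating, which is possible because
  functions of this decay form a convolution algebra for \<open>s > n\<close>, gives the same for
  \<open>cis (mu (x + t) - mu x) - 1\<close>, uniformly in \<open>x\<close>. Cutting \<open>window (\<eta> - \<xi>)\<close> into compactly supported
  pieces then shows that the transform of the image is bounded pointwise by the average of
  \<open>w = norm \<circ> VV (fourier f)\<close> with weight \<open>japan y powr - s * japan m powr - s\<close> over all
  translations by \<open>(y, m)\<close>. The same bound for \<open>mu = 0\<close> is a reproducing inequality for \<open>w\<close>, which
  turns this average into an \<open>r\<close>-average; as \<open>r \<le> min p q\<close> and \<open>s r > n\<close>, Minkowski's integral
  inequality finishes the proof.\<close>

section \<open>Lebesgue integrals, Gaussians and the weight japan\<close>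

text \<open>The hypothesis controls only the gradient, so mu may be unbounded. What can be
  represented is the phase relative to its value at the centre of a ball; the remaining factor
  \<open>cis (mu x)\<close> is constant there and disappears from every modulus. The outer norm in
  the hypothesis is an essential supremum, so this is available for almost every centre only;
  integrating over the centres \<open>\<xi> + m\<close> hides the null set. The Gaussian window is
  its own transform but has no compact support, whereas the representations live on balls. Cutting
  it into pieces costs factors growing exponentially in m, which the Gaussian itself absorbs. If p
  or q is below 1, the triangle inequality fails and only r-th powers of norms are subadditive. The
  kernel estimate, an average of w itself, must therefore be converted to r-th powers before any
  norm is taken. This raises the weight to the power r, and the integrability of
  \<open>omega (s * r)\<close> is the origin of the exponent n/r + \<epsilon>.\<close>

lemma lborel_nn_integral_affine:
  fixes f :: "'a::euclidean_space \<Rightarrow> ennreal"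
  assumes [measurable]: "f \<in> borel_measurable borel" and "c \<noteq> 0"
  shows "(\<integral>\<^sup>+x. f x \<partial>lborel) = ennreal (\<bar>c\<bar> ^ DIM('a)) * (\<integral>\<^sup>+x. f (t + c *\<^sub>R x) \<partial>lborel)"
  by (subst lborel_affine[OF assms(2), of t])
     (simp add: nn_integral_density nn_integral_distr nn_integral_cmult)

lemma lborel_integrable_affine:
  fixes f :: "'a::euclidean_space \<Rightarrow> 'b::{banach, second_countable_topology}"
  assumes f: "integrable lborel f" and "c \<noteq> 0"
  shows "integrable lborel (\<lambda>x. f (t + c *\<^sub>R x))"
proof -
  have [measurable]: "f \<in> borel_measurable borel"
    using f by auto
  have "(\<integral>\<^sup>+x. ennreal (norm (f x)) \<partial>lborel) < \<infinity>"
    using f by (auto simp: integrable_iff_bounded)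
  then have "ennreal (\<bar>c\<bar> ^ DIM('a)) * (\<integral>\<^sup>+x. ennreal (norm (f (t + c *\<^sub>R x))) \<partial>lborel) < \<infinity>"
    by (subst (asm) lborel_nn_integral_affine[OF _ assms(2), where t=t]) auto
  then have "(\<integral>\<^sup>+x. ennreal (norm (f (t + c *\<^sub>R x))) \<partial>lborel) < \<infinity>"
    using assms(2) by (auto simp: ennreal_mult_less_top)
  then show ?thesis by (auto simp: integrable_iff_bounded)
qed

lemma lborel_integrable_affine_iff:
  fixes f :: "'a::euclidean_space \<Rightarrow> 'b::{banach, second_countable_topology}"
  assumes "c \<noteq> 0"
  shows "integrable lborel (\<lambda>x. f (t + c *\<^sub>R x)) \<longleftrightarrow> integrable lborel f"
proof
  assume "integrable lborel (\<lambda>x. f (t + c *\<^sub>R x))"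
  from lborel_integrable_affine[OF this, of "1/c" "- ((1/c) *\<^sub>R t)"] assms
  show "integrable lborel f" by (simp add: algebra_simps)
qed (rule lborel_integrable_affine[OF _ assms])

lemma lborel_integral_affine:
  fixes f :: "'a::euclidean_space \<Rightarrow> 'b::{banach, second_countable_topology}"
  assumes "c \<noteq> 0"
  shows "(LBINT x. f (t + c *\<^sub>R x)) = (LBINT x. f x) /\<^sub>R \<bar>c\<bar> ^ DIM('a)"
proof cases
  assume f: "integrable lborel f"
  then have [measurable]: "f \<in> borel_measurable borel" by auto
  have "(LBINT x. f x) = \<bar>c\<bar> ^ DIM('a) *\<^sub>R (LBINT x. f (t + c *\<^sub>R x))"
    by (subst lborel_affine[OF assms, of t])
       (simp add: integral_density integral_distr)
  then show ?thesis using assms by simp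
next
  assume "\<not> integrable lborel f" then show ?thesis
    using lborel_integrable_affine_iff[OF assms, of f t] by (simp add: not_integrable_integral_eq)
qed

lemma lborel_nn_integral_translate:
  fixes f :: "'a::euclidean_space \<Rightarrow> ennreal"
  assumes "f \<in> borel_measurable borel"
  shows "(\<integral>\<^sup>+x. f (a + x) \<partial>lborel) = (\<integral>\<^sup>+x. f x \<partial>lborel)"
  using lborel_nn_integral_affine[OF assms, of 1 a] by simp

lemma lborel_integral_translate:
  fixes f :: "'a::euclidean_space \<Rightarrow> 'b::{banach, second_countable_topology}"
  shows "(LBINT x. f (a + x)) = (LBINT x. f x)"
    and "(LBINT x. f (x + a)) = (LBINT x. f x)"
    and "(LBINT x. f (a - x)) = (LBINT x. f x)"
    and "(LBINT x. f (x - a)) = (LBINT x. f x)"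
    and "(LBINT x. f (- x)) = (LBINT x. f x)"
  using lborel_integral_affine[of 1 f a] lborel_integral_affine[of "-1" f a]
    lborel_integral_affine[of 1 f "-a"] lborel_integral_affine[of "-1" f 0]
  by (simp_all add: add.commute)

lemma lborel_integrable_translate:
  fixes f :: "'a::euclidean_space \<Rightarrow> 'b::{banach, second_countable_topology}"
  shows "integrable lborel (\<lambda>x. f (a + x)) \<longleftrightarrow> integrable lborel f"
    and "integrable lborel (\<lambda>x. f (x + a)) \<longleftrightarrow> integrable lborel f"
    and "integrable lborel (\<lambda>x. f (a - x)) \<longleftrightarrow> integrable lborel f"
    and "integrable lborel (\<lambda>x. f (x - a)) \<longleftrightarrow> integrable lborel f"
    and "integrable lborel (\<lambda>x. f (- x)) \<longleftrightarrow> integrable lborel f"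
  using lborel_integrable_affine_iff[of 1 f a] lborel_integrable_affine_iff[of "-1" f a]
    lborel_integrable_affine_iff[of 1 f "-a"] lborel_integrable_affine_iff[of "-1" f 0]
  by (simp_all add: add.commute)

lemma integrable_dominated:
  fixes f :: "'a \<Rightarrow> 'b::{banach, second_countable_topology}"
  assumes "integrable M g" "f \<in> borel_measurable M" "\<And>x. norm (f x) \<le> g x"
  shows "integrable M f"
  by (rule Bochner_Integration.integrable_bound[OF assms(1,2)]) (use order_trans[OF assms(3) abs_ge_self] in auto)

lemma norm_integral_dominated:
  fixes f :: "'a \<Rightarrow> 'b::{banach, second_countable_topology}"
  assumes "integrable M g" "\<And>x. norm (f x) \<le> g x"
  shows "norm (\<integral>x. f x \<partial>M) \<le> (\<integral>x. g x \<partial>M)"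
  by (rule order_trans[OF integral_norm_bound integral_mono_AE'[OF assms(1)]])
    (use assms(2) order_trans[OF norm_ge_zero assms(2)] in auto)

section \<open>The weight japan: submultiplicativity and integrability\<close>

lemma japan_ge_1: "1 \<le> japan x"
  by (simp add: japan_def)

lemma japan_pos [simp]: "0 < japan x" and japan_nonneg [simp]: "0 \<le> japan x" and japan_neq_0 [simp]: "japan x \<noteq> 0"
  using japan_ge_1[of x] by auto

lemma japan_minus [simp]: "japan (- x) = japan x"
  by (simp add: japan_def)

lemma norm_le_japan: "norm x \<le> japan x"
  unfolding japan_def by (rule real_le_rsqrt) simp

lemma japan_le: "japan x \<le> 1 + norm x"
  unfolding japan_def by (rule real_le_lsqrt) (auto simp: power2_eq_square algebra_simps)

lemma continuous_japan [continuous_intros]: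
  "continuous_on S f \<Longrightarrow> continuous_on S (\<lambda>x. japan (f x))"
  unfolding japan_def by (intro continuous_intros)

lemma borel_measurable_japan [measurable]: "japan \<in> borel_measurable borel"
  by (rule borel_measurable_continuous_onI) (intro continuous_intros)

text \<open>A Peetre-type inequality. Its core, norm x + norm y \<le> japan x * japan y, is
  Cauchy-Schwarz for the vectors (norm x, 1) and (1, norm y); the 2 comes from 1 + t \<le> 2 max 1
  t.\<close>

lemma japan_add: "japan (x + y) \<le> 2 * japan x * japan y"
proof -
  have "japan (x + y) \<le> 1 + norm (x + y)" by (rule japan_le)
  also have "\<dots> \<le> 1 + norm x + norm y" using norm_triangle_ineq[of x y] by simp
  also have "\<dots> \<le> 2 * max 1 (norm x + norm y)"
    by (auto simp: max_def)
  also have "max 1 (norm x + norm y) \<le> japan x * japan y"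
  proof (rule max.boundedI)
    show "1 \<le> japan x * japan y" using mult_mono[OF japan_ge_1 japan_ge_1, of x y] by simp
    have "(norm x + norm y)\<^sup>2 \<le> (1 + (norm x)\<^sup>2) * (1 + (norm y)\<^sup>2)"
    proof -
      have "0 \<le> (1 - norm x * norm y)\<^sup>2" by simp
      then show ?thesis by (simp add: power2_eq_square algebra_simps)
    qed
    then show "norm x + norm y \<le> japan x * japan y"
      unfolding japan_def real_sqrt_mult[symmetric] by (rule real_le_rsqrt)
  qed
  finally show ?thesis by simp
qed

lemma le_japan_powrI:
  assumes "japan x powr k * a \<le> D"
  shows "a \<le> D * japan x powr - k"
proof -
  have "a = japan x powr - k * (japan x powr k * a)"
    by (simp add: mult.assoc[symmetric] powr_add[symmetric])
  also have "\<dots> \<le> japan x powr - k * D"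
    by (intro mult_left_mono assms) auto
  finally show ?thesis by (simp only: mult.commute)
qed

text \<open>Dyadic decomposition: where \<open>japan x\<close> lies between 2^k and 2^(k+1), the
  integrand is at most 2^(-sk) and x lies in the ball of radius 2^(k+1). Summing over k gives a
  geometric series of ratio 2^(n-s).\<close>

lemma integrable_japan_powr:
  assumes s: "real CARD('n::finite) < s"
  shows "integrable lborel (\<lambda>x::real^'n. japan x powr - s)"
proof -
  let ?n = "CARD('n)"
  define a where "a = (\<lambda>k::nat. 2 powr (- s * real k))"
  have le_suminf: "F k \<le> suminf F" for F :: "nat \<Rightarrow> ennreal" and k
    using sum_le_suminf[of F "{k}"] by simp
  have pw: "ennreal (japan x powr - s) \<le> (\<Sum>k. ennreal (a k) * indicator (ball 0 (2 ^ Suc k)) x)" for x :: "real^'n"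
  proof -
    define k where "k = nat \<lfloor>log 2 (japan x)\<rfloor>"
    have l0: "0 \<le> log 2 (japan x)" using japan_ge_1[of x] by simp
    have k: "real k \<le> log 2 (japan x)" "log 2 (japan x) < real (Suc k)"
      using l0 unfolding k_def by linarith+
    have "2 powr real k \<le> japan x"
      using k(1) by (subst (asm) le_log_iff) auto
    then have "japan x powr - s \<le> (2 powr real k) powr - s"
      using s by (intro powr_mono2') auto
    also have "\<dots> = a k" by (simp add: a_def powr_powr mult.commute)
    finally have 1: "japan x powr - s \<le> a k" .
    have "japan x < 2 powr real (Suc k)"
      using k(2) by (subst (asm) log_less_iff) auto
    then have "norm x < 2 ^ Suc k"
      using norm_le_japan[of x] by (subst (asm) powr_realpow) auto
    then have "x \<in> ball 0 (2 ^ Suc k)" by simp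
    then have "ennreal (japan x powr - s) \<le> ennreal (a k) * indicator (ball 0 (2 ^ Suc k)) x"
      using 1 by (simp add: ennreal_leI)
    also have "\<dots> \<le> (\<Sum>k. ennreal (a k) * indicator (ball 0 (2 ^ Suc k)) x)"
      by (rule le_suminf)
    finally show ?thesis .
  qed
  have [measurable]: "ball (0 :: real^'n) r \<in> sets borel" for r
    by (intro borel_open open_ball)
  have em: "emeasure lborel (ball (0::real^'n) (2 ^ Suc k)) = ennreal (unit_ball_vol ?n * (2 ^ Suc k) ^ ?n)" for k
    by (subst emeasure_ball) auto
  have "(\<integral>\<^sup>+x. ennreal (norm (japan x powr - s)) \<partial>(lborel :: (real^'n) measure))
      \<le> (\<integral>\<^sup>+x. (\<Sum>k. ennreal (a k) * indicator (ball 0 (2 ^ Suc k)) x) \<partial>(lborel :: (real^'n) measure))"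
    using pw by (intro nn_integral_mono) simp
  also have "\<dots> = (\<Sum>k. ennreal (a k) * emeasure lborel (ball (0::real^'n) (2 ^ Suc k)))"
    by (subst nn_integral_suminf) (auto intro!: suminf_cong nn_integral_cmult_indicator)
  also have "\<dots> = (\<Sum>k. ennreal (unit_ball_vol ?n * 2 ^ ?n * (2 powr (?n - s)) ^ k))"
  proof (intro suminf_cong)
    fix k
    have "(2 ^ Suc k :: real) ^ ?n = 2 powr (real (Suc k) * real ?n)"
      unfolding power_mult[symmetric] by (subst powr_realpow[symmetric]) (simp, simp only: of_nat_mult)
    moreover have "(2::real) ^ ?n = 2 powr real ?n" by (simp add: powr_realpow)
    moreover have "((2::real) powr (?n - s)) ^ k = 2 powr ((?n - s) * real k)"
      by (simp add: powr_power mult.commute)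
    ultimately have "a k * (2 ^ Suc k) ^ ?n = 2 ^ ?n * (2 powr (?n - s)) ^ k"
      by (simp only: a_def powr_add[symmetric]) (simp add: algebra_simps)
    then show "ennreal (a k) * emeasure lborel (ball (0::real^'n) (2 ^ Suc k))
        = ennreal (unit_ball_vol ?n * 2 ^ ?n * (2 powr (?n - s)) ^ k)"
      unfolding em by (subst ennreal_mult[symmetric]) (auto simp: a_def mult_ac)
  qed
  also have "\<dots> < \<infinity>"
  proof -
    have "2 powr (?n - s) < 1" using s by (simp add: powr_less_one)
    then have "summable (\<lambda>k. unit_ball_vol ?n * 2 ^ ?n * (2 powr (?n - s)) ^ k)"
      by (intro summable_mult summable_geometric) auto
    then show ?thesis
      by (subst suminf_ennreal2) auto
  qed
  finally show ?thesis by (simp add: integrable_iff_bounded)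
qed

section \<open>Characters and the self-dual Gaussian\<close>

definition ch :: "real \<Rightarrow> complex" where
  "ch t = cis (2 * pi * t)"

lemma norm_ch [simp]: "norm (ch t) = 1" by (simp add: ch_def)
lemma ch_0 [simp]: "ch 0 = 1" by (simp add: ch_def)
lemma ch_add: "ch (s + t) = ch s * ch t" by (simp add: ch_def cis_mult algebra_simps)
lemma ch_diff: "ch (s - t) = ch s * ch (- t)" using ch_add[of s "-t"] by simp
lemma continuous_ch [continuous_intros]: "continuous_on S f \<Longrightarrow> continuous_on S (\<lambda>x. ch (f x))"
  unfolding ch_def by (intro continuous_intros)
lemma borel_measurable_ch [measurable]: "ch \<in> borel_measurable borel"
  by (rule borel_measurable_continuous_onI) (intro continuous_intros)

lemma continuous_window [continuous_intros]: "continuous_on S f \<Longrightarrow> continuous_on S (\<lambda>x. window (f x))"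
  unfolding window_def by (intro continuous_intros)
lemma borel_measurable_window [measurable]: "window \<in> borel_measurable borel"
  by (rule borel_measurable_continuous_onI) (intro continuous_intros)
lemma window_pos [simp]: "0 < window x" and window_nonneg [simp]: "0 \<le> window x" and window_neq_0 [simp]: "window x \<noteq> 0"
  by (auto simp: window_def)
lemma window_le_1: "window x \<le> 1" by (simp add: window_def)
lemma window_minus [simp]: "window (- x) = window x" by (simp add: window_def)

text \<open>Substituting sqrt (2 pi) x for x turns the integral into the characteristic function of
  the standard normal distribution.\<close>

lemma integral_gauss_real:
  fixes \<xi> :: real
  shows "integrable lborel (\<lambda>x. complex_of_real (exp (- pi * x\<^sup>2)) * ch (x * \<xi>))" (is ?I)
    and "(LBINT x. complex_of_real (exp (- pi * x\<^sup>2)) * ch (x * \<xi>)) = complex_of_real (exp (- pi * \<xi>\<^sup>2))" (is ?E)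
proof -
  let ?t = "sqrt (2 * pi) * \<xi>"
  let ?g = "\<lambda>x::real. complex_of_real (std_normal_density x) * iexp (?t * x)"
  have "integrable lborel (\<lambda>x::real. complex_of_real (std_normal_density x))"
    using integrable_normal_density[of 1 0] by (simp add: integrable_of_real)
  from integrable_norm[OF this] have int: "integrable lborel ?g"
    by (rule integrable_dominated) (auto simp: norm_mult)
  have "char std_normal_distribution ?t = (LBINT x. ?g x)"
    unfolding char_def by (subst integral_density) (auto simp: scaleR_conv_of_real)
  then have val: "(LBINT x. ?g x) = complex_of_real (exp (- pi * \<xi>\<^sup>2))"
    by (simp add: char_std_normal_distribution power_mult_distrib)
  have eq: "?g (0 + sqrt (2 * pi) * x) = complex_of_real (1 / sqrt (2 * pi)) * (complex_of_real (exp (- pi * x\<^sup>2)) * ch (x * \<xi>))" for x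
  proof -
    have 2: "sqrt (2 * pi) * \<xi> * (sqrt (2 * pi) * x) = 2 * pi * (x * \<xi>)"
      using real_sqrt_mult_self[of "2 * pi"] by (simp add: algebra_simps)
    show ?thesis
      by (simp only: add_0 2) (simp add: std_normal_density_def power_mult_distrib ch_def cis_conv_exp)
  qed
  have nz: "sqrt (2 * pi) \<noteq> 0" by simp
  have "integrable lborel (\<lambda>x. complex_of_real (sqrt (2 * pi)) * ?g (0 + sqrt (2 * pi) * x))"
    by (intro integrable_mult_right lborel_integrable_real_affine int nz)
  then show ?I unfolding eq by (simp add: mult.assoc[symmetric])
  have "(LBINT x. ?g x) = \<bar>sqrt (2 * pi)\<bar> *\<^sub>R (LBINT x. ?g (0 + sqrt (2 * pi) * x))"
    by (rule lborel_integral_real_affine[OF nz])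
  also have "\<dots> = (LBINT x. complex_of_real (exp (- pi * x\<^sup>2)) * ch (x * \<xi>))"
    unfolding eq by (simp add: scaleR_conv_of_real)
  finally show ?E using val by simp
qed

lemma ch_sum: "ch (sum f A) = (\<Prod>i\<in>A. ch (f i))"
  by (induction A rule: infinite_finite_induct) (auto simp: ch_add)

text \<open>Window and character both factor over the coordinates, so the one-dimensional formula
  can be applied in each factor of the product measure.\<close>

lemma integral_window_ch:
  fixes \<xi> :: "real^'n::finite"
  shows "integrable lborel (\<lambda>x. complex_of_real (window x) * ch (x \<bullet> \<xi>))" (is ?I)
    and "(LBINT x. complex_of_real (window x) * ch (x \<bullet> \<xi>)) = complex_of_real (window \<xi>)" (is ?E)
proof -
  interpret product_sigma_finite "\<lambda>_::real^'n. lborel :: real measure" ..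
  let ?B = "Basis :: (real^'n) set"
  let ?f = "\<lambda>b x. complex_of_real (exp (- pi * x\<^sup>2)) * ch (x * (\<xi> \<bullet> b))"
  let ?T = "\<lambda>f. \<Sum>b\<in>?B. f b *\<^sub>R b"
  have w: "complex_of_real (window x) = (\<Prod>b\<in>?B. complex_of_real (exp (- pi * (x \<bullet> b)\<^sup>2)))" for x
    unfolding of_real_prod[symmetric] window_def norm_eq_sqrt_inner
    by (subst euclidean_inner) (simp add: sum_nonneg exp_sum[symmetric] sum_distrib_left sum_negf power2_eq_square)
  have eq: "complex_of_real (window x) * ch (x \<bullet> \<xi>) = (\<Prod>b\<in>?B. ?f b (x \<bullet> b))" for x
    unfolding w by (subst euclidean_inner) (simp add: ch_sum prod.distrib)
  have int: "integrable (\<Pi>\<^sub>M b\<in>?B. lborel) (\<lambda>g. \<Prod>b\<in>?B. ?f b (g b))"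
    using integral_gauss_real(1) by (intro product_integrable_prod) auto
  show ?I
    unfolding eq by (subst lborel_eq, subst integrable_distr_eq) (use int in \<open>auto cong: prod.cong\<close>)
  have "(LBINT x. (\<Prod>b\<in>?B. ?f b (x \<bullet> b))) = (\<integral>g. (\<Prod>b\<in>?B. ?f b (g b)) \<partial>(\<Pi>\<^sub>M b\<in>?B. lborel))"
    by (subst lborel_eq, subst integral_distr) (auto cong: prod.cong)
  also have "\<dots> = (\<Prod>b\<in>?B. complex_of_real (exp (- pi * (\<xi> \<bullet> b)\<^sup>2)))"
    using integral_gauss_real by (subst product_integral_prod) auto
  finally show ?E unfolding eq unfolding w .
qed

lemma integrable_window: "integrable lborel (window :: real^'n::finite \<Rightarrow> real)"
  and integral_window: "(LBINT x. window (x::real^'n::finite)) = 1"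
proof -
  have *: "integrable lborel (\<lambda>x::real^'n. complex_of_real (window x))"
    using integral_window_ch(1)[of 0] by simp
  then show "integrable lborel (window :: real^'n \<Rightarrow> real)" 
    using integrable_Re by force
  have "complex_of_real (LBINT x. window (x::real^'n)) = 1"
    using integral_window_ch(2)[of "0::real^'n"] by (simp add: window_def[of 0])
  then show "(LBINT x. window (x::real^'n)) = 1"
    using of_real_eq_1_iff by blast
qed

section \<open>Fourier inversion\<close>

lemma integrable_pair_bound:
  fixes F :: "'a::euclidean_space \<times> 'b::euclidean_space \<Rightarrow> 'c::{banach, second_countable_topology}"
    and g :: "'a \<Rightarrow> real" and h :: "'b \<Rightarrow> real"
  assumes g: "integrable lborel g" and h: "integrable lborel h"
    and [measurable]: "F \<in> borel_measurable (lborel \<Otimes>\<^sub>M lborel)"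
    and b: "\<And>x y. norm (F (x, y)) \<le> g x * h y"
  shows "integrable (lborel \<Otimes>\<^sub>M lborel) F"
proof (rule integrable_dominated)
  have [measurable]: "g \<in> borel_measurable borel" "h \<in> borel_measurable borel" using g h by auto
  show "integrable (lborel \<Otimes>\<^sub>M lborel) (\<lambda>p. \<bar>g (fst p)\<bar> * \<bar>h (snd p)\<bar>)"
  proof (rule lborel_pair.Fubini_integrable)
    show "integrable lborel (\<lambda>x. \<integral>y. norm (\<bar>g (fst (x, y))\<bar> * \<bar>h (snd (x, y))\<bar>) \<partial>lborel)"
      using g by simp
  qed (use h in auto)
  show "norm (F p) \<le> \<bar>g (fst p)\<bar> * \<bar>h (snd p)\<bar>" for p
    using order_trans[OF b abs_ge_self, of "fst p" "snd p"] by (simp add: abs_mult[symmetric])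
qed simp

text \<open>Most interchanges of integrals below are dominated by a product of two integrable
  functions of one variable each, which makes this the convenient form of Fubini's theorem.\<close>

lemma Fubini_bound:
  fixes F :: "'a::euclidean_space \<Rightarrow> 'b::euclidean_space \<Rightarrow> 'c::{banach, second_countable_topology}"
    and g :: "'a \<Rightarrow> real" and h :: "'b \<Rightarrow> real"
  assumes "integrable lborel g" and "integrable lborel h"
    and "(\<lambda>(x, y). F x y) \<in> borel_measurable (lborel \<Otimes>\<^sub>M lborel)"
    and "\<And>x y. norm (F x y) \<le> g x * h y"
  shows "(LBINT x. (LBINT y. F x y)) = (LBINT y. (LBINT x. F x y))"
proof -
  show ?thesis
    by (rule lborel_pair.Fubini_integral[symmetric], rule integrable_pair_bound[OF assms(1,2)]) (use assms in auto)
qed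

text \<open>The sign of the character is opposite to that in \<open>fourier\<close>: writing g as
  \<open>ft G\<close> exhibits g as a superposition of the characters
  \<open>ch (y \<bullet> x)\<close>, and multiplication by such a character translates the first
  argument of \<open>VV\<close>.\<close>

definition ft :: "(real^'n::finite \<Rightarrow> complex) \<Rightarrow> real^'n \<Rightarrow> complex" where
  "ft G x = (LBINT y. G y * ch (y \<bullet> x))"

lemma integrable_mult_ch:
  fixes G :: "real^'n::finite \<Rightarrow> complex"
  assumes "integrable lborel G" and [measurable]: "g \<in> borel_measurable borel"
  shows "integrable lborel (\<lambda>y. G y * ch (g y))"
  by (rule integrable_dominated[OF integrable_norm[OF assms(1)]]) (use assms in \<open>auto simp: norm_mult\<close>)

lemma borel_measurable_ft [measurable]:
  assumes [measurable]: "G \<in> borel_measurable borel"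
  shows "ft G \<in> borel_measurable borel"
  unfolding ft_def by measurable

lemma ft_window_scaled:
  fixes z :: "real^'n::finite"
  assumes k: "0 < k"
  shows "integrable lborel (\<lambda>y. complex_of_real (window ((1/k) *\<^sub>R y)) * ch (y \<bullet> z))" (is ?I)
    and "(LBINT y. complex_of_real (window ((1/k) *\<^sub>R y)) * ch (y \<bullet> z)) = k ^ CARD('n) * window (k *\<^sub>R z)" (is ?E)
proof -
  let ?f = "\<lambda>y::real^'n. complex_of_real (window y) * ch (y \<bullet> (k *\<^sub>R z))"
  have eq: "complex_of_real (window ((1/k) *\<^sub>R y)) * ch (y \<bullet> z) = ?f (0 + (1/k) *\<^sub>R y)" for y
    using k by simp
  show ?I unfolding eq by (rule lborel_integrable_affine[OF integral_window_ch(1)]) (use k in auto)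
  show ?E unfolding eq by (subst lborel_integral_affine)
     (use k in \<open>auto simp: integral_window_ch(2) scaleR_conv_of_real power_divide divide_simps simp del: inner_scaleR_right\<close>)
qed

text \<open>Scaled Gaussians form an approximate identity. As f may be unbounded, it is split at the
  unit ball around x: near x it is bounded by compactness and dominated convergence applies after
  rescaling; away from x the kernel tends to 0 uniformly and integrability of f suffices.\<close>

lemma gauss_approx:
  fixes f :: "real^'n::finite \<Rightarrow> complex"
  assumes c: "continuous_on UNIV f" and i: "integrable lborel f"
  shows "(\<lambda>k. \<integral>z. f z * (real (Suc k) ^ CARD('n) * window (real (Suc k) *\<^sub>R (z - x))) \<partial>lborel) \<longlonglongrightarrow> f x"
proof -
  let ?n = "CARD('n)"
  let ?w = "\<lambda>k z. complex_of_real (real (Suc k) ^ ?n * window (real (Suc k) *\<^sub>R (z - x)))"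
  define f1 where "f1 z = (if z \<in> cball x 1 then f z else 0)" for z
  define f2 where "f2 z = (if z \<in> cball x 1 then 0 else f z)" for z
  have [measurable]: "f \<in> borel_measurable borel" using i by auto
  have [measurable]: "cball x 1 \<in> sets borel" by (intro borel_closed closed_cball)
  have m1[measurable]: "f1 \<in> borel_measurable borel" unfolding f1_def by measurable
  have m2[measurable]: "f2 \<in> borel_measurable borel" unfolding f2_def by measurable
  have "bounded (f ` cball x 1)"
    by (intro compact_imp_bounded compact_continuous_image continuous_on_subset[OF c]) auto
  then obtain B0 where "\<And>z. z \<in> cball x 1 \<Longrightarrow> norm (f z) \<le> B0"
    unfolding bounded_iff by blast
  then have B: "norm (f1 z) \<le> \<bar>B0\<bar>" for z by (auto simp: f1_def intro: order_trans[OF _ abs_ge_self])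
  define B where "B = \<bar>B0\<bar>"
  \<comment> \<open>The substitution moves the scaling from the kernel to f1, so that a multiple of
    the fixed window dominates for every k.\<close>
  have sub: "(LBINT z. f1 z * (of_real (K ^ ?n) * complex_of_real (window (K *\<^sub>R (z - x)))))
      = (LBINT z. f1 (x + (1 / K) *\<^sub>R z) * window z)" if K: "0 < K" for K
  proof -
    let ?h = "\<lambda>z. f1 (x + (1 / K) *\<^sub>R z) * complex_of_real (window z)"
    have eq: "f1 z * (of_real (K ^ ?n) * complex_of_real (window (K *\<^sub>R (z - x)))) = of_real (K ^ ?n) * ?h ((- K *\<^sub>R x) + K *\<^sub>R z)" for z
      using K by (simp add: algebra_simps)
    have "(LBINT z. f1 z * (of_real (K ^ ?n) * complex_of_real (window (K *\<^sub>R (z - x)))))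
        = of_real (K ^ ?n) * (LBINT z. ?h ((- K *\<^sub>R x) + K *\<^sub>R z))"
      unfolding eq by (rule integral_mult_right_zero)
    also have "\<dots> = (LBINT z. ?h z)"
      by (subst lborel_integral_affine) (use K in \<open>auto simp: scaleR_conv_of_real divide_simps\<close>)
    finally show ?thesis .
  qed
  have "(\<lambda>k. \<integral>z. f1 (x + (1 / real (Suc k)) *\<^sub>R z) * window z \<partial>lborel) \<longlonglongrightarrow> (LBINT z. f x * complex_of_real (window (z::real^'n)))"
  proof (rule integral_dominated_convergence[where w="\<lambda>z::real^'n. B * window z"])
    show "integrable lborel (\<lambda>z::real^'n. B * window z)"
      using integrable_window by auto
    show "AE z in lborel. (\<lambda>k. f1 (x + (1 / real (Suc k)) *\<^sub>R z) * window z) \<longlonglongrightarrow> f x * complex_of_real (window z)"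
    proof (intro always_eventually allI)
      fix z :: "real^'n"
      have l0: "(\<lambda>k. 1 / real (Suc k)) \<longlonglongrightarrow> 0"
        using LIMSEQ_inverse_real_of_nat by (simp add: inverse_eq_divide)
      have l1: "(\<lambda>k. x + (1 / real (Suc k)) *\<^sub>R z) \<longlonglongrightarrow> x + 0 *\<^sub>R z"
        by (intro tendsto_intros l0)
      have "isCont f x" using c by (simp add: continuous_on_eq_continuous_at)
      then have l2: "(\<lambda>k. f (x + (1 / real (Suc k)) *\<^sub>R z)) \<longlonglongrightarrow> f x"
        using l1 isCont_tendsto_compose[of x f] by simp
      have "\<forall>\<^sub>F k in sequentially. x + (1 / real (Suc k)) *\<^sub>R z \<in> ball x 1"
        using l1 by (intro topological_tendstoD[of _ x]) auto
      then have "\<forall>\<^sub>F k in sequentially. f (x + (1 / real (Suc k)) *\<^sub>R z) = f1 (x + (1 / real (Suc k)) *\<^sub>R z)"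
        by eventually_elim (auto simp: f1_def)
      then have "(\<lambda>k. f1 (x + (1 / real (Suc k)) *\<^sub>R z)) \<longlonglongrightarrow> f x"
        using l2 by (rule Lim_transform_eventually[rotated])
      then show "(\<lambda>k. f1 (x + (1 / real (Suc k)) *\<^sub>R z) * window z) \<longlonglongrightarrow> f x * complex_of_real (window z)"
        by (intro tendsto_intros)
    qed
    show "AE z in lborel. norm (f1 (x + (1 / real (Suc k)) *\<^sub>R z) * complex_of_real (window z)) \<le> B * window z" for k
      using B by (auto simp: norm_mult B_def intro!: mult_right_mono)
  qed measurable
  also have "(LBINT z. f x * complex_of_real (window (z::real^'n))) = f x"
    using integral_window[where 'n='n] by simp
  finally have t1: "(\<lambda>k. \<integral>z. f1 z * ?w k z \<partial>lborel) \<longlonglongrightarrow> f x"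
    using sub[of "real (Suc _)"] by simp
  \<comment> \<open>Outside the unit ball around x the exponent of the scaled Gaussian is at most
    -(k+1), so \<open>c k\<close> bounds the kernel there.\<close>
  define c where "c k = real (Suc k) ^ ?n / exp (real (Suc k))" for k
  have c0: "c \<longlonglongrightarrow> 0"
    unfolding c_def by (rule filterlim_compose[OF tendsto_power_div_exp_0])
      (rule filterlim_compose[OF filterlim_real_sequentially filterlim_Suc])
  then have "Bseq c" by (rule convergent_imp_Bseq[OF convergentI])
  then obtain C where C: "\<And>k. norm (c k) \<le> C" unfolding Bseq_def by auto
  have wc: "norm (f2 z * ?w k z) \<le> norm (f z) * c k" for k z
  proof (cases "z \<in> cball x 1")
    case False
    then have "1 \<le> norm (z - x)" by (simp add: dist_norm norm_minus_commute)
    then have "real (Suc k) \<le> norm (real (Suc k) *\<^sub>R (z - x))"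
      by simp
    moreover define N where "N = norm (real (Suc k) *\<^sub>R (z - x))"
    moreover have "1 \<le> real (Suc k)" by simp
    ultimately have "real (Suc k) * 1 \<le> N * N"
      by (intro mult_mono) linarith+
    also have "\<dots> \<le> pi * (N * N)"
      using pi_gt3 by (intro mult_right_mono[of 1 pi "N * N", simplified mult_1]) auto
    finally have "real (Suc k) \<le> pi * N\<^sup>2"
      by (simp only: power2_eq_square mult_1_right)
    then have "- pi * N\<^sup>2 \<le> - real (Suc k)"
      by (simp only: mult_minus_left neg_le_iff_le)
    then have "window (real (Suc k) *\<^sub>R (z - x)) \<le> exp (- real (Suc k))"
      unfolding window_def N_def by (rule iffD2[OF exp_le_cancel_iff])
    then have "real (Suc k) ^ ?n * window (real (Suc k) *\<^sub>R (z - x)) \<le> c k"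
      unfolding c_def divide_inverse exp_minus[symmetric] by (intro mult_left_mono) (assumption, simp)
    then show ?thesis using False
      by (auto simp: f2_def norm_mult norm_power intro!: mult_left_mono simp del: of_nat_Suc)
  qed (auto simp: f2_def c_def)
  have "(\<lambda>k. \<integral>z. f2 z * ?w k z \<partial>lborel) \<longlonglongrightarrow> (\<integral>z. 0 \<partial>(lborel :: (real^'n) measure))"
  proof (rule integral_dominated_convergence[where w="\<lambda>z. norm (f z) * C"])
    show "integrable lborel (\<lambda>z. norm (f z) * C)"
      using i by auto
    show "AE z in lborel. norm (f2 z * ?w k z) \<le> norm (f z) * C" for k
      using wc[of _ k] C[of k] by (intro always_eventually allI order_trans[OF wc] mult_left_mono) auto
    show "AE z in lborel. (\<lambda>k. f2 z * ?w k z) \<longlonglongrightarrow> 0"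
    proof (intro always_eventually allI)
      fix z
      have "(\<lambda>k. norm (f z) * c k) \<longlonglongrightarrow> norm (f z) * 0" by (intro tendsto_intros c0)
      then show "(\<lambda>k. f2 z * ?w k z) \<longlonglongrightarrow> 0"
        by (intro Lim_null_comparison[OF always_eventually[OF allI[OF wc]]]) simp
    qed
  qed measurable
  then have t2: "(\<lambda>k. \<integral>z. f2 z * ?w k z \<partial>lborel) \<longlonglongrightarrow> 0" by simp
  have wle: "norm (?w k z) \<le> real (Suc k) ^ ?n" for k z
    unfolding norm_of_real abs_mult using window_le_1[of "real (Suc k) *\<^sub>R (z - x)"]
    by (simp add: mult_left_le del: of_nat_Suc)
  have ig: "integrable lborel (\<lambda>z. g z * ?w k z)"
    if [measurable]: "g \<in> borel_measurable borel" and g: "\<And>z. norm (g z) \<le> norm (f z)" for g k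
  proof (rule integrable_dominated)
    show "integrable lborel (\<lambda>z. norm (f z) * real (Suc k) ^ ?n)" using i by auto
    show "norm (g z * ?w k z) \<le> norm (f z) * real (Suc k) ^ ?n" for z
      unfolding norm_mult using wle[of k] by (intro mult_mono g) (auto simp del: of_real_mult of_real_power of_nat_Suc)
  qed measurable
  have i12: "integrable lborel (\<lambda>z. f1 z * ?w k z)" "integrable lborel (\<lambda>z. f2 z * ?w k z)" for k
    by (rule ig; simp add: f1_def f2_def)+
  have "(LBINT z. f z * ?w k z) = (LBINT z. f1 z * ?w k z) + (LBINT z. f2 z * ?w k z)" for k
    by (subst Bochner_Integration.integral_add[OF i12, symmetric])
      (auto intro!: Bochner_Integration.integral_cong simp: f1_def f2_def)
  then show ?thesis using tendsto_add[OF t1 t2] by simp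
qed

text \<open>Gauss summation: inserting a wide Gaussian into the inversion integral and interchanging
  integrals gives the mean of f against a narrow Gaussian around x. Both sides converge, the first
  because \<open>ft f\<close> is integrable, the second by \<open>gauss_approx\<close>.\<close>

lemma fourier_inversion:
  fixes f :: "real^'n::finite \<Rightarrow> complex"
  assumes c: "continuous_on UNIV f" and i: "integrable lborel f" and fi: "integrable lborel (ft f)"
  shows "(LBINT y. ft f y * ch (- (y \<bullet> x))) = f x"
proof -
  let ?n = "CARD('n)"
  have [measurable]: "f \<in> borel_measurable borel" using i by auto
  let ?A = "\<lambda>k. \<integral>y. ft f y * ch (- (y \<bullet> x)) * window ((1 / real (Suc k)) *\<^sub>R y) \<partial>lborel"
  have A: "?A \<longlonglongrightarrow> (LBINT y. ft f y * ch (- (y \<bullet> x)))"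
  proof (rule integral_dominated_convergence[where w="\<lambda>y. norm (ft f y)"])
    show "AE y in lborel. (\<lambda>k. ft f y * ch (- (y \<bullet> x)) * window ((1 / real (Suc k)) *\<^sub>R y)) \<longlonglongrightarrow> ft f y * ch (- (y \<bullet> x))"
    proof (intro always_eventually allI)
      fix y :: "real^'n"
      have l0: "(\<lambda>k. 1 / real (Suc k)) \<longlonglongrightarrow> 0"
        using LIMSEQ_inverse_real_of_nat by (simp add: inverse_eq_divide)
      have l1: "(\<lambda>k. window ((1 / real (Suc k)) *\<^sub>R y)) \<longlonglongrightarrow> window (0 *\<^sub>R y)"
        unfolding window_def by (intro tendsto_intros l0)
      have "(\<lambda>k. ft f y * ch (- (y \<bullet> x)) * window ((1 / real (Suc k)) *\<^sub>R y)) \<longlonglongrightarrow> ft f y * ch (- (y \<bullet> x)) * window (0 *\<^sub>R y)"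
        by (intro tendsto_intros l1)
      then show "(\<lambda>k. ft f y * ch (- (y \<bullet> x)) * window ((1 / real (Suc k)) *\<^sub>R y)) \<longlonglongrightarrow> ft f y * ch (- (y \<bullet> x))"
        by (simp add: window_def[of 0])
    qed
    show "AE y in lborel. norm (ft f y * ch (- (y \<bullet> x)) * window ((1 / real (Suc k)) *\<^sub>R y)) \<le> norm (ft f y)" for k
      by (intro always_eventually allI) (auto simp: norm_mult intro!: mult_left_le window_le_1)
  qed (use fi in auto)
  have "?A k = (LBINT z. f z * (real (Suc k) ^ ?n * window (real (Suc k) *\<^sub>R (z - x))))" for k
  proof -
    have "?A k = (LBINT y. (LBINT z. f z * (complex_of_real (window ((1 / real (Suc k)) *\<^sub>R y)) * ch (y \<bullet> (z - x)))))"
      unfolding ft_def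
      by (subst integral_mult_left_zero[symmetric], subst integral_mult_left_zero[symmetric])
        (auto intro!: Bochner_Integration.integral_cong simp: inner_diff_right ch_diff inner_commute algebra_simps)
    also have "\<dots> = (LBINT z. (LBINT y. f z * (complex_of_real (window ((1 / real (Suc k)) *\<^sub>R y)) * ch (y \<bullet> (z - x)))))"
    proof (rule Fubini_bound[where g="\<lambda>y::real^'n. window ((1 / real (Suc k)) *\<^sub>R y)" and h="\<lambda>z. norm (f z)"])
      show "integrable lborel (\<lambda>y::real^'n. window ((1 / real (Suc k)) *\<^sub>R y))"
        using lborel_integrable_affine[OF integrable_window, of "1 / real (Suc k)" 0] by simp
    qed (use i in \<open>auto simp: norm_mult\<close>)
    also have "\<dots> = (LBINT z. f z * (real (Suc k) ^ ?n * window (real (Suc k) *\<^sub>R (z - x))))"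
      by (subst integral_mult_right_zero, subst ft_window_scaled) auto
    finally show ?thesis .
  qed
  then show ?thesis using LIMSEQ_unique[OF A] gauss_approx[OF c i, of x] by simp
qed

section \<open>Cut-off functions\<close>

lemma continuous_on_integral_dominated:
  fixes F :: "'a::metric_space \<Rightarrow> 'b \<Rightarrow> 'c::{banach, second_countable_topology}"
  assumes [measurable]: "\<And>x. F x \<in> borel_measurable M"
    and c: "\<And>y. continuous_on UNIV (\<lambda>x. F x y)"
    and b: "\<And>x y. norm (F x y) \<le> w y" and w: "integrable M w"
  shows "continuous_on UNIV (\<lambda>x. \<integral>y. F x y \<partial>M)"
  unfolding continuous_on_sequentially
proof (intro allI ballI impI, elim conjE)
  fix u :: "nat \<Rightarrow> 'a" and x assume u: "u \<longlonglongrightarrow> x"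
  show "((\<lambda>x. \<integral>y. F x y \<partial>M) \<circ> u) \<longlonglongrightarrow> (\<integral>y. F x y \<partial>M)"
    unfolding comp_def
  proof (rule integral_dominated_convergence[where w=w])
    show "AE y in M. (\<lambda>i. F (u i) y) \<longlonglongrightarrow> F x y"
      using c u by (intro always_eventually allI) (auto simp: continuous_on_sequentially comp_def)
  qed (use b w in auto)
qed

section \<open>Convolutions and exponentially weighted decay\<close>

definition conv :: "(real^'n::finite \<Rightarrow> complex) \<Rightarrow> (real^'n \<Rightarrow> complex) \<Rightarrow> real^'n \<Rightarrow> complex" where
  "conv f g x = (LBINT y. f (x - y) * g y)"

lemma ft_conv:
  fixes f g :: "real^'n::finite \<Rightarrow> complex"
  assumes f: "integrable lborel f" and g: "integrable lborel g"
  shows "ft (conv f g) z = ft f z * ft g z"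
proof -
  have [measurable]: "f \<in> borel_measurable borel" "g \<in> borel_measurable borel" using f g by auto
  have int: "integrable (lborel \<Otimes>\<^sub>M lborel) (\<lambda>(y, x). f (x - y) * g y * ch (x \<bullet> z))"
  proof (rule lborel_pair.Fubini_integrable)
    have "integrable lborel (\<lambda>y. norm (g y) * (LBINT x. norm (f x)))" using g by simp
    then show "integrable lborel (\<lambda>y. \<integral>x. norm (case (y, x) of (y, x) \<Rightarrow> f (x - y) * g y * ch (x \<bullet> z)) \<partial>lborel)"
      by (simp add: norm_mult lborel_integral_translate(4)[where f="\<lambda>x. norm (f x)"] mult.commute)
    show "AE y in lborel. integrable lborel (\<lambda>x. case (y, x) of (y, x) \<Rightarrow> f (x - y) * g y * ch (x \<bullet> z))"
      using f by (auto intro!: integrable_mult_ch integrable_mult_left simp: lborel_integrable_translate(4))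
  qed measurable
  have "ft (conv f g) z = (LBINT x. (LBINT y. f (x - y) * g y * ch (x \<bullet> z)))"
    unfolding ft_def conv_def by simp
  also have "\<dots> = (LBINT y. (LBINT x. f (x - y) * g y * ch (x \<bullet> z)))"
    using lborel_pair.Fubini_integral[OF int] by simp
  also have "\<dots> = (LBINT y. (g y * ch (y \<bullet> z)) * ft f z)"
  proof (rule Bochner_Integration.integral_cong[OF refl])
    fix y
    have "f (x - y) * g y * ch (x \<bullet> z) = (g y * ch (y \<bullet> z)) * (f (x - y) * ch ((x - y) \<bullet> z))" for x
      using ch_add[of "y \<bullet> z" "(x - y) \<bullet> z"] by (simp add: inner_diff_left)
    then have "(LBINT x. f (x - y) * g y * ch (x \<bullet> z)) = (LBINT x. (g y * ch (y \<bullet> z)) * (f (x - y) * ch ((x - y) \<bullet> z)))"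
      by (simp only:)
    also have "\<dots> = (g y * ch (y \<bullet> z)) * (LBINT x. f (x - y) * ch ((x - y) \<bullet> z))"
      by simp
    also have "(LBINT x. f (x - y) * ch ((x - y) \<bullet> z)) = ft f z"
      unfolding ft_def by (rule lborel_integral_translate(4)[where f="\<lambda>x. f x * ch (x \<bullet> z)"])
    finally show "(LBINT x. f (x - y) * g y * ch (x \<bullet> z)) = (g y * ch (y \<bullet> z)) * ft f z" .
  qed
  also have "\<dots> = ft f z * ft g z"
    by (simp add: ft_def)
  finally show ?thesis .
qed

text \<open>Exponential weights are multiplicative, so they pass through convolutions; this is what makes
  iterated convolutions convenient cut-off functions here. In \<open>efd\<close> (exponentially weighted Fourier
  decay) the weights serve two purposes: quotients of Gaussian windows are exponentials, and inverse
  Gaussians are superpositions of exponentials.\<close>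

definition expw :: "real^'n::finite \<Rightarrow> (real^'n \<Rightarrow> complex) \<Rightarrow> real^'n \<Rightarrow> complex" where
  "expw c f t = complex_of_real (exp (c \<bullet> t)) * f t"

lemma expw_conv: "expw c (conv f g) = conv (expw c f) (expw c g)"
proof
  fix x
  have "exp (c \<bullet> x) = exp (c \<bullet> (x - y)) * exp (c \<bullet> y)" for y
    by (simp add: exp_add[symmetric] inner_diff_right)
  then have "expw c (conv f g) x = (LBINT y. complex_of_real (exp (c \<bullet> x)) * (f (x - y) * g y))"
    unfolding expw_def conv_def by simp
  also have "\<dots> = conv (expw c f) (expw c g) x"
    unfolding expw_def conv_def
  proof (rule Bochner_Integration.integral_cong[OF refl])
    fix y
    have "complex_of_real (exp (c \<bullet> x)) = complex_of_real (exp (c \<bullet> (x - y))) * complex_of_real (exp (c \<bullet> y))"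
      unfolding of_real_mult[symmetric] by (simp add: exp_add[symmetric] inner_diff_right)
    then show "complex_of_real (exp (c \<bullet> x)) * (f (x - y) * g y) =
        complex_of_real (exp (c \<bullet> (x - y))) * f (x - y) * (complex_of_real (exp (c \<bullet> y)) * g y)" by simp
  qed
  finally show "expw c (conv f g) x = conv (expw c f) (expw c g) x" .
qed

definition efd :: "real \<Rightarrow> (real^'n::finite \<Rightarrow> complex) \<Rightarrow> bool" where
  "efd N f \<longleftrightarrow> f \<in> borel_measurable borel \<and> bounded (range f) \<and> (\<exists>R. \<forall>t. R < norm t \<longrightarrow> f t = 0) \<and>
     (\<exists>C a. \<forall>c y. norm (ft (expw c f) y) \<le> C * exp (a * norm c) * japan y powr - N)"

lemma efdD:
  assumes "efd N f"
  obtains R B where "0 < R" "0 < B" "\<And>t. R < norm t \<Longrightarrow> f t = 0" "\<And>t. norm (f t) \<le> B * indicator (cball 0 R) t"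
proof -
  obtain R0 B0 where R: "\<And>t. R0 < norm t \<Longrightarrow> f t = 0" and B: "\<And>t. norm (f t) \<le> B0"
    using assms unfolding efd_def bounded_iff by auto
  show ?thesis
  proof (rule that[of "max R0 1" "max B0 1"])
    show "norm (f t) \<le> max B0 1 * indicator (cball 0 (max R0 1)) t" for t
      using R[of t] B[of t] by (auto simp: indicator_def)
  qed (use R in auto)
qed

lemma efdE:
  fixes f :: "real^'n::finite \<Rightarrow> complex"
  assumes "efd N f"
  obtains C a where "0 < C" "0 < a" "\<And>c y. norm (ft (expw c f) y) \<le> C * exp (a * norm c) * japan y powr - N"
proof -
  obtain C a where C: "\<And>c y. norm (ft (expw c f) y) \<le> C * exp (a * norm c) * japan y powr - N"
    using assms unfolding efd_def by auto
  show ?thesis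
  proof (rule that[of "\<bar>C\<bar> + 1" "\<bar>a\<bar> + 1"])
    fix c y :: "real^'n"
    have "a * norm c \<le> (\<bar>a\<bar> + 1) * norm c" by (intro mult_right_mono) auto
    then have "C * exp (a * norm c) \<le> (\<bar>C\<bar> + 1) * exp ((\<bar>a\<bar> + 1) * norm c)" by (intro mult_mono) auto
    then show "norm (ft (expw c f) y) \<le> (\<bar>C\<bar> + 1) * exp ((\<bar>a\<bar> + 1) * norm c) * japan y powr - N"
      by (intro order_trans[OF C] mult_right_mono) auto
  qed auto
qed

lemma integrable_indicator_cball: "integrable lborel (indicator (cball x R) :: 'a::euclidean_space \<Rightarrow> real)"
  by (subst integrable_indicator_iff) (use emeasure_lborel_cball_finite[of x R] in auto)

lemma efd_integrable:
  assumes "efd N f" and [measurable]: "g \<in> borel_measurable borel" and b: "bounded (g ` {t. f t \<noteq> 0})"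
  shows "integrable lborel (\<lambda>t. g t * f t)"
proof -
  obtain R B where f: "\<And>t. R < norm t \<Longrightarrow> f t = 0" "\<And>t. norm (f t) \<le> B * indicator (cball 0 R) t" 
    using efdD[OF assms(1)] by metis
  obtain D where D: "\<And>t. f t \<noteq> 0 \<Longrightarrow> norm (g t) \<le> D" using b unfolding bounded_iff by auto
  have [measurable]: "f \<in> borel_measurable borel" using assms(1) by (simp add: efd_def)
  have "integrable lborel (\<lambda>t. (\<bar>D\<bar> * B) * indicator (cball 0 R) t)"
    by (intro integrable_mult_right integrable_indicator_cball)
  then show ?thesis
  proof (rule integrable_dominated)
    show "norm (g t * f t) \<le> \<bar>D\<bar> * B * indicator (cball 0 R) t" for t
    proof -
      have "norm (g t * f t) \<le> \<bar>D\<bar> * (B * indicator (cball 0 R) t)"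
      proof (cases "f t = 0")
        case True
        then show ?thesis using f(2)[of t] by simp
      next
        case False
        then show ?thesis using D[OF False] unfolding norm_mult by (intro mult_mono f(2)) auto
      qed
      then show ?thesis by (simp add: mult.assoc)
    qed
  qed measurable
qed

lemma bounded_on_efd_support:
  assumes "efd N f" and "continuous_on UNIV g"
  shows "bounded (g ` {t. f t \<noteq> 0})"
proof -
  obtain R where f: "\<And>t. R < norm t \<Longrightarrow> f t = 0" 
    using efdD[OF assms(1)] by metis
  have "bounded (g ` cball 0 R)"
    by (intro compact_imp_bounded compact_continuous_image continuous_on_subset[OF assms(2)]) auto
  then show ?thesis by (rule bounded_subset) (use f not_less in force)
qed

lemma continuous_on_mult_efd_integrable:
  assumes "efd N f" and "continuous_on UNIV g"
  shows "integrable lborel (\<lambda>t. g t * f t)"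
  using assms by (intro efd_integrable bounded_on_efd_support borel_measurable_continuous_onI)

lemma integrable_expw:
  assumes "efd N f"
  shows "integrable lborel (expw c f)"
  unfolding expw_def by (rule continuous_on_mult_efd_integrable[OF assms]) (intro continuous_intros)

lemma efd_integrable': "efd N f \<Longrightarrow> integrable lborel f"
  using continuous_on_mult_efd_integrable[of N f "\<lambda>_. 1"] by simp

lemma continuous_conv:
  assumes f: "efd N f" "continuous_on UNIV f" and g: "integrable lborel g"
  shows "continuous_on UNIV (conv f g)"
proof -
  have [measurable]: "f \<in> borel_measurable borel" "g \<in> borel_measurable borel"
    using assms by (auto simp: efd_def)
  obtain B where B: "\<And>t. norm (f t) \<le> B" using f(1) unfolding efd_def bounded_iff by auto
  show ?thesis
    unfolding conv_def
  proof (rule continuous_on_integral_dominated[where w="\<lambda>y. B * norm (g y)"])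
    show "continuous_on UNIV (\<lambda>x. f (x - y) * g y)" for y
      by (intro continuous_intros continuous_on_compose2[OF f(2)]) auto
  qed (use B g in \<open>auto simp: norm_mult intro!: mult_right_mono\<close>)
qed

text \<open>The weights pass through the convolution and transforms multiply, so the orders of decay
  add. Continuity is asked of one factor only: the other may be an indicator function, as in
  \<open>plateau_exists\<close>.\<close>

lemma efd_conv:
  assumes f: "efd N f" "continuous_on UNIV f" and g: "efd M g"
  shows "efd (N + M) (conv f g)"
proof -
  have [measurable]: "f \<in> borel_measurable borel" "g \<in> borel_measurable borel"
    using assms by (auto simp: efd_def)
  obtain Rf Bf where fR: "0 < Rf" "0 < Bf" "\<And>t. Rf < norm t \<Longrightarrow> f t = 0" "\<And>t. norm (f t) \<le> Bf * indicator (cball 0 Rf) t"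
    using efdD[OF f(1)] by metis
  obtain Rg Bg where gR: "0 < Rg" "\<And>t. Rg < norm t \<Longrightarrow> g t = 0"
    using efdD[OF g(1)] by metis
  have gi: "integrable lborel g" by (rule efd_integrable'[OF g])
  have cont: "continuous_on UNIV (conv f g)" by (rule continuous_conv[OF f gi])
  have supp: "conv f g t = 0" if "Rf + Rg < norm t" for t
  proof -
    have "f (t - y) * g y = 0" for y
    proof (cases "Rg < norm y")
      case False
      then have "Rf < norm (t - y)" using that norm_triangle_ineq2[of t y] by linarith
      then show ?thesis by (simp add: fR)
    qed (simp add: gR)
    then show ?thesis by (simp only: conv_def) simp
  qed
  have "bounded (conv f g ` cball 0 (Rf + Rg))"
    by (intro compact_imp_bounded compact_continuous_image continuous_on_subset[OF cont]) auto
  then have "bounded (insert 0 (conv f g ` cball 0 (Rf + Rg)))" by simp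
  then have bd: "bounded (range (conv f g))"
    by (rule bounded_subset) (use supp not_less in force)
  obtain C a where C: "0 < C" "\<And>c y. norm (ft (expw c f) y) \<le> C * exp (a * norm c) * japan y powr - N"
    using efdE[OF f(1)] by metis
  obtain D b where D: "0 < D" "\<And>c y. norm (ft (expw c g) y) \<le> D * exp (b * norm c) * japan y powr - M"
    using efdE[OF g(1)] by metis
  have "norm (ft (expw c (conv f g)) y) \<le> (C * D) * exp ((a + b) * norm c) * japan y powr - (N + M)" for c y
  proof -
    have "norm (ft (expw c (conv f g)) y) = norm (ft (expw c f) y) * norm (ft (expw c g) y)"
      unfolding expw_conv by (subst ft_conv) (auto simp: norm_mult integrable_expw[OF f(1)] integrable_expw[OF g])
    also have "\<dots> \<le> (C * exp (a * norm c) * japan y powr - N) * (D * exp (b * norm c) * japan y powr - M)"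
      using C(1) by (intro mult_mono C(2) D(2)) auto
    also have "\<dots> = (C * D) * (exp (a * norm c) * exp (b * norm c)) * (japan y powr - N * japan y powr - M)"
      by (simp only: mult_ac)
    also have "\<dots> = (C * D) * exp ((a + b) * norm c) * japan y powr - (N + M)"
      by (simp add: exp_add[symmetric] powr_add[symmetric] algebra_simps)
    finally show ?thesis .
  qed
  then show ?thesis
    unfolding efd_def using bd supp borel_measurable_continuous_onI[OF cont] by blast
qed

lemma norm_expw_le: "norm (expw c f t) \<le> exp (norm c * norm t) * norm (f t)"
  unfolding expw_def norm_mult using norm_cauchy_schwarz[of c t]
  by (intro mult_right_mono) auto

text \<open>Without any smoothness, the trivial bound of a transform by the L^1 norm gives decay of
  order 0; on the support the weight is at most \<open>exp (R * norm c)\<close>.\<close>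

lemma efd_zero:
  fixes f :: "real^'n::finite \<Rightarrow> complex"
  assumes m[measurable]: "f \<in> borel_measurable borel" and b: "bounded (range f)" and R: "\<And>t. R < norm t \<Longrightarrow> f t = 0"
  shows "efd 0 f"
proof -
  obtain B where B: "\<And>t. norm (f t) \<le> B" using b unfolding bounded_iff by auto
  let ?I = "\<lambda>t::real^'n. indicator (cball 0 R) t :: real"
  have "norm (ft (expw c f) y) \<le> B * (LBINT t. ?I t) * exp (R * norm c) * japan y powr - 0" for c y
  proof -
    have 1: "norm (expw c f t) \<le> exp (R * norm c) * (B * ?I t)" for t
    proof (cases "R < norm t")
      case False
      then have "norm c * norm t \<le> R * norm c" using mult_right_mono[of "norm t" R "norm c"] by (simp add: mult.commute)
      then have "norm (expw c f t) \<le> exp (R * norm c) * B"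
        by (intro order_trans[OF norm_expw_le] mult_mono B) auto
      then show ?thesis using False by simp
    qed (simp add: R expw_def)
    have "norm (ft (expw c f) y) \<le> (LBINT t. exp (R * norm c) * (B * ?I t))"
      unfolding ft_def by (intro norm_integral_dominated integrable_mult_right integrable_indicator_cball)
        (use 1 in \<open>auto simp: norm_mult\<close>)
    also have "\<dots> = B * (LBINT t. ?I t) * exp (R * norm c)" by simp
    finally show ?thesis by simp
  qed
  then show ?thesis unfolding efd_def using m b R by blast
qed

text \<open>A compactly supported Lipschitz function, whose transform decays to first order. Its
  iterated convolutions take the place of smooth bump functions, one order of decay being gained at
  each step.\<close>

definition tent :: "real^'n::finite \<Rightarrow> complex" where
  "tent t = complex_of_real (max 0 (1 - norm t))"

lemma abs_exp_diff_le:
  fixes a b M :: real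
  assumes "a \<le> M" "b \<le> M"
  shows "\<bar>exp a - exp b\<bar> \<le> exp M * \<bar>a - b\<bar>"
proof -
  have *: "exp x - exp y \<le> exp M * \<bar>x - y\<bar>" if "x \<le> M" for x y :: real
  proof -
    have "exp x - exp y = exp x * (1 - exp (y - x))" by (simp add: exp_diff field_simps)
    also have "\<dots> \<le> exp x * \<bar>x - y\<bar>"
      using exp_ge_add_one_self[of "y - x"] abs_ge_self[of "x - y"] by (intro mult_left_mono; linarith?) simp
    also have "\<dots> \<le> exp M * \<bar>x - y\<bar>" using that by (intro mult_right_mono) auto
    finally show ?thesis .
  qed
  show ?thesis using *[of a b] *[of b a] assms by (simp add: abs_le_iff abs_minus_commute)
qed

text \<open>The Fourier transform of a Lipschitz function \<open>G\<close> decays like \<open>1/|y|\<close>: a translation by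
  \<open>y / (2|y|\<^sup>2)\<close> changes the sign of the character, so \<open>2 ft G y\<close> is the transform of a difference.\<close>

lemma efd_tent: "efd 1 (tent :: real^'n::finite \<Rightarrow> complex)"
proof -
  have cont: "continuous_on UNIV (tent :: real^'n \<Rightarrow> complex)"
    unfolding tent_def by (intro continuous_intros)
  have supp: "tent t = 0" if "1 \<le> norm t" for t :: "real^'n" using that by (simp add: tent_def)
  have le1: "norm (tent t) \<le> 1" for t :: "real^'n" by (simp add: tent_def)
  have meas[measurable]: "tent \<in> borel_measurable (borel :: (real^'n) measure)" by (rule borel_measurable_continuous_onI[OF cont])
  have bdd: "bounded (range (tent :: real^'n \<Rightarrow> complex))" using le1 by (auto simp: bounded_iff)
  have e0: "efd 0 (tent :: real^'n \<Rightarrow> complex)" by (rule efd_zero[OF meas bdd, of 1]) (use supp in auto)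
  obtain C0 a0 where C0: "0 < C0" "0 < a0" "\<And>c y. norm (ft (expw c tent) (y::real^'n)) \<le> C0 * exp (a0 * norm c) * japan y powr - 0"
    using efdE[OF e0] by metis
  define V where "V = (\<integral>t. indicator (cball (0::real^'n) 2) t \<partial>lborel :: real)"
  have V0: "0 \<le> V" unfolding V_def by (intro integral_nonneg_AE) auto
  have large: "norm (ft (expw c tent) y) \<le> V * exp (3 * norm c) * japan y powr - 1" if y: "1 \<le> norm y" for c y :: "real^'n"
  proof -
    define \<tau> where "\<tau> = (1 / (2 * (norm y)\<^sup>2)) *\<^sub>R y"
    have \<tau>y: "\<tau> \<bullet> y = 1 / 2" using y by (auto simp: \<tau>_def power2_norm_eq_inner)
    have n\<tau>: "norm \<tau> = 1 / (2 * norm y)" using y by (simp add: \<tau>_def power2_eq_square)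
    have n\<tau>1: "norm \<tau> \<le> 1 / 2" unfolding n\<tau> using y by (simp add: divide_simps)
    let ?G = "expw c tent"
    have int: "integrable lborel ?G" "integrable lborel (\<lambda>t. ?G (t + \<tau>))"
      using integrable_expw[OF e0, of c] by (auto simp: lborel_integrable_translate(2))
    have "ft ?G y = (LBINT t. ?G (t + \<tau>) * ch ((t + \<tau>) \<bullet> y))"
      unfolding ft_def by (rule lborel_integral_translate(2)[symmetric])
    also have "\<dots> = - (LBINT t. ?G (t + \<tau>) * ch (t \<bullet> y))"
      by (simp add: inner_add_left ch_add \<tau>y) (simp add: ch_def)
    finally have "2 * ft ?G y = ft ?G y - (LBINT t. ?G (t + \<tau>) * ch (t \<bullet> y))" by simp
    also have "\<dots> = (LBINT t. (?G t - ?G (t + \<tau>)) * ch (t \<bullet> y))"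
      unfolding ft_def left_diff_distrib using int
      by (intro Bochner_Integration.integral_diff[symmetric] integrable_mult_ch) auto
    finally have "2 * norm (ft ?G y) = norm (LBINT t. (?G t - ?G (t + \<tau>)) * ch (t \<bullet> y))"
      by (metis norm_mult norm_numeral)
    \<comment> \<open>As norm \<tau> \<le> 1/2, both terms of the difference vanish for norm t >
      3/2, well inside the ball of radius 2.\<close>
    also have "\<dots> \<le> (LBINT t. (exp (3 * norm c) * norm \<tau>) * indicator (cball (0::real^'n) 2) t)"
    proof (intro norm_integral_dominated integrable_mult_right integrable_indicator_cball)
        fix t :: "real^'n"
        show "norm ((?G t - ?G (t + \<tau>)) * ch (t \<bullet> y)) \<le> (exp (3 * norm c) * norm \<tau>) * indicator (cball 0 2) t"
        proof (cases "norm t \<le> 3/2")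
          case False
          then have "1 \<le> norm (t + \<tau>)" using n\<tau>1 norm_triangle_ineq2[of t "-\<tau>"] by simp
          then show ?thesis using False by (simp add: expw_def supp)
        next
          case True
          have n2: "norm (t + \<tau>) \<le> 2" using norm_triangle_ineq[of t \<tau>] True n\<tau>1 by simp
          have cb: "c \<bullet> z \<le> 2 * norm c" if "norm z \<le> 2" for z
            using norm_cauchy_schwarz[of c z] mult_left_mono[OF that, of "norm c"] by simp
          let ?a = "complex_of_real (exp (c \<bullet> t))" and ?b = "complex_of_real (exp (c \<bullet> (t + \<tau>)))"
          have "?G t - ?G (t + \<tau>) = (?a - ?b) * tent t + ?b * (tent t - tent (t + \<tau>))"
            by (simp add: expw_def algebra_simps)
          then have "norm (?G t - ?G (t + \<tau>)) \<le> norm (?a - ?b) * norm (tent t) + norm ?b * norm (tent t - tent (t + \<tau>))"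
            by (metis norm_mult norm_triangle_ineq)
          also have "\<dots> \<le> (exp (2 * norm c) * (norm c * norm \<tau>)) * 1 + exp (2 * norm c) * norm \<tau>"
          proof (intro add_mono mult_mono le1)
            have "norm (?a - ?b) = \<bar>exp (c \<bullet> t) - exp (c \<bullet> (t + \<tau>))\<bar>"
              by (simp only: of_real_diff[symmetric] norm_of_real)
            also have "\<dots> \<le> exp (2 * norm c) * \<bar>c \<bullet> t - c \<bullet> (t + \<tau>)\<bar>"
              by (intro abs_exp_diff_le cb n2) (use True in auto)
            also have "\<dots> \<le> exp (2 * norm c) * (norm c * norm \<tau>)"
              using Cauchy_Schwarz_ineq2[of c \<tau>] by (intro mult_left_mono) (auto simp: inner_add_right)
            finally show "norm (?a - ?b) \<le> exp (2 * norm c) * (norm c * norm \<tau>)" .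
            show "norm ?b \<le> exp (2 * norm c)" using cb[OF n2] by simp
            have "norm (tent t - tent (t + \<tau>)) = \<bar>max 0 (1 - norm t) - max 0 (1 - norm (t + \<tau>))\<bar>"
              by (simp only: tent_def of_real_diff[symmetric] norm_of_real)
            also have "\<dots> \<le> \<bar>norm (t + \<tau>) - norm t\<bar>" by linarith
            also have "\<dots> \<le> norm \<tau>" using norm_triangle_ineq3[of "t + \<tau>" t] by simp
            finally show "norm (tent t - tent (t + \<tau>)) \<le> norm \<tau>" .
          qed auto
          also have "\<dots> = exp (2 * norm c) * (1 + norm c) * norm \<tau>" by (simp add: algebra_simps)
          \<comment> \<open>The factor 1 + norm c, due to the Lipschitz constant of the weight, is
            absorbed by raising the exponential rate from 2 to 3.\<close>
          also have "\<dots> \<le> exp (2 * norm c) * exp (norm c) * norm \<tau>"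
            by (intro mult_right_mono mult_left_mono exp_ge_add_one_self) auto
          also have "\<dots> = exp (3 * norm c) * norm \<tau>" by (simp add: exp_add[symmetric])
          finally show ?thesis using True by (simp add: norm_mult)
        qed
    qed
    also have "\<dots> = exp (3 * norm c) * norm \<tau> * V" by (simp add: V_def)
    finally have "norm (ft ?G y) \<le> V * exp (3 * norm c) * (1 / (4 * norm y))" by (simp add: n\<tau> field_simps)
    also have "\<dots> \<le> V * exp (3 * norm c) * japan y powr - 1"
    proof (intro mult_left_mono)
      have "japan y \<le> 4 * norm y" using japan_le[of y] y by simp
      then show "1 / (4 * norm y) \<le> japan y powr - 1"
        by (simp add: powr_minus_divide) (intro divide_left_mono mult_pos_pos; use y in auto)
    qed (use V0 in auto)
    finally show ?thesis .
  qed
  \<comment> \<open>For norm y < 1 the weight \<open>japan y\<close> is at most 2, so the bound of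
    order 0 loses only a factor 2.\<close>
  have "norm (ft (expw c tent) y) \<le> (2 * C0 + V) * exp ((a0 + 3) * norm c) * japan y powr - 1" for c y :: "real^'n"
  proof (cases "1 \<le> norm y")
    case True
    have "V * exp (3 * norm c) \<le> (2 * C0 + V) * exp ((a0 + 3) * norm c)"
      using V0 C0(1,2) by (intro mult_mono) (auto simp: distrib_right)
    then show ?thesis by (intro order_trans[OF large[OF True]] mult_right_mono) auto
  next
    case False
    then have j2: "1 \<le> 2 * japan y powr - 1"
      using japan_le[of y] by (simp add: powr_minus_divide divide_simps)
    have "norm (ft (expw c tent) y) \<le> C0 * exp (a0 * norm c) * 1"
      using C0(3)[of c y] by simp
    also have "\<dots> \<le> C0 * exp (a0 * norm c) * (2 * japan y powr - 1)"
      using C0(1) by (intro mult_left_mono j2) auto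
    also have "\<dots> = (2 * C0) * exp (a0 * norm c) * japan y powr - 1" by simp
    also have "\<dots> \<le> (2 * C0 + V) * exp ((a0 + 3) * norm c) * japan y powr - 1"
      using V0 C0(1,2) by (intro mult_mono) (auto simp: distrib_right)
    finally show ?thesis .
  qed
  then show ?thesis unfolding efd_def using meas bdd supp less_imp_le by blast
qed

lemma integral_tent: "(\<integral>t. tent t \<partial>(lborel :: (real^'n::finite) measure)) \<noteq> 0"
proof
  assume 0: "(\<integral>t. tent t \<partial>(lborel :: (real^'n::finite) measure)) = 0"
  let ?f = "\<lambda>t::real^'n. max 0 (1 - norm t)"
  have i: "integrable lborel ?f"
    using integrable_Re[OF efd_integrable'[OF efd_tent[where 'n='n]]] by (simp add: tent_def)
  have "complex_of_real (LBINT t. ?f t) = 0"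
    using 0 unfolding tent_def by simp
  then have "(LBINT t. ?f t) = 0" by simp
  then have "AE t in lborel. ?f t = 0"
    using integral_nonneg_eq_0_iff_AE[OF i] by auto
  then have "emeasure lborel {t. ?f t \<noteq> 0} = 0"
    by (subst (asm) AE_iff_measurable[OF _ refl]) auto
  moreover have "{t. ?f t \<noteq> 0} = ball 0 1" by (auto simp: max_def)
  ultimately have "emeasure lborel (ball (0::real^'n) 1) = 0" by simp
  then show False by (simp add: emeasure_ball unit_ball_vol_pos ennreal_eq_0_iff) (use unit_ball_vol_pos[of "real CARD('n)"] in linarith)
qed

lemma ft_zero: "ft f 0 = (LBINT y. f y)"
  by (simp add: ft_def)

lemma efd_divide:
  assumes e: "efd N f"
  shows "efd N (\<lambda>t. f t / z)"
proof -
  obtain R where R: "\<And>t. R < norm t \<Longrightarrow> f t = 0" using efdD[OF e] by metis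
  obtain B where B: "\<And>t. norm (f t) \<le> B" using e unfolding efd_def bounded_iff by auto
  obtain C a where C: "\<And>c y. norm (ft (expw c f) y) \<le> C * exp (a * norm c) * japan y powr - N"
    using efdE[OF e] by metis
  have "ft (expw c (\<lambda>t. f t / z)) y = ft (expw c f) y / z" for c y
    by (simp add: ft_def expw_def)
  then have "norm (ft (expw c (\<lambda>t. f t / z)) y) \<le> (C / norm z) * exp (a * norm c) * japan y powr - N" for c y
    using divide_right_mono[OF C[of c y], of "norm z"] by (simp add: norm_divide)
  then have "\<exists>C a. \<forall>c y. norm (ft (expw c (\<lambda>t. f t / z)) y) \<le> C * exp (a * norm c) * japan y powr - N" by blast
  moreover have "norm (f t / z) \<le> B / norm z" for t
    using divide_right_mono[OF B[of t], of "norm z"] by (simp add: norm_divide)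
  then have "bounded (range (\<lambda>t. f t / z))" unfolding bounded_iff by auto
  moreover have "(\<lambda>t. f t / z) \<in> borel_measurable borel"
    using e by (auto simp: efd_def)
  ultimately show ?thesis unfolding efd_def using R by auto
qed

text \<open>Convolving with \<open>tent\<close> again and again; since the value of the transform at
  0 is the integral, the integral stays nonzero and can be normalised. Integral 1 makes the
  translates of \<beta> a continuous partition of unity.\<close>

lemma spline_exists:
  fixes N :: nat
  shows "\<exists>\<beta> :: real^'n::finite \<Rightarrow> complex. continuous_on UNIV \<beta> \<and> efd (real (Suc N)) \<beta> \<and> (LBINT t. \<beta> t) = 1"
proof (induction N)
  case 0
  define I where "I = (\<integral>t. tent t \<partial>(lborel :: (real^'n) measure))"
  have I: "I \<noteq> 0" using integral_tent[where 'n='n] by (simp add: I_def)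
  let ?\<beta> = "\<lambda>t::real^'n. tent t / I"
  have "continuous_on UNIV ?\<beta>" unfolding tent_def using I by (intro continuous_intros) auto
  moreover have "(LBINT t. ?\<beta> t) = 1" using I by (simp add: I_def)
  ultimately show ?case using efd_divide[OF efd_tent, where z=I] by auto
next
  case (Suc N)
  then obtain \<beta> :: "real^'n \<Rightarrow> complex" where \<beta>: "continuous_on UNIV \<beta>" "efd (real (Suc N)) \<beta>" "(LBINT t. \<beta> t) = 1"
    by blast
  define I where "I = (\<integral>t. tent t \<partial>(lborel :: (real^'n) measure))"
  have I: "I \<noteq> 0" using integral_tent[where 'n='n] by (simp add: I_def)
  let ?c = "conv \<beta> (tent :: real^'n \<Rightarrow> complex)"
  have e: "efd (real (Suc N) + 1) ?c" by (intro efd_conv \<beta> efd_tent)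
  have cont: "continuous_on UNIV ?c" by (intro continuous_conv[OF \<beta>(2,1)] efd_integrable'[OF efd_tent])
  have int: "(LBINT t. ?c t) = I"
    using ft_conv[OF efd_integrable'[OF \<beta>(2)] efd_integrable'[OF efd_tent], of 0] \<beta>(3) by (simp add: ft_zero I_def)
  let ?d = "\<lambda>t. ?c t / I"
  have "continuous_on UNIV ?d" using I by (intro continuous_intros cont) auto
  moreover have "(LBINT t. ?d t) = 1" using I int by simp
  ultimately show ?case using efd_divide[OF e, of I] by (auto simp: add.commute)
qed

text \<open>If \<beta> has integral 1 and support in the ball of radius Q, averaging the indicator
  of the ball of radius R + Q against \<beta> leaves the value 1 on the ball of radius R.\<close>

lemma plateau_exists:
  fixes N :: nat and R :: real
  shows "\<exists>\<beta> :: real^'n::finite \<Rightarrow> complex. continuous_on UNIV \<beta> \<and> efd (real (Suc N)) \<beta> \<and> (\<forall>t. norm t \<le> R \<longrightarrow> \<beta> t = 1)"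
proof -
  obtain \<beta> :: "real^'n \<Rightarrow> complex" where \<beta>: "continuous_on UNIV \<beta>" "efd (real (Suc N)) \<beta>" "(LBINT t. \<beta> t) = 1"
    using spline_exists by blast
  obtain Q where Q: "0 < Q" "\<And>t. Q < norm t \<Longrightarrow> \<beta> t = 0"
    using efdD[OF \<beta>(2)] by metis
  define g where "g = (indicator (cball (0::real^'n) (R + Q)) :: real^'n \<Rightarrow> complex)"
  have "norm (g x) \<le> 1" for x by (auto simp: g_def indicator_def)
  then have bg: "bounded (range g)" by (auto simp: bounded_iff)
  have [measurable]: "cball (0::real^'n) (R + Q) \<in> sets borel" by (intro borel_closed closed_cball)
  have gm: "g \<in> borel_measurable borel" unfolding g_def by measurable
  have e: "efd 0 g" by (rule efd_zero[OF gm bg, of "R + Q"]) (auto simp: g_def)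
  have "conv \<beta> g t = 1" if "norm t \<le> R" for t
  proof -
    have "\<beta> (t - y) * g y = \<beta> (t - y)" for y
    proof (cases "norm y \<le> R + Q")
      case False
      then have "Q < norm (t - y)" using that norm_triangle_ineq2[of y t] by (simp add: norm_minus_commute)
      then show ?thesis by (simp add: Q)
    qed (simp add: g_def)
    then show ?thesis unfolding conv_def by (simp only:) (simp add: \<beta>(3) lborel_integral_translate(3))
  qed
  moreover have "continuous_on UNIV (conv \<beta> g)" by (rule continuous_conv[OF \<beta>(2,1) efd_integrable'[OF e]])
  ultimately show ?thesis using efd_conv[OF \<beta>(2,1) e] by auto
qed

section \<open>Local representations as Fourier transforms of decaying functions\<close>

text \<open>In contrast to \<open>japan_add\<close>, only one weight is spent: one of the two
  summands carries at least half the weight of the sum, and the decay in the other stays available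
  for integration.\<close>

lemma japan_add_max: "japan (x + y) \<le> 2 * max (japan x) (japan y)"
proof -
  have *: "japan (x + y) \<le> 2 * japan y" if "norm x \<le> norm y" for x y :: "real^'n::finite"
  proof -
    have "norm (x + y) \<le> 2 * norm y" using norm_triangle_ineq[of x y] that by linarith
    then have "(norm (x + y))\<^sup>2 \<le> (2 * norm y)\<^sup>2" by (intro power_mono) auto
    then have "1 + (norm (x + y))\<^sup>2 \<le> (2 * japan y)\<^sup>2"
      by (simp add: power_mult_distrib japan_def)
    then show ?thesis unfolding japan_def[of "x + y"] by (intro real_le_lsqrt) auto
  qed
  show ?thesis
  proof (cases "norm x \<le> norm y")
    case True
    show ?thesis using *[OF True] max.cobounded2[of "japan y" "japan x"] by simp
  next
    case False
    then show ?thesis using *[of y x] max.cobounded1[of "japan x" "japan y"] by (simp add: add.commute)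
  qed
qed

text \<open>The type argument records the dimension, on which the integral depends.\<close>

definition jint :: "'n::finite itself \<Rightarrow> real \<Rightarrow> real" where
  "jint _ s = (LBINT y. japan (y :: real^'n) powr - s)"

lemma jint_nonneg: "0 \<le> jint TYPE('n::finite) s"
  unfolding jint_def by (intro integral_nonneg_AE) auto

lemma jint_pos: "real CARD('n::finite) < s \<Longrightarrow> 0 < jint TYPE('n) s"
proof -
  assume s: "real CARD('n) < s"
  have "jint TYPE('n) s \<noteq> 0"
  proof
    assume "jint TYPE('n) s = 0"
    then have "AE y in lborel. japan (y :: real^'n) powr - s = 0"
      unfolding jint_def using integral_nonneg_eq_0_iff_AE[OF integrable_japan_powr[OF s]] by auto
    then have "AE y in (lborel :: (real^'n) measure). False" by simp
    then show False by (simp add: AE_iff_null null_sets_def)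
  qed
  then show ?thesis using jint_nonneg[where 'n='n and s=s] by linarith
qed

text \<open>The constant of the convolution algebra: \<open>2 powr s\<close> stems from
  \<open>japan_add_max\<close>, and one integral is paid for each of the two summands that may be
  the larger one.\<close>

definition kconst :: "'n::finite itself \<Rightarrow> real \<Rightarrow> real" where
  "kconst T s = 2 powr s * (2 * jint T s)"

lemma kconst_pos: "real CARD('n::finite) < s \<Longrightarrow> 0 < kconst TYPE('n) s"
  using jint_pos[where 'n='n] by (simp add: kconst_def)

text \<open>For z = (z - y) + y, the factor belonging to the larger summand is at most
  \<open>2 powr s * japan z powr - s\<close>; the other factor is kept and is integrable in
  y.\<close>

lemma japan_powr_conv_pointwise:
  assumes "0 \<le> s"
  shows "japan (z - y) powr - s * japan y powr - s \<le> 2 powr s * (japan z powr - s * (japan (z - y) powr - s + japan y powr - s))"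
proof -
  have *: "a powr - s * b powr - s \<le> 2 powr s * (japan z powr - s * (a powr - s + b powr - s))"
    if "japan z \<le> 2 * b" "0 < a" "0 < b" for a b
  proof -
    have "(2 * b) powr - s \<le> japan z powr - s" using that assms by (intro powr_mono2') auto
    then have "2 powr s * (2 powr - s * b powr - s) \<le> 2 powr s * japan z powr - s"
      using that by (intro mult_left_mono) (auto simp: powr_mult)
    then have b: "b powr - s \<le> 2 powr s * japan z powr - s"
      by (simp add: mult.assoc[symmetric] powr_add[symmetric])
    have "a powr - s * b powr - s \<le> a powr - s * (2 powr s * japan z powr - s)"
      by (intro mult_left_mono b) auto
    also have "\<dots> \<le> (a powr - s + b powr - s) * (2 powr s * japan z powr - s)"
      by (intro mult_right_mono) auto
    finally show ?thesis by (simp add: mult_ac)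
  qed
  have "japan z \<le> 2 * max (japan (z - y)) (japan y)" using japan_add_max[of "z - y" y] by simp
  then consider "japan z \<le> 2 * japan y" | "japan z \<le> 2 * japan (z - y)" by (auto simp: max_def split: if_splits)
  then show ?thesis
    using *[of "japan y" "japan (z - y)"] *[of "japan (z - y)" "japan y"] by cases (simp_all add: mult_ac add_ac)
qed

lemma japan_conv:
  fixes z :: "real^'n::finite"
  assumes s: "real CARD('n) < s"
  shows "integrable lborel (\<lambda>y. japan (z - y) powr - s * japan y powr - s)"
    and "(LBINT y. japan (z - y) powr - s * japan y powr - s) \<le> kconst TYPE('n) s * japan z powr - s"
proof -
  have s0: "0 \<le> s" using s by linarith
  have i: "integrable lborel (\<lambda>y. 2 powr s * (japan z powr - s * (japan (z - y) powr - s + japan y powr - s)))"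
    by (intro integrable_mult_right Bochner_Integration.integrable_add integrable_japan_powr s)
      (simp add: lborel_integrable_translate(3)[where f="\<lambda>y. japan y powr - s"] integrable_japan_powr s)
  show 1: "integrable lborel (\<lambda>y. japan (z - y) powr - s * japan y powr - s)"
    by (rule integrable_dominated[OF i]) (use japan_powr_conv_pointwise[OF s0] in auto)
  have "(LBINT y. japan (z - y) powr - s * japan y powr - s)
      \<le> (LBINT y. 2 powr s * (japan z powr - s * (japan (z - y) powr - s + japan y powr - s)))"
    by (intro integral_mono 1 i japan_powr_conv_pointwise[OF s0])
  also have "\<dots> = 2 powr s * (japan z powr - s * (jint TYPE('n) s + jint TYPE('n) s))"
    by (simp, subst Bochner_Integration.integral_add)
      (simp_all add: lborel_integrable_translate(3)[where f="\<lambda>y. japan y powr - s"] integrable_japan_powr s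
        lborel_integral_translate(3)[where f="\<lambda>y. japan y powr - s"] jint_def)
  also have "\<dots> = kconst TYPE('n) s * japan z powr - s" by (simp add: kconst_def)
  finally show "(LBINT y. japan (z - y) powr - s * japan y powr - s) \<le> kconst TYPE('n) s * japan z powr - s" .
qed

definition decays :: "real \<Rightarrow> real \<Rightarrow> (real^'n::finite \<Rightarrow> complex) \<Rightarrow> bool" where
  "decays s B G \<longleftrightarrow> G \<in> borel_measurable borel \<and> (\<forall>y. norm (G y) \<le> B * japan y powr - s)"

lemma decaysD: "decays s B G \<Longrightarrow> norm (G y) \<le> B * japan y powr - s"
  and decays_measurable: "decays s B G \<Longrightarrow> G \<in> borel_measurable borel"
  by (auto simp: decays_def)

lemma decays_nonneg: 
  assumes "decays s B (G :: real^'n::finite \<Rightarrow> complex)"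
  shows "0 \<le> B"
proof -
  have "0 \<le> B * japan (0::real^'n) powr - s" using order_trans[OF norm_ge_zero decaysD[OF assms, of 0]] .
  then show ?thesis by (simp add: japan_def)
qed

lemma decays_integrable:
  assumes d: "decays s B (G :: real^'n::finite \<Rightarrow> complex)" and s: "real CARD('n) < s"
  shows "integrable lborel G"
  by (rule integrable_dominated[OF integrable_mult_right[OF integrable_japan_powr[OF s]]])
    (use d in \<open>auto simp: decays_def\<close>)

lemma decays_conv:
  fixes G H :: "real^'n::finite \<Rightarrow> complex"
  assumes G: "decays s B G" and H: "decays s B' H" and s: "real CARD('n) < s"
  shows "decays s (kconst TYPE('n) s * B * B') (conv G H)"
proof -
  have [measurable]: "G \<in> borel_measurable borel" "H \<in> borel_measurable borel" using G H by (auto simp: decays_def)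
  have B: "0 \<le> B" "0 \<le> B'" using decays_nonneg G H by blast+
  have "norm (conv G H z) \<le> kconst TYPE('n) s * B * B' * japan z powr - s" for z
  proof -
    have "norm (conv G H z) \<le> (LBINT y. (B * B') * (japan (z - y) powr - s * japan y powr - s))"
      unfolding conv_def
    proof (intro norm_integral_dominated integrable_mult_right japan_conv s)
      have "norm (G (z - y)) * norm (H y) \<le> (B * japan (z - y) powr - s) * (B' * japan y powr - s)" for y
        by (intro mult_mono decaysD[OF G] decaysD[OF H]) (use B in auto)
      then show "norm (G (z - y) * H y) \<le> (B * B') * (japan (z - y) powr - s * japan y powr - s)" for y
        by (simp add: norm_mult mult_ac)
    qed
    also have "\<dots> = (B * B') * (LBINT y. japan (z - y) powr - s * japan y powr - s)" by simp
    also have "\<dots> \<le> (B * B') * (kconst TYPE('n) s * japan z powr - s)"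
      using B by (intro mult_left_mono japan_conv s) auto
    finally show ?thesis by (simp add: mult_ac)
  qed
  moreover have "conv G H \<in> borel_measurable borel" unfolding conv_def by measurable
  ultimately show ?thesis by (auto simp: decays_def)
qed

text \<open>A local weighted Fourier algebra: restrictions to S of transforms of decaying functions,
  with B bounding the quotient norm. The bound is kept explicit because it has to be uniform over
  the centres of the balls.\<close>

definition rep :: "real \<Rightarrow> real \<Rightarrow> (real^'n::finite) set \<Rightarrow> (real^'n \<Rightarrow> complex) \<Rightarrow> bool" where
  "rep s B S g \<longleftrightarrow> (\<exists>G. decays s B G \<and> (\<forall>x\<in>S. g x = ft G x))"

lemma rep_nonneg: "rep s B S g \<Longrightarrow> 0 \<le> B"
  unfolding rep_def using decays_nonneg by blast

lemma rep_mono: "rep s B S g \<Longrightarrow> B \<le> B' \<Longrightarrow> s' \<le> s \<Longrightarrow> rep s' B' S g"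
proof -
  assume r: "rep s B S g" and le: "B \<le> B'" "s' \<le> s"
  obtain G where G: "decays s B G" "\<forall>x\<in>S. g x = ft G x" using r by (auto simp: rep_def)
  have "0 \<le> B" using rep_nonneg[OF r] .
  then have "B * japan y powr - s \<le> B' * japan y powr - s'" for y :: "real^'a"
    using le japan_ge_1[of y] by (intro mult_mono powr_mono) auto
  then have "decays s' B' G" using G(1) unfolding decays_def by (meson order_trans)
  then show ?thesis using G(2) by (auto simp: rep_def)
qed

lemma rep_subset: "rep s B S g \<Longrightarrow> T \<subseteq> S \<Longrightarrow> rep s B T g"
  unfolding rep_def by blast

lemma rep_cong: "rep s B S g \<Longrightarrow> (\<And>x. x \<in> S \<Longrightarrow> g x = h x) \<Longrightarrow> rep s B S h"
  unfolding rep_def by metis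

lemma rep_mult:
  fixes g h :: "real^'n::finite \<Rightarrow> complex"
  assumes "rep s B S g" "rep s B' S h" and s: "real CARD('n) < s"
  shows "rep s (kconst TYPE('n) s * B * B') S (\<lambda>x. g x * h x)"
proof -
  obtain G H where G: "decays s B G" "\<forall>x\<in>S. g x = ft G x" and H: "decays s B' H" "\<forall>x\<in>S. h x = ft H x"
    using assms by (auto simp: rep_def)
  have "g x * h x = ft (conv G H) x" if "x \<in> S" for x
    using that G(2) H(2) by (simp add: ft_conv decays_integrable[OF G(1) s] decays_integrable[OF H(1) s])
  then show ?thesis using decays_conv[OF G(1) H(1) s] by (auto simp: rep_def)
qed

lemma rep_add:
  fixes g h :: "real^'n::finite \<Rightarrow> complex"
  assumes "rep s B S g" "rep s B' S h" and s: "real CARD('n) < s"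
  shows "rep s (B + B') S (\<lambda>x. g x + h x)"
proof -
  obtain G H where G: "decays s B G" "\<forall>x\<in>S. g x = ft G x" and H: "decays s B' H" "\<forall>x\<in>S. h x = ft H x"
    using assms by (auto simp: rep_def)
  have "norm (G y + H y) \<le> (B + B') * japan y powr - s" for y
    using norm_triangle_ineq[of "G y" "H y"] decaysD[OF G(1), of y] decaysD[OF H(1), of y] by (simp add: distrib_right)
  then have "decays s (B + B') (\<lambda>y. G y + H y)" using decays_measurable[OF G(1)] decays_measurable[OF H(1)] by (auto simp: decays_def)
  moreover have "ft (\<lambda>y. G y + H y) x = ft G x + ft H x" for x
    unfolding ft_def distrib_right using decays_integrable[OF G(1) s] decays_integrable[OF H(1) s]
    by (intro Bochner_Integration.integral_add integrable_mult_ch) auto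
  ultimately show ?thesis using G(2) H(2) unfolding rep_def by (intro exI[of _ "\<lambda>y. G y + H y"]) auto
qed

lemma rep_zero: "rep s 0 S (\<lambda>x. 0)"
  unfolding rep_def decays_def by (intro exI[of _ "\<lambda>_. 0"]) (auto simp: ft_def)

lemma rep_sum:
  fixes g :: "'i \<Rightarrow> real^'n::finite \<Rightarrow> complex"
  assumes "\<And>i. i \<in> I \<Longrightarrow> rep s (B i) S (g i)" and s: "real CARD('n) < s"
  shows "rep s (\<Sum>i\<in>I. B i) S (\<lambda>x. \<Sum>i\<in>I. g i x)"
  using assms(1) by (induction I rule: infinite_finite_induct) (auto intro: rep_zero rep_add s)

text \<open>The exponential series in the convolution algebra. Subtracting 1 avoids adjoining a
  unit: the constant 1 is not the transform of an integrable function on the whole space.\<close>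

lemma rep_exp:
  fixes g :: "real^'n::finite \<Rightarrow> complex"
  assumes r: "rep s B S g" and s: "real CARD('n) < s"
  shows "rep s (B * exp (kconst TYPE('n) s * B)) S (\<lambda>x. exp (\<i> * g x) - 1)"
proof -
  let ?K = "kconst TYPE('n) s"
  have K: "0 < ?K" by (rule kconst_pos[OF s])
  obtain G where G: "decays s B G" "\<forall>x\<in>S. g x = ft G x" using r by (auto simp: rep_def)
  have B: "0 \<le> B" using rep_nonneg[OF r] .
  \<comment> \<open>Indexed from 0: \<open>Gk k\<close> is the convolution of k + 1 copies of G and
    represents the power k + 1.\<close>
  define Gk where "Gk k = ((\<lambda>H. conv H G) ^^ k) G" for k
  have dk: "decays s (B * (?K * B) ^ k) (Gk k)" for k
  proof (induction k)
    case (Suc k)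
    then show ?case using decays_conv[OF Suc G(1) s] by (simp add: Gk_def mult_ac)
  qed (simp add: Gk_def G(1))
  have ftk: "ft (Gk k) x = ft G x ^ Suc k" for k x
  proof (induction k)
    case (Suc k)
    have "ft (Gk (Suc k)) x = ft (Gk k) x * ft G x"
      using ft_conv[OF decays_integrable[OF dk s, of k] decays_integrable[OF G(1) s], of x] by (simp add: Gk_def)
    then show ?case using Suc by (simp add: mult_ac)
  qed (simp add: Gk_def)
  define F where "F k y = (\<i> ^ Suc k / fact (Suc k)) * Gk k y" for k y
  have [measurable]: "Gk k \<in> borel_measurable borel" for k using dk by (auto simp: decays_def)
  have Fm[measurable]: "F k \<in> borel_measurable borel" for k unfolding F_def by measurable
  \<comment> \<open>The coefficients 1/(k+1)! are relaxed to 1/k!, so that the majorants sum to an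
    exponential.\<close>
  define e where "e k = (?K * B) ^ k / fact k" for k
  have es: "e sums exp (?K * B)"
    using exp_converges[of "?K * B"] by (simp add: e_def[abs_def] divide_inverse mult.commute)
  have Fb: "norm (F k y) \<le> B * e k * japan y powr - s" for k y
  proof -
    have "norm (F k y) = norm (Gk k y) / fact (Suc k)"
      by (simp add: F_def norm_mult norm_divide norm_power del: fact_Suc)
    also have "\<dots> \<le> (B * (?K * B) ^ k * japan y powr - s) / fact k"
      using decaysD[OF dk, of k y] order_trans[OF norm_ge_zero decaysD[OF dk, of k y]] by (intro frac_le fact_mono) (auto simp del: fact_Suc)
    finally show ?thesis by (simp add: e_def)
  qed
  have e0: "0 \<le> e k" for k unfolding e_def using K B by simp
  have sumB: "summable (\<lambda>k. B * e k * c)" for c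
    using es by (intro summable_mult2 summable_mult) (auto simp: sums_iff)
  have sumF: "summable (\<lambda>k. norm (F k y))" for y
    by (rule summable_comparison_test'[OF sumB[of "japan y powr - s"]]) (use Fb in auto)
  define E where "E y = (\<Sum>k. F k y)" for y
  have Eb: "norm (E y) \<le> B * exp (?K * B) * japan y powr - s" for y
  proof -
    have "norm (E y) \<le> (\<Sum>k. norm (F k y))" unfolding E_def by (rule summable_norm[OF sumF])
    also have "\<dots> \<le> (\<Sum>k. B * e k * japan y powr - s)" by (intro suminf_le Fb sumF sumB)
    also have "\<dots> = B * exp (?K * B) * japan y powr - s"
      using sums_mult2[OF sums_mult[OF es]] by (simp add: sums_iff)
    finally show ?thesis .
  qed
  have Em: "E \<in> borel_measurable borel" unfolding E_def by measurable
  have intF: "integrable lborel (\<lambda>y. F k y * ch (y \<bullet> x))" for k x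
    unfolding F_def using decays_integrable[OF dk s, of k] by (intro integrable_mult_ch integrable_mult_right) auto
  have intn: "(LBINT y. norm (F k y * ch (y \<bullet> x))) \<le> B * e k * jint TYPE('n) s" for k x
  proof -
    have "(LBINT y. norm (F k y * ch (y \<bullet> x))) \<le> (\<integral>y. B * e k * japan y powr - s \<partial>(lborel :: (real^'n) measure))"
      by (intro integral_mono integrable_norm intF integrable_mult_right integrable_japan_powr s)
        (use Fb in \<open>auto simp: norm_mult\<close>)
    then show ?thesis by (simp add: jint_def)
  qed
  have "ft E x = exp (\<i> * g x) - 1" if x: "x \<in> S" for x
  proof -
    have "ft E x = (LBINT y. (\<Sum>k. F k y * ch (y \<bullet> x)))"
      unfolding ft_def E_def using sumF by (simp add: suminf_mult2 summable_norm_cancel)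
    also have "\<dots> = (\<Sum>k. \<integral>y. F k y * ch (y \<bullet> x) \<partial>lborel)"
    proof (rule integral_suminf[OF intF])
      show "AE y in lborel. summable (\<lambda>k. norm (F k y * ch (y \<bullet> x)))"
        using sumF by (simp add: norm_mult)
      show "summable (\<lambda>k. \<integral>y. norm (F k y * ch (y \<bullet> x)) \<partial>lborel)"
        by (rule summable_comparison_test'[OF sumB[of "jint TYPE('n) s"]]) (use intn in auto)
    qed
    also have "\<dots> = (\<Sum>k. (\<i> * g x) ^ Suc k /\<^sub>R fact (Suc k))"
    proof (rule suminf_cong)
      fix k
      have "(LBINT y. F k y * ch (y \<bullet> x)) = (\<i> ^ Suc k / fact (Suc k)) * ft (Gk k) x"
        unfolding F_def ft_def mult.assoc by simp
      also have "\<dots> = (\<i> * g x) ^ Suc k / fact (Suc k)"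
        using G(2) x ftk[of k x] by (simp add: power_mult_distrib del: fact_Suc)
      finally show "(LBINT y. F k y * ch (y \<bullet> x)) = (\<i> * g x) ^ Suc k /\<^sub>R fact (Suc k)"
        by (simp add: scaleR_conv_of_real divide_inverse mult.commute del: fact_Suc power_Suc)
    qed
    also have "\<dots> = exp (\<i> * g x) - 1" 
      using exp_first_term[of "\<i> * g x"] by (simp add: inverse_eq_divide)
    finally show ?thesis .
  qed
  then show ?thesis using Eb Em by (auto simp: rep_def decays_def intro!: exI[of _ E])
qed

text \<open>By Fourier inversion, \<open>ft\<close> is its own inverse up to reflection; so f is the
  transform of the reflected \<open>ft f\<close>.\<close>

lemma rep_of_ft_bound:
  fixes f :: "real^'n::finite \<Rightarrow> complex"
  assumes c: "continuous_on UNIV f" and i: "integrable lborel f" and s: "real CARD('n) < s"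
    and b: "\<And>y. norm (ft f y) \<le> B * japan y powr - s"
  shows "rep s B UNIV f"
proof -
  have [measurable]: "f \<in> borel_measurable borel" using i by auto
  have d: "decays s B (ft f)" using b by (auto simp: decays_def)
  have d': "decays s B (\<lambda>y. ft f (- y))" using d b[of "- _"] by (auto simp: decays_def)
  have "f x = ft (\<lambda>y. ft f (- y)) x" for x
    using fourier_inversion[OF c i decays_integrable[OF d s], of x]
      lborel_integral_translate(5)[of "\<lambda>y. ft f y * ch (- (y \<bullet> x))"] by (simp add: ft_def[of _ x])
  then show ?thesis using d' by (auto simp: rep_def)
qed

lemma efd_rep:
  fixes \<beta> :: "real^'n::finite \<Rightarrow> complex"
  assumes c: "continuous_on UNIV \<beta>" and e: "efd s \<beta>" and s: "real CARD('n) < s"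
  obtains C a where "0 < C" "0 < a" "\<And>c. rep s (C * exp (a * norm c)) UNIV (expw c \<beta>)"
proof -
  obtain C a where C: "0 < C" "0 < a" "\<And>c y. norm (ft (expw c \<beta>) y) \<le> C * exp (a * norm c) * japan y powr - s"
    using efdE[OF e] by metis
  have "rep s (C * exp (a * norm c)) UNIV (expw c \<beta>)" for c
  proof (rule rep_of_ft_bound[OF _ integrable_expw[OF e] s C(3)])
    show "continuous_on UNIV (expw c \<beta>)"
      unfolding expw_def by (intro continuous_intros assms(1))
  qed
  then show ?thesis using that C by blast
qed

text \<open>Completing the square against three quarters of the Gaussian exponent absorbs the
  exponential with constant exp (a^2 / (3 pi)); the remaining quarter is a dilated window.\<close>

lemma integrable_exp_window:
  "integrable lborel (\<lambda>z::real^'n::finite. exp (a * norm z) * window z)"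
proof (rule integrable_dominated)
  show "integrable lborel (\<lambda>z::real^'n. exp (a\<^sup>2 / (3 * pi)) * window ((1/2) *\<^sub>R z))"
    using lborel_integrable_affine[OF integrable_window, of "1/2" 0] by simp
  have "a * r + - pi * r\<^sup>2 \<le> a\<^sup>2 / (3 * pi) + - pi * (r / 2)\<^sup>2" for r :: real
  proof -
    have "0 \<le> (3 * pi / 2 * r - a)\<^sup>2 / (3 * pi)" by simp
    also have "\<dots> = 3 * pi / 4 * r\<^sup>2 - a * r + a\<^sup>2 / (3 * pi)"
      by (simp add: power2_eq_square field_simps)
    finally show ?thesis by (simp add: power2_eq_square algebra_simps)
  qed
  then show "norm (exp (a * norm z) * window z) \<le> exp (a\<^sup>2 / (3 * pi)) * window ((1/2) *\<^sub>R z)" for z :: "real^'n"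
    unfolding window_def exp_add[symmetric] by (simp add: abs_mult exp_add[symmetric])
qed measurable

text \<open>Proved by writing \<open>P x / window x\<close> as the integral of \<open>P z * window z * exp (2 \<pi> x \<bullet> z)\<close> over \<open>z\<close>.\<close>

lemma rep_div_window:
  fixes P :: "real^'n::finite \<Rightarrow> real"
  assumes c: "continuous_on UNIV P" and Pb: "\<And>z. \<bar>P z\<bar> \<le> exp (norm z)"
    and mean: "\<And>x. (LBINT z. P (z + x) * window z) = P x"
    and s: "real CARD('n) < s"
  obtains B where "rep s B (cball 0 R) (\<lambda>x. complex_of_real (P x / window x))"
proof -
  have [measurable]: "P \<in> borel_measurable borel" by (rule borel_measurable_continuous_onI[OF c])
  obtain N :: nat where N: "s \<le> real (Suc N)" using real_arch_simple[of s] by (meson le_SucI of_nat_mono order_trans le_refl lessI less_imp_le)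
  obtain \<beta> :: "real^'n \<Rightarrow> complex" where \<beta>: "continuous_on UNIV \<beta>" "efd (real (Suc N)) \<beta>" "\<And>t. norm t \<le> R \<Longrightarrow> \<beta> t = 1"
    using plateau_exists[of N R] by blast
  obtain Q D where Q: "0 < Q" "0 < D" "\<And>t. norm (\<beta> t) \<le> D * indicator (cball 0 Q) t"
    using efdD[OF \<beta>(2)] by metis
  have [measurable]: "\<beta> \<in> borel_measurable borel" using \<beta>(2) by (simp add: efd_def)
  obtain C a where C: "0 < C" "0 < a" "\<And>c y. norm (ft (expw c \<beta>) y) \<le> C * exp (a * norm c) * japan y powr - real (Suc N)"
    using efdE[OF \<beta>(2)] by metis
  let ?f = "\<lambda>x. complex_of_real (P x / window x) * \<beta> x"
  have cf: "continuous_on UNIV (\<lambda>x. complex_of_real (P x / window x))"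
    by (intro continuous_intros c) auto
  have int: "integrable lborel ?f" by (rule continuous_on_mult_efd_integrable[OF \<beta>(2) cf])
  have cont: "continuous_on UNIV ?f" by (intro continuous_intros c \<beta>) auto
  \<comment> \<open>Completing the square turns the integral into the Gaussian mean of P around x,
    divided by \<open>window x\<close>; by \<open>mean\<close> this mean is
    \<open>P x\<close>.\<close>
  have eq: "(LBINT z. P z * window z * exp (2 * pi * (x \<bullet> z))) = P x / window x" for x
  proof -
    have "window z * exp (2 * pi * (x \<bullet> z)) = window (z - x) / window x" for z
    proof -
      have "(norm (z - x))\<^sup>2 = (norm z)\<^sup>2 - 2 * (x \<bullet> z) + (norm x)\<^sup>2"
        by (simp add: power2_norm_eq_inner inner_diff_left inner_diff_right inner_commute)
      then show ?thesis
        unfolding window_def exp_add[symmetric] exp_diff[symmetric] by (simp add: distrib_left right_diff_distrib)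
    qed
    then have "P z * window z * exp (2 * pi * (x \<bullet> z)) = (P z * window (z - x)) / window x" for z
      by (simp add: mult.assoc)
    then have "(LBINT z. P z * window z * exp (2 * pi * (x \<bullet> z))) = (LBINT z. P z * window (z - x)) / window x"
      by (simp only:) simp
    also have "(LBINT z. P z * window (z - x)) = P x"
      using mean[of x] lborel_integral_translate(2)[of "\<lambda>z. P z * window (z - x)" x] by simp
    finally show ?thesis .
  qed
  define J where "J = (LBINT z. exp ((1 + 2 * pi * a) * norm z) * window (z::real^'n))"
  have ftb: "norm (ft ?f y) \<le> (C * J) * japan y powr - real (Suc N)" for y
  proof -
    let ?H = "\<lambda>x z. complex_of_real (P z * window z) * (complex_of_real (exp (2 * pi * (x \<bullet> z))) * \<beta> x * ch (x \<bullet> y))"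
    have "ft ?f y = (LBINT x. (LBINT z. ?H x z))"
      unfolding ft_def
    proof (rule Bochner_Integration.integral_cong[OF refl])
      fix x
      have "(LBINT z. ?H x z) = (LBINT z. complex_of_real (P z * window z * exp (2 * pi * (x \<bullet> z))) * (\<beta> x * ch (x \<bullet> y)))"
        by (simp add: mult.assoc)
      also have "\<dots> = complex_of_real (P x / window x) * (\<beta> x * ch (x \<bullet> y))"
        by (simp only: integral_mult_left_zero integral_complex_of_real eq)
      finally show "?f x * ch (x \<bullet> y) = (LBINT z. ?H x z)" by simp
    qed
    also have "\<dots> = (LBINT z. (LBINT x. ?H x z))"
    proof (rule Fubini_bound[where g="\<lambda>x. D * indicator (cball 0 Q) x" and h="\<lambda>z. exp ((1 + 2 * pi * Q) * norm z) * window z"])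
      show "integrable lborel (\<lambda>x::real^'n. D * indicator (cball 0 Q) x :: real)"
        by (intro integrable_mult_right integrable_indicator_cball)
      show "integrable lborel (\<lambda>z::real^'n. exp ((1 + 2 * pi * Q) * norm z) * window z)"
        by (rule integrable_exp_window)
      fix x z :: "real^'n"
      show "norm (?H x z) \<le> D * indicator (cball 0 Q) x * (exp ((1 + 2 * pi * Q) * norm z) * window z)"
      proof (cases "norm x \<le> Q")
        case True
        have "x \<bullet> z \<le> Q * norm z" using norm_cauchy_schwarz[of x z] mult_right_mono[OF True, of "norm z"] by simp
        then have 1: "exp (2 * pi * (x \<bullet> z)) \<le> exp (2 * pi * (Q * norm z))" by simp
        have "norm (?H x z) = (\<bar>P z\<bar> * window z) * (exp (2 * pi * (x \<bullet> z)) * norm (\<beta> x))"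
          by (simp add: norm_mult abs_mult)
        also have "\<dots> \<le> (exp (norm z) * window z) * (exp (2 * pi * (Q * norm z)) * D)"
          using Q(3)[of x] True by (intro mult_mono Pb 1) auto
        also have "\<dots> = D * 1 * ((exp (norm z) * exp (2 * pi * (Q * norm z))) * window z)" by (simp add: mult_ac)
        also have "exp (norm z) * exp (2 * pi * (Q * norm z)) = exp ((1 + 2 * pi * Q) * norm z)"
          by (simp add: exp_add[symmetric] algebra_simps)
        finally show ?thesis using True by simp
      next
        case False
        then show ?thesis using Q(3)[of x] by simp
      qed
    qed measurable
    \<comment> \<open>The inner integral is the transform of \<beta> with an exponential weight in
      direction z. Its bound grows exponentially in z, which \<open>window z\<close>
      absorbs.\<close>
    also have "\<dots> = (LBINT z. complex_of_real (P z * window z) * ft (expw ((2 * pi) *\<^sub>R z) \<beta>) y)"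
      unfolding ft_def expw_def by (simp add: inner_commute)
    also have "norm \<dots> \<le> (LBINT z. (C * japan y powr - real (Suc N)) * (exp ((1 + 2 * pi * a) * norm z) * window (z::real^'n)))"
    proof (intro norm_integral_dominated integrable_mult_right integrable_exp_window)
        fix z
        have "norm (complex_of_real (P z * window z) * ft (expw ((2 * pi) *\<^sub>R z) \<beta>) y)
            = (\<bar>P z\<bar> * window z) * norm (ft (expw ((2 * pi) *\<^sub>R z) \<beta>) y)" by (simp add: norm_mult abs_mult)
        also have "\<dots> \<le> (exp (norm z) * window z) * (C * exp (a * norm ((2 * pi) *\<^sub>R z)) * japan y powr - real (Suc N))"
          by (intro mult_mono Pb C(3)) auto
        also have "\<dots> = (C * japan y powr - real (Suc N)) * ((exp (norm z) * exp (2 * pi * a * norm z)) * window z)"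
          by (simp add: mult_ac)
        also have "exp (norm z) * exp (2 * pi * a * norm z) = exp ((1 + 2 * pi * a) * norm z)"
          by (simp add: exp_add[symmetric] algebra_simps)
        finally show "norm (complex_of_real (P z * window z) * ft (expw ((2 * pi) *\<^sub>R z) \<beta>) y) \<le> (C * japan y powr - real (Suc N)) * (exp ((1 + 2 * pi * a) * norm z) * window z)" .
    qed
    also have "\<dots> = (C * J) * japan y powr - real (Suc N)" by (simp add: J_def)
    finally show ?thesis .
  qed
  have "rep (real (Suc N)) (C * J) UNIV ?f"
    by (rule rep_of_ft_bound[OF cont int _ ftb]) (use N s in linarith)
  then have "rep s (C * J) UNIV ?f" by (rule rep_mono[OF _ order_refl N])
  then have "rep s (C * J) (cball 0 R) ?f" by (rule rep_subset) simp
  then have "rep s (C * J) (cball 0 R) (\<lambda>x. complex_of_real (P x / window x))"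
    by (rule rep_cong) (use \<beta>(3) in auto)
  then show ?thesis by (rule that)
qed

section \<open>The local phase\<close>

text \<open>Upgrades the bounds behind an essential supremum to bounds at every point: the
  exceptional set is open, and a nonempty open set contains a ball of positive measure.\<close>

lemma AE_le_continuous:
  fixes u v :: "'a::euclidean_space \<Rightarrow> real"
  assumes c: "continuous_on UNIV u" "continuous_on UNIV v" and ae: "AE x in lborel. u x \<le> v x"
  shows "u x \<le> v x"
proof (rule ccontr)
  assume "\<not> u x \<le> v x"
  then have x: "x \<in> {x. v x < u x}" by simp
  have op: "open {x. v x < u x}" by (intro open_Collect_less c)
  then obtain e where e: "0 < e" "ball x e \<subseteq> {x. v x < u x}" using x openE by blast
  have "emeasure lborel {x. v x < u x} = 0"
    using ae op by (subst (asm) AE_iff_measurable[OF _ refl]) (auto simp: not_le)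
  then have "emeasure lborel (ball x e) = 0"
    using emeasure_mono[OF e(2), of lborel] op by auto
  moreover have "0 < unit_ball_vol (real DIM('a)) * e ^ DIM('a)" using e(1) unit_ball_vol_pos[of "real DIM('a)"] by simp
  ultimately show False using e(1) by (simp add: emeasure_ball ennreal_eq_0_iff)
qed

text \<open>Since \<open>japan z powr s\<close> is at most exp (|s| norm z), it suffices to maximise
  exp (b t - pi t^2) with b = a + |s|; the maximum exp (b^2 / (4 pi)) is the constant.\<close>

lemma exp_window_decay:
  obtains C where "0 < C" "\<And>z::real^'n::finite. exp (a * norm z) * window z \<le> C * japan z powr - s"
proof
  let ?b = "a + \<bar>s\<bar>"
  show "0 < exp (?b\<^sup>2 / (4 * pi))" by simp
  fix z :: "real^'n"
  have "ln (japan z) \<le> norm z"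
    using ln_le_minus_one[of "japan z"] japan_le[of z] by simp
  moreover have "0 \<le> ln (japan z)" using japan_ge_1[of z] by simp
  ultimately have "s * ln (japan z) \<le> \<bar>s\<bar> * norm z"
    by (intro mult_mono) auto
  then have "japan z powr s \<le> exp (\<bar>s\<bar> * norm z)" by (simp add: powr_def)
  then have "exp (a * norm z) * window z * japan z powr s \<le> exp (a * norm z) * window z * exp (\<bar>s\<bar> * norm z)"
    by (intro mult_left_mono) auto
  also have "\<dots> = exp (?b * norm z + - pi * (norm z)\<^sup>2)"
    by (simp add: window_def exp_add[symmetric] distrib_right)
  also have "\<dots> \<le> exp (?b\<^sup>2 / (4 * pi))"
  proof -
    have "0 \<le> (2 * pi * norm z - ?b)\<^sup>2 / (4 * pi)" by simp
    also have "\<dots> = pi * (norm z)\<^sup>2 - ?b * norm z + ?b\<^sup>2 / (4 * pi)"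
      by (simp add: power2_diff power_mult_distrib divide_simps) (simp add: power2_eq_square algebra_simps)
    finally show ?thesis by simp
  qed
  finally show "exp (a * norm z) * window z \<le> exp (?b\<^sup>2 / (4 * pi)) * japan z powr - s"
    by (intro le_japan_powrI) (simp only: mult.commute)
qed

lemma ft_window: "ft (\<lambda>y. complex_of_real (window y)) x = complex_of_real (window x)"
  unfolding ft_def by (rule integral_window_ch(2))

lemma rep_window: 
  obtains C where "rep s C UNIV (\<lambda>x::real^'n::finite. complex_of_real (window x))"
proof -
  obtain C where "0 < C" "\<And>z::real^'n. exp (0 * norm z) * window z \<le> C * japan z powr - s"
    using exp_window_decay by blast
  then have "decays s C (\<lambda>y::real^'n. complex_of_real (window y))" by (auto simp: decays_def)
  then show ?thesis using that[of C] ft_window unfolding rep_def by metis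
qed

lemma nth_le_exp_norm: "\<bar>z $ j\<bar> \<le> exp (norm (z::real^'n::finite))"
  using component_le_norm_cart[of z j] exp_ge_add_one_self[of "norm z"] by linarith

lemma integrable_nth_window: "integrable lborel (\<lambda>z::real^'n::finite. z $ j * window z)"
  by (rule integrable_dominated[OF integrable_exp_window[of 1]])
    (use nth_le_exp_norm in \<open>auto simp: abs_mult intro!: mult_right_mono\<close>)

text \<open>A coordinate function is unbounded, hence only locally a transform. It equals its own
  Gaussian mean because the window is even, so \<open>rep_div_window\<close> represents its quotient
  by the window, and multiplying by the window undoes the division.\<close>

lemma rep_nth:
  assumes s: "real CARD('n::finite) < s"
  obtains B where "rep s B (cball 0 R) (\<lambda>x::real^'n. complex_of_real (x $ j))"
proof -
  have odd: "(LBINT z. z $ j * window (z::real^'n)) = 0"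
    using lborel_integral_translate(5)[of "\<lambda>z::real^'n. z $ j * window z"] by simp
  have mean: "(LBINT z. (z + x) $ j * window z) = x $ j" for x :: "real^'n"
    using integrable_nth_window[of j] integrable_window integral_window[where 'n='n] odd
    by (simp add: distrib_right, subst Bochner_Integration.integral_add) auto
  obtain B where B: "rep s B (cball 0 R) (\<lambda>x::real^'n. complex_of_real (x $ j / window x))"
    by (rule rep_div_window[where P="\<lambda>x. x $ j", OF _ nth_le_exp_norm mean s]) (auto intro!: continuous_intros)
  obtain C where "rep s C UNIV (\<lambda>x::real^'n. complex_of_real (window x))" by (rule rep_window)
  then have "rep s C (cball 0 R) (\<lambda>x::real^'n. complex_of_real (window x))" by (rule rep_subset) simp
  from rep_mult[OF B this s] show ?thesis by (intro that) (simp add: rep_def)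
qed

lemma rep_one_div_window:
  assumes s: "real CARD('n::finite) < s"
  obtains B where "rep s B (cball 0 R) (\<lambda>x::real^'n. complex_of_real (1 / window x))"
  by (rule rep_div_window[where P="\<lambda>x. 1" and s=s and R=R]) (use integral_window s in auto)

section \<open>Dilations and integration along rays\<close>

lemma japan_dilate:
  assumes "0 < \<tau>"
  shows "japan y \<le> 2 * max 1 (\<tau> * japan ((1/\<tau>) *\<^sub>R y))"
proof -
  have "(norm y)\<^sup>2 \<le> (\<tau> * japan ((1/\<tau>) *\<^sub>R y))\<^sup>2"
    using assms by (simp add: japan_def power_mult_distrib distrib_left power_divide)
  then have "norm y \<le> \<tau> * japan ((1/\<tau>) *\<^sub>R y)" using assms by (auto intro: power2_le_imp_le)
  moreover have "japan y \<le> 1 + norm y" by (rule japan_le)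
  ultimately show ?thesis by (auto simp: max_def)
qed

lemma japan_dilate_powr:
  fixes y :: "real^'n::finite"
  assumes t: "0 < \<tau>" and s: "0 \<le> s"
  shows "japan y powr s * japan ((1/\<tau>) *\<^sub>R y) powr - s \<le> 2 powr s * (japan ((1/\<tau>) *\<^sub>R y) powr - s + \<tau> powr s)"
proof -
  let ?w = "japan ((1/\<tau>) *\<^sub>R y)"
  have "japan y powr s \<le> (2 * max 1 (\<tau> * ?w)) powr s"
    by (intro powr_mono2 s japan_dilate t) auto
  also have "\<dots> = 2 powr s * (max 1 (\<tau> * ?w)) powr s" by (subst powr_mult) auto
  also have "\<dots> \<le> 2 powr s * (1 + \<tau> powr s * ?w powr s)"
    using t by (intro mult_left_mono) (auto simp: max_def powr_mult)
  finally have "japan y powr s * ?w powr - s \<le> 2 powr s * (1 + \<tau> powr s * ?w powr s) * ?w powr - s"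
    by (intro mult_right_mono) auto
  also have "\<dots> = 2 powr s * (?w powr - s + \<tau> powr s * (?w powr s * ?w powr - s))"
    by (simp add: algebra_simps)
  also have "?w powr s * ?w powr - s = 1" by (simp add: powr_add[symmetric])
  finally show ?thesis by simp
qed

lemma ft_dilate:
  fixes G :: "real^'n::finite \<Rightarrow> complex"
  assumes t: "0 < \<tau>"
  shows "ft (\<lambda>y. complex_of_real (\<tau> powr - real CARD('n)) * G ((1/\<tau>) *\<^sub>R y)) x = ft G (\<tau> *\<^sub>R x)"
proof -
  let ?f = "\<lambda>y. G y * ch (y \<bullet> (\<tau> *\<^sub>R x))"
  have "ft (\<lambda>y. complex_of_real (\<tau> powr - real CARD('n)) * G ((1/\<tau>) *\<^sub>R y)) x
     = (LBINT y. complex_of_real (\<tau> powr - real CARD('n)) * ?f (0 + (1/\<tau>) *\<^sub>R y))"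
    unfolding ft_def using t by (simp add: mult.assoc)
  also have "\<dots> = complex_of_real (\<tau> powr - real CARD('n)) * (LBINT y. ?f (0 + (1/\<tau>) *\<^sub>R y))" by (rule integral_mult_right_zero)
  also have "(LBINT y. ?f (0 + (1/\<tau>) *\<^sub>R y)) = ft G (\<tau> *\<^sub>R x) * of_real (\<tau> ^ CARD('n))"
    using t by (subst lborel_integral_affine) (auto simp: ft_def scaleR_conv_of_real power_divide)
  finally show ?thesis using t
    by (simp add: powr_minus powr_realpow of_real_inverse)
qed

lemma integrable_dilate:
  fixes G :: "real^'n::finite \<Rightarrow> complex"
  assumes "integrable lborel G" "0 < \<tau>"
  shows "integrable lborel (\<lambda>y. complex_of_real (\<tau> powr - real CARD('n)) * G ((1/\<tau>) *\<^sub>R y))"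
  using lborel_integrable_affine[OF assms(1), of "1/\<tau>" 0] assms(2) by (intro integrable_mult_right) auto

text \<open>The dilations \<open>x \<mapsto> \<tau> x\<close> with \<open>\<tau> \<le> 1\<close> act uniformly on local representations,
  because \<open>s\<close> exceeds the dimension.\<close>

lemma decays_conv_dilate:
  fixes X G :: "real^'n::finite \<Rightarrow> complex"
  assumes X: "decays (2 * s) A X" and G: "decays s B G" and s: "real CARD('n) < s" and t: "0 < \<tau>" "\<tau> \<le> 1"
  shows "decays s (A * B * (2 powr s * (2 powr s * (2 * jint TYPE('n) s)))) (conv X (\<lambda>y. complex_of_real (\<tau> powr - real CARD('n)) * G ((1/\<tau>) *\<^sub>R y)))"
proof -
  let ?n = "real CARD('n)"
  let ?j = "\<lambda>y. japan ((1/\<tau>) *\<^sub>R y) powr - s"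
  let ?G = "\<lambda>y. complex_of_real (\<tau> powr - ?n) * G ((1/\<tau>) *\<^sub>R y)"
  have s0: "0 \<le> s" using s by linarith
  have AB: "0 \<le> A" "0 \<le> B" using decays_nonneg X G by blast+
  have [measurable]: "X \<in> borel_measurable borel" "G \<in> borel_measurable borel" using X G by (auto simp: decays_def)
  have ji: "integrable lborel (\<lambda>y::real^'n. ?j y)" 
    using lborel_integrable_affine[OF integrable_japan_powr[OF s], of "1/\<tau>" 0] t by simp
  have jv: "(LBINT y. ?j (y::real^'n)) = \<tau> powr ?n * jint TYPE('n) s"
    using lborel_integral_affine[of "1/\<tau>" "\<lambda>y::real^'n. japan y powr - s" 0] t
    by (simp add: jint_def powr_realpow power_divide)
  have zi: "integrable lborel (\<lambda>y. japan (z - y) powr - s)" for z :: "real^'n"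
    using lborel_integrable_translate(3)[of "\<lambda>y. japan y powr - s" z] integrable_japan_powr[OF s] by simp
  have zv: "(LBINT y. japan (z - y) powr - s) = jint TYPE('n) s" for z :: "real^'n"
    using lborel_integral_translate(3)[of "\<lambda>y. japan y powr - s" z] by (simp add: jint_def)
  \<comment> \<open>The dilate of G may have a peak of height \<tau>^(-n), so by itself it does not
    decay with a uniform constant. The bound has two parts: the dilated weight, whose integral times
    \<tau>^(-n) does not depend on \<tau>, and a tail carrying the factor
    \<open>\<tau> powr s\<close>.\<close>
  let ?b = "\<lambda>z y. (A * B) * japan z powr - s * (2 powr s * (2 powr s * (\<tau> powr - ?n * (?j y + \<tau> powr s * japan (z - y) powr - s))))"
  have pw: "norm (X (z - y) * ?G y) \<le> ?b z y" for z y
  proof -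
    \<comment> \<open>X decays with order 2 s: one s pays for the factor
      \<open>japan (z - y) powr s\<close> introduced here, the other keeps the tail term integrable
      in y.\<close>
    have P: "japan z powr s \<le> 2 powr s * (japan (z - y) powr s * japan y powr s)"
    proof -
      have "japan z powr s \<le> (2 * japan (z - y) * japan y) powr s"
        using japan_add[of "z - y" y] s0 by (intro powr_mono2) auto
      then show ?thesis by (simp add: powr_mult mult.assoc)
    qed
    have "japan z powr s * (japan (z - y) powr - (2 * s) * ?j y)
        \<le> (2 powr s * (japan (z - y) powr s * japan y powr s)) * (japan (z - y) powr - (2 * s) * ?j y)"
      by (intro mult_right_mono P) auto
    also have "\<dots> = 2 powr s * ((japan (z - y) powr s * japan (z - y) powr - (2 * s)) * (japan y powr s * ?j y))"
      by (simp only: mult_ac)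
    also have "japan (z - y) powr s * japan (z - y) powr - (2 * s) = japan (z - y) powr - s"
      by (simp add: powr_add[symmetric])
    also have "2 powr s * (japan (z - y) powr - s * (japan y powr s * ?j y))
       \<le> 2 powr s * (japan (z - y) powr - s * (2 powr s * (?j y + \<tau> powr s)))"
      by (intro mult_left_mono japan_dilate_powr t s0) auto
    also have "\<dots> \<le> 2 powr s * (2 powr s * (?j y + \<tau> powr s * japan (z - y) powr - s))"
    proof -
      have "japan (z - y) powr - s \<le> 1" using japan_ge_1[of "z - y"] s0 by (simp add: powr_minus_divide ge_one_powr_ge_zero)
      then have "japan (z - y) powr - s * ?j y \<le> ?j y" by (intro mult_left_le_one_le) auto
      then have "japan (z - y) powr - s * (?j y + \<tau> powr s) \<le> ?j y + \<tau> powr s * japan (z - y) powr - s"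
        by (simp add: distrib_left mult.commute)
      then have "2 powr s * (2 powr s * (japan (z - y) powr - s * (?j y + \<tau> powr s))) \<le> 2 powr s * (2 powr s * (?j y + \<tau> powr s * japan (z - y) powr - s))"
        by (intro mult_left_mono) auto
      then show ?thesis by (simp only: mult_ac)
    qed
    finally have "japan z powr - s * (japan z powr s * (japan (z - y) powr - (2 * s) * ?j y))
        \<le> japan z powr - s * (2 powr s * (2 powr s * (?j y + \<tau> powr s * japan (z - y) powr - s)))"
      by (intro mult_left_mono) auto
    then have Q: "japan (z - y) powr - (2 * s) * ?j y \<le> japan z powr - s * (2 powr s * (2 powr s * (?j y + \<tau> powr s * japan (z - y) powr - s)))"
      by (simp add: mult.assoc[symmetric] powr_add[symmetric])
    have "norm (X (z - y) * ?G y) = norm (X (z - y)) * (\<tau> powr - ?n * norm (G ((1/\<tau>) *\<^sub>R y)))"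
      by (simp add: norm_mult)
    also have "\<dots> \<le> (A * japan (z - y) powr - (2 * s)) * (\<tau> powr - ?n * (B * ?j y))"
      by (intro mult_mono decaysD[OF X] decaysD[OF G] mult_nonneg_nonneg) (use AB in auto)
    also have "\<dots> = (A * B * \<tau> powr - ?n) * (japan (z - y) powr - (2 * s) * ?j y)" by (simp only: mult_ac)
    also have "\<dots> \<le> (A * B * \<tau> powr - ?n) * (japan z powr - s * (2 powr s * (2 powr s * (?j y + \<tau> powr s * japan (z - y) powr - s))))"
      by (intro mult_left_mono Q) (use AB in auto)
    finally show ?thesis by (simp only: mult_ac)
  qed
  have "norm (conv X ?G z) \<le> A * B * (2 powr s * (2 powr s * (2 * jint TYPE('n) s))) * japan z powr - s" for z
  proof -
    have bi: "integrable lborel (?b z)"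
      by (intro integrable_mult_right Bochner_Integration.integrable_add ji zi)
    have "norm (conv X ?G z) \<le> (LBINT y. ?b z y)"
      unfolding conv_def by (rule norm_integral_dominated[OF bi pw])
    also have "\<dots> = (A * B) * japan z powr - s * (2 powr s * (2 powr s * (\<tau> powr - ?n * (\<tau> powr ?n * jint TYPE('n) s + \<tau> powr s * jint TYPE('n) s))))"
      by (simp only: integral_mult_right_zero Bochner_Integration.integral_add[OF ji integrable_mult_right[OF zi]] jv zv)
    also have "\<tau> powr - ?n * (\<tau> powr ?n * jint TYPE('n) s + \<tau> powr s * jint TYPE('n) s) = (1 + \<tau> powr (s - ?n)) * jint TYPE('n) s"
      using t by (simp add: algebra_simps powr_add[symmetric] mult.assoc[symmetric])
    also have "(A * B) * japan z powr - s * (2 powr s * (2 powr s * ((1 + \<tau> powr (s - ?n)) * jint TYPE('n) s)))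
        \<le> (A * B) * japan z powr - s * (2 powr s * (2 powr s * (2 * jint TYPE('n) s)))"
    proof (intro mult_left_mono mult_right_mono)
      \<comment> \<open>The only power of \<tau> left; its being at most 1 gives the
        uniformity.\<close>
      have "\<tau> powr (s - ?n) \<le> 1" using t s by (intro powr_le1) auto
      then show "1 + \<tau> powr (s - ?n) \<le> 2" by simp
    qed (use AB jint_nonneg in auto)
    finally show ?thesis by (simp only: mult_ac)
  qed
  moreover have "conv X ?G \<in> borel_measurable borel" unfolding conv_def by measurable
  ultimately show ?thesis by (auto simp: decays_def)
qed

text \<open>As \<open>w\<close> does not depend on \<tau>, its representing function X is convolved
  with every dilate of G; by \<open>decays_conv_dilate\<close> these convolutions are bounded
  uniformly, and their average over \<tau> represents the ray integral. The ball is centred at 0 and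
  so contains the whole segment to x.\<close>

lemma rep_ray_integral:
  fixes v w :: "real^'n::finite \<Rightarrow> complex"
  assumes w: "rep (2 * s) A (cball 0 R) w" and v: "rep s B (cball 0 R) v" and s: "real CARD('n) < s"
  shows "rep s (A * B * (2 powr s * (2 powr s * (2 * jint TYPE('n) s)))) (cball 0 R)
           (\<lambda>x. \<integral>\<tau>. indicator {0<..1::real} \<tau> *\<^sub>R (w x * v (\<tau> *\<^sub>R x)) \<partial>lborel)"
proof -
  obtain X where X: "decays (2 * s) A X" "\<And>x. x \<in> cball 0 R \<Longrightarrow> w x = ft X x" using w by (auto simp: rep_def)
  obtain G where G: "decays s B G" "\<And>x. x \<in> cball 0 R \<Longrightarrow> v x = ft G x" using v by (auto simp: rep_def)
  define D where "D = A * B * (2 powr s * (2 powr s * (2 * jint TYPE('n) s)))"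
  have D0: "0 \<le> D" unfolding D_def using decays_nonneg[OF X(1)] decays_nonneg[OF G(1)] jint_nonneg[where 'n='n] by simp
  define GG where "GG \<tau> y = complex_of_real (\<tau> powr - real CARD('n)) * G ((1/\<tau>) *\<^sub>R y)" for \<tau> y
  define H where "H z = (LBINT \<tau>. indicator {0<..1::real} \<tau> *\<^sub>R conv X (GG \<tau>) z)" for z
  have [measurable]: "X \<in> borel_measurable borel" "G \<in> borel_measurable borel" using X G by (auto simp: decays_def)
  have dt: "norm (conv X (GG \<tau>) z) \<le> D * japan z powr - s" if "0 < \<tau>" "\<tau> \<le> 1" for \<tau> z
    using decaysD[OF decays_conv_dilate[OF X(1) G(1) s that], of z] by (simp add: D_def GG_def[abs_def])
  have dti: "norm (indicator {0<..1::real} \<tau> *\<^sub>R conv X (GG \<tau>) z) \<le> (D * japan z powr - s) * indicator {0<..1} \<tau>" for \<tau> z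
    using dt[of \<tau> z] by (auto simp: indicator_def)
  have i01: "integrable lborel (indicator {0<..1::real} :: real \<Rightarrow> real)" by simp
  have mm[measurable]: "(\<lambda>(z, \<tau>). conv X (GG \<tau>) z) \<in> borel_measurable (lborel \<Otimes>\<^sub>M lborel)"
    unfolding conv_def GG_def by measurable
  have Hm: "H \<in> borel_measurable borel" unfolding H_def by measurable
  have Hb: "norm (H z) \<le> D * japan z powr - s" for z
  proof -
    have "norm (H z) \<le> (LBINT \<tau>. (D * japan z powr - s) * indicator {0<..1::real} \<tau>)"
      unfolding H_def by (rule norm_integral_dominated[OF integrable_mult_right[OF i01] dti])
    then show ?thesis by simp
  qed
  have "ft H x = (LBINT \<tau>. indicator {0<..1::real} \<tau> *\<^sub>R (w x * v (\<tau> *\<^sub>R x)))" if x: "x \<in> cball 0 R" for x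
  proof -
    have "ft H x = (LBINT z. (LBINT \<tau>. indicator {0<..1::real} \<tau> *\<^sub>R conv X (GG \<tau>) z * ch (z \<bullet> x)))"
      unfolding ft_def H_def integral_mult_left_zero ..
    also have "\<dots> = (LBINT \<tau>. (LBINT z. indicator {0<..1::real} \<tau> *\<^sub>R conv X (GG \<tau>) z * ch (z \<bullet> x)))"
    proof (rule Fubini_bound[where g="\<lambda>z. D * japan z powr - s" and h="indicator {0<..1}"])
      show "integrable lborel (\<lambda>z::real^'n. D * japan z powr - s)" by (intro integrable_mult_right integrable_japan_powr s)
      show "norm (indicator {0<..1::real} \<tau> *\<^sub>R conv X (GG \<tau>) z * ch (z \<bullet> x)) \<le> D * japan z powr - s * indicator {0<..1} \<tau>" for z \<tau>
        using dti[of \<tau> z] by (simp add: norm_mult)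
    qed (use i01 in auto)
    also have "\<dots> = (LBINT \<tau>. indicator {0<..1::real} \<tau> *\<^sub>R (w x * v (\<tau> *\<^sub>R x)))"
    proof (rule Bochner_Integration.integral_cong[OF refl])
      fix \<tau> :: real
      show "(LBINT z. indicator {0<..1::real} \<tau> *\<^sub>R conv X (GG \<tau>) z * ch (z \<bullet> x)) = indicator {0<..1::real} \<tau> *\<^sub>R (w x * v (\<tau> *\<^sub>R x))"
      proof (cases "\<tau> \<in> {0<..1}")
        case True
        then have t: "0 < \<tau>" "\<tau> \<le> 1" by auto
        have "norm (\<tau> *\<^sub>R x) \<le> norm x" using t by (simp add: mult_left_le_one_le)
        then have tx: "\<tau> *\<^sub>R x \<in> cball 0 R" using x by simp
        have "(LBINT z. conv X (GG \<tau>) z * ch (z \<bullet> x)) = ft (conv X (GG \<tau>)) x" by (simp add: ft_def)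
        also have "\<dots> = ft X x * ft (GG \<tau>) x"
          unfolding GG_def using s t
          by (intro ft_conv integrable_dilate decays_integrable[OF X(1)] decays_integrable[OF G(1)]) auto
        also have "ft (GG \<tau>) x = ft G (\<tau> *\<^sub>R x)" unfolding GG_def by (rule ft_dilate[OF t(1)])
        finally show ?thesis using True X(2)[OF x] G(2)[OF tx] by simp
      qed simp
    qed
    finally show ?thesis .
  qed
  then show ?thesis using Hb Hm unfolding rep_def decays_def D_def by (intro exI[of _ H]) auto
qed


section \<open>From the hypothesis on the derivatives to the local phase\<close>

lemma stft_eq:
  "stft_integrand f x \<xi> y = f y * complex_of_real (window (y - x)) * ch (- (y \<bullet> \<xi>))"
  by (simp add: stft_integrand_def ch_def algebra_simps)

lemma Lp_qnorm_inf: "Lp_qnorm \<infinity> F = esssup lborel F"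
  by (simp add: Lp_qnorm_def)

lemma in_W_inf_AE_bound:
  assumes "in_W \<infinity> \<infinity> s f"
  obtains A where "0 \<le> A" "AE x in lborel. AE \<xi> in lborel. norm (stft f x \<xi>) \<le> A * japan \<xi> powr - s"
proof
  define W where "W = wa_norm \<infinity> \<infinity> s f"
  have Wf: "W < \<infinity>" using assms by (simp add: in_W_def W_def)
  then have We: "W = ennreal (enn2real W)" by simp
  show "0 \<le> enn2real W" by simp
  have "AE x in lborel. esssup lborel (\<lambda>\<xi>. ennreal (norm (stft f x \<xi>) * japan \<xi> powr s)) \<le> W"
    unfolding W_def wa_norm_def Lp_qnorm_inf by (rule esssup_AE)
  then show "AE x in lborel. AE \<xi> in lborel. norm (stft f x \<xi>) \<le> enn2real W * japan \<xi> powr - s"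
  proof (rule eventually_mono)
    fix x assume x: "esssup lborel (\<lambda>\<xi>. ennreal (norm (stft f x \<xi>) * japan \<xi> powr s)) \<le> W"
    have "AE \<xi> in lborel. ennreal (norm (stft f x \<xi>) * japan \<xi> powr s) \<le> esssup lborel (\<lambda>\<xi>. ennreal (norm (stft f x \<xi>) * japan \<xi> powr s))"
      by (rule esssup_AE)
    then show "AE \<xi> in lborel. norm (stft f x \<xi>) \<le> enn2real W * japan \<xi> powr - s"
    proof (rule eventually_mono)
      fix \<xi> assume "ennreal (norm (stft f x \<xi>) * japan \<xi> powr s) \<le> esssup lborel (\<lambda>\<xi>. ennreal (norm (stft f x \<xi>) * japan \<xi> powr s))"
      then have "ennreal (norm (stft f x \<xi>) * japan \<xi> powr s) \<le> ennreal (enn2real W)" using x We by simp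
      then have "norm (stft f x \<xi>) * japan \<xi> powr s \<le> enn2real W" by simp
      then show "norm (stft f x \<xi>) \<le> enn2real W * japan \<xi> powr - s"
        by (intro le_japan_powrI) (simp only: mult.commute)
    qed
  qed
qed

lemma continuous_ft:
  assumes "integrable lborel G"
  shows "continuous_on UNIV (ft G)"
  unfolding ft_def
proof (rule continuous_on_integral_dominated[where w="\<lambda>y. norm (G y)"])
  have [measurable]: "G \<in> borel_measurable borel" using assms by auto
  show "(\<lambda>y. G y * ch (y \<bullet> x)) \<in> borel_measurable lborel" for x by measurable
  show "continuous_on UNIV (\<lambda>x. G y * ch (y \<bullet> x))" for y by (intro continuous_intros)
qed (use assms in \<open>auto simp: norm_mult\<close>)

text \<open>Up to a phase and a reflection, the short-time transform at x is the transform of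
  \<open>g (x + t) * window t\<close>, which is thereby represented; on a ball the window can be
  divided out by \<open>rep_one_div_window\<close>. The bound in the frequency holds everywhere by
  continuity, that in x only almost everywhere, with one constant.\<close>

lemma in_W_local_rep:
  fixes g :: "real^'n::finite \<Rightarrow> complex"
  assumes W: "in_W \<infinity> \<infinity> s g" and c: "continuous_on UNIV g" and s: "real CARD('n) < s"
  obtains B where "AE x in lborel. rep s B (cball 0 R) (\<lambda>t. g (x + t))"
proof -
  obtain A where A: "0 \<le> A" "AE x in lborel. AE \<xi> in lborel. norm (stft g x \<xi>) \<le> A * japan \<xi> powr - s"
    by (rule in_W_inf_AE_bound[OF W])
  obtain D where D: "rep s D (cball 0 R) (\<lambda>x::real^'n. complex_of_real (1 / window x))"
    by (rule rep_one_div_window[OF s])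
  have "rep s (kconst TYPE('n) s * A * D) (cball 0 R) (\<lambda>t. g (x + t))"
    if x: "AE \<xi> in lborel. norm (stft g x \<xi>) \<le> A * japan \<xi> powr - s" for x
  proof -
    let ?f = "\<lambda>t. g (x + t) * complex_of_real (window t)"
    have cf: "continuous_on UNIV ?f"
      by (intro continuous_intros continuous_on_compose2[OF c]) auto
    have "integrable lborel (stft_integrand g x 0)" using W by (simp add: in_W_def)
    then have i0: "integrable lborel (\<lambda>y. g y * complex_of_real (window (y - x)))"
      by (simp add: stft_eq[abs_def])
    have fi: "integrable lborel ?f"
      using lborel_integrable_translate(1)[of "\<lambda>y. g y * complex_of_real (window (y - x))" x] i0 by simp
    have eq: "norm (ft ?f y) = norm (stft g x (- y))" for y
    proof -
      have "ft ?f y = (LBINT t. (\<lambda>z. g z * complex_of_real (window (z - x)) * ch ((z - x) \<bullet> y)) (x + t))"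
        by (simp add: ft_def)
      also have "\<dots> = (LBINT z. g z * complex_of_real (window (z - x)) * ch ((z - x) \<bullet> y))"
        by (rule lborel_integral_translate(1))
      also have "\<dots> = (LBINT z. stft_integrand g x (- y) z * ch (- (x \<bullet> y)))"
        by (simp add: stft_eq inner_diff_left ch_diff mult.assoc)
      also have "\<dots> = stft g x (- y) * ch (- (x \<bullet> y))" by (simp add: stft_def)
      finally show ?thesis by (simp add: norm_mult)
    qed
    have cft: "continuous_on UNIV (ft ?f)" by (rule continuous_ft[OF fi])
    have cft': "continuous_on UNIV (\<lambda>y. ft ?f (- y))"
      by (intro continuous_on_compose2[OF cft] continuous_intros) auto
    have "norm (ft ?f (- y)) \<le> A * japan y powr - s" for y
    proof (rule AE_le_continuous[where u="\<lambda>y. norm (ft ?f (- y))" and v="\<lambda>y. A * japan y powr - s"])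
      show "continuous_on UNIV (\<lambda>y. norm (ft ?f (- y)))" by (intro continuous_intros cft')
      show "continuous_on UNIV (\<lambda>y::real^'n. A * japan y powr - s)" by (intro continuous_intros) auto
      show "AE y in lborel. norm (ft ?f (- y)) \<le> A * japan y powr - s" using x by (simp add: eq)
    qed
    from this[of "- _"] have "norm (ft ?f y) \<le> A * japan y powr - s" for y by simp
    then have "rep s A UNIV ?f" by (intro rep_of_ft_bound cf fi s)
    then have "rep s A (cball 0 R) ?f" by (rule rep_subset) simp
    from rep_mult[OF this D s] show ?thesis by (rule rep_cong) simp
  qed
  then have "AE x in lborel. rep s (kconst TYPE('n) s * A * D) (cball 0 R) (\<lambda>t. g (x + t))"
    using A(2) by auto
  then show ?thesis by (rule that)
qed

lemma frechet_derivative_partial: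
  fixes f :: "real^'n::finite \<Rightarrow> 'b::real_normed_vector"
  assumes "f differentiable (at x)"
  shows "frechet_derivative f (at x) t = (\<Sum>j\<in>UNIV. (t $ j) *\<^sub>R partial j f x)"
proof -
  have lin: "linear (frechet_derivative f (at x))" by (rule linear_frechet_derivative[OF assms])
  have "t = (\<Sum>j\<in>UNIV. (t $ j) *\<^sub>R axis j 1)"
    using basis_expansion[of t] by (simp add: scalar_mult_eq_scaleR)
  then have "frechet_derivative f (at x) t = frechet_derivative f (at x) (\<Sum>j\<in>UNIV. (t $ j) *\<^sub>R axis j 1)" by simp
  also have "\<dots> = (\<Sum>j\<in>UNIV. (t $ j) *\<^sub>R partial j f x)"
    by (simp add: linear_sum[OF lin] linear_scale[OF lin] partial_def)
  finally show ?thesis .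
qed

lemma has_vector_derivative_ray:
  fixes f :: "real^'n::finite \<Rightarrow> 'b::real_normed_vector"
  assumes "\<And>x. f differentiable (at x)"
  shows "((\<lambda>\<tau>. f (x + \<tau> *\<^sub>R t)) has_vector_derivative (\<Sum>j\<in>UNIV. (t $ j) *\<^sub>R partial j f (x + \<tau> *\<^sub>R t))) (at \<tau> within S)"
proof -
  have "(f has_derivative frechet_derivative f (at (x + \<tau> *\<^sub>R t))) (at (x + \<tau> *\<^sub>R t))"
    using assms frechet_derivative_works by blast
  moreover have "((\<lambda>\<tau>. x + \<tau> *\<^sub>R t) has_derivative (\<lambda>h. h *\<^sub>R t)) (at \<tau> within S)"
    by (auto intro!: derivative_eq_intros)
  ultimately have "((\<lambda>\<tau>. f (x + \<tau> *\<^sub>R t)) has_derivative (\<lambda>h. frechet_derivative f (at (x + \<tau> *\<^sub>R t)) (h *\<^sub>R t))) (at \<tau> within S)"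
    by (rule has_derivative_compose[rotated])
  then show ?thesis
    unfolding has_vector_derivative_def
    using linear_scale[OF linear_frechet_derivative[OF assms]] by (simp add: frechet_derivative_partial[OF assms])
qed

lemma ray_FTC:
  fixes f :: "real^'n::finite \<Rightarrow> 'b::euclidean_space"
  assumes d: "\<And>x. f differentiable (at x)" and c: "\<And>j. continuous_on UNIV (partial j f)"
  shows "f (x + t) - f x = (\<Sum>j\<in>UNIV. \<integral>\<tau>. indicator {0<..1::real} \<tau> *\<^sub>R ((t $ j) *\<^sub>R partial j f (x + \<tau> *\<^sub>R t)) \<partial>lborel)"
proof -
  let ?p = "\<lambda>j \<tau>. (t $ j) *\<^sub>R partial j f (x + \<tau> *\<^sub>R t)"
  have cp: "continuous_on S (?p j)" for j S
    by (intro continuous_intros continuous_on_compose2[OF c]) auto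
  have ip: "integrable lborel (\<lambda>\<tau>. indicator {0..1::real} \<tau> *\<^sub>R ?p j \<tau>)" for j
    using borel_integrable_atLeastAtMost'[OF cp, of 0 1] by (simp add: set_integrable_def)
  \<comment> \<open>The endpoint 0 is dropped because the dilation by \<tau> = 0 is not invertible;
    \<open>rep_ray_integral\<close> therefore works on the half-open interval.\<close>
  have AE: "AE \<tau> in lborel. (indicator {0<..1::real} \<tau> :: real) = indicator {0..1} \<tau>"
    using AE_lborel_singleton[of "0::real"] by eventually_elim (auto simp: indicator_def)
  have "(LBINT \<tau>. indicator {0..1} \<tau> *\<^sub>R (\<Sum>j\<in>UNIV. ?p j \<tau>)) = f (x + 1 *\<^sub>R t) - f (x + 0 *\<^sub>R t)"
    by (rule integral_FTC_Icc[OF _ has_vector_derivative_ray[OF d]]) (auto intro!: continuous_on_sum cp)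
  then have "f (x + t) - f x = (LBINT \<tau>. (\<Sum>j\<in>UNIV. indicator {0..1} \<tau> *\<^sub>R ?p j \<tau>))"
    by (simp add: scaleR_sum_right)
  also have "\<dots> = (\<Sum>j\<in>UNIV. \<integral>\<tau>. indicator {0..1} \<tau> *\<^sub>R ?p j \<tau> \<partial>lborel)"
    by (rule Bochner_Integration.integral_sum[OF ip])
  also have "\<dots> = (\<Sum>j\<in>UNIV. \<integral>\<tau>. indicator {0<..1} \<tau> *\<^sub>R ?p j \<tau> \<partial>lborel)"
  proof (intro sum.cong refl integral_cong_AE)
    fix j
    have [measurable]: "?p j \<in> borel_measurable borel" by (rule borel_measurable_continuous_onI[OF cp])
    show "(\<lambda>\<tau>. indicator {0..1} \<tau> *\<^sub>R ?p j \<tau>) \<in> borel_measurable lborel" "(\<lambda>\<tau>. indicator {0<..1} \<tau> *\<^sub>R ?p j \<tau>) \<in> borel_measurable lborel"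
      by measurable
    show "AE \<tau> in lborel. indicator {0..1} \<tau> *\<^sub>R ?p j \<tau> = indicator {0<..1} \<tau> *\<^sub>R ?p j \<tau>"
      using AE by eventually_elim simp
  qed
  finally show ?thesis .
qed

text \<open>Integrating the gradient from x to x + t gives \<open>mu (x + t) - mu x\<close> as a sum
  of ray integrals with factors \<open>t $ j\<close>, to which \<open>rep_ray_integral\<close>
  applies; \<open>rep_exp\<close> passes to the exponential. Finitely many derivatives give one
  common null set and one constant for all other x.\<close>

lemma local_phase_rep:
  fixes mu :: "real^'n::finite \<Rightarrow> real"
  assumes C1: "C1_fun mu" and s: "real CARD('n) < s"
    and W: "\<And>j. in_W \<infinity> \<infinity> s (\<lambda>x. complex_of_real (partial j mu x))"
  obtains B where "AE x in lborel. rep s B (cball 0 R) (\<lambda>t. cis (mu (x + t) - mu x) - 1)"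
proof -
  have d: "mu differentiable (at x)" and c: "continuous_on UNIV (partial j mu)" for x j
    using C1 by (auto simp: C1_fun_def)
  \<comment> \<open>The coordinate factor is represented with order 2 s, as
    \<open>rep_ray_integral\<close> demands.\<close>
  have s2: "real CARD('n) < 2 * s" using s by simp
  have "\<exists>A. rep (2 * s) A (cball 0 R) (\<lambda>x. complex_of_real (x $ j))" for j :: 'n
    by (rule rep_nth[OF s2]) blast
  then obtain X where X: "\<And>j::'n. rep (2 * s) (X j) (cball 0 R) (\<lambda>x. complex_of_real (x $ j))"
    by metis
  have "\<exists>B. AE x in lborel. rep s B (cball 0 R) (\<lambda>t. complex_of_real (partial j mu (x + t)))" for j
    by (rule in_W_local_rep[OF W _ s]) (use c in \<open>auto intro!: continuous_on_of_real\<close>)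
  then obtain V where V: "\<And>j. AE x in lborel. rep s (V j) (cball 0 R) (\<lambda>t. complex_of_real (partial j mu (x + t)))"
    by metis
  define B where "B = (\<Sum>j\<in>UNIV. X j * V j * (2 powr s * (2 powr s * (2 * jint TYPE('n) s))))"
  have "AE x in lborel. \<forall>j. rep s (V j) (cball 0 R) (\<lambda>t. complex_of_real (partial j mu (x + t)))"
    using V by (simp add: AE_all_countable)
  then have "AE x in lborel. rep s (B * exp (kconst TYPE('n) s * B)) (cball 0 R) (\<lambda>t. cis (mu (x + t) - mu x) - 1)"
  proof (rule eventually_mono)
    fix x assume x: "\<forall>j. rep s (V j) (cball 0 R) (\<lambda>t. complex_of_real (partial j mu (x + t)))"
    have "rep s B (cball 0 R) (\<lambda>t. \<Sum>j\<in>UNIV. \<integral>\<tau>. indicator {0<..1::real} \<tau> *\<^sub>R (complex_of_real (t $ j) * complex_of_real (partial j mu (x + \<tau> *\<^sub>R t))) \<partial>lborel)"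
      unfolding B_def using x by (intro rep_sum s rep_ray_integral[OF X]) auto
    then have "rep s B (cball 0 R) (\<lambda>t. complex_of_real (mu (x + t) - mu x))"
    proof (rule rep_cong)
      fix t
      have "(LBINT \<tau>. indicator {0<..1::real} \<tau> *\<^sub>R (complex_of_real (t $ j) * complex_of_real (partial j mu (x + \<tau> *\<^sub>R t))))
          = complex_of_real (LBINT \<tau>. indicator {0<..1::real} \<tau> *\<^sub>R ((t $ j) *\<^sub>R partial j mu (x + \<tau> *\<^sub>R t)))" for j
        unfolding integral_complex_of_real[symmetric] by (simp add: scaleR_conv_of_real)
      then show "(\<Sum>j\<in>UNIV. \<integral>\<tau>. indicator {0<..1::real} \<tau> *\<^sub>R (complex_of_real (t $ j) * complex_of_real (partial j mu (x + \<tau> *\<^sub>R t))) \<partial>lborel) = complex_of_real (mu (x + t) - mu x)"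
        unfolding ray_FTC[OF d c] of_real_sum by (simp only:)
    qed
    from rep_exp[OF this s]
    show "rep s (B * exp (kconst TYPE('n) s * B)) (cball 0 R) (\<lambda>t. cis (mu (x + t) - mu x) - 1)"
      by (simp add: cis_conv_exp)
  qed
  then show ?thesis by (rule that)
qed

section \<open>The kernel estimate\<close>

definition VV :: "(real^'n::finite \<Rightarrow> complex) \<Rightarrow> real^'n \<Rightarrow> real^'n \<Rightarrow> complex" where
  "VV h x \<xi> = (LBINT \<eta>. h \<eta> * complex_of_real (window (\<eta> - \<xi>)) * ch (x \<bullet> \<eta>))"

definition omega :: "real \<Rightarrow> (real^'n::finite) \<times> (real^'n) \<Rightarrow> real" where
  "omega s Y = japan (fst Y) powr - s * japan (snd Y) powr - s"

lemma omega_nonneg [simp]: "0 \<le> omega s Y" and omega_pos [simp]: "0 < omega s Y"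
  by (auto simp: omega_def)

lemma borel_measurable_omega [measurable]: "omega s \<in> borel_measurable borel"
  unfolding omega_def by (rule borel_measurable_continuous_onI) (intro continuous_intros; simp)

lemma integrable_omega:
  assumes "real CARD('n::finite) < s"
  shows "integrable lborel (omega s :: (real^'n) \<times> (real^'n) \<Rightarrow> real)"
  unfolding lborel_prod[symmetric]
  by (rule integrable_pair_bound[where g="\<lambda>x. japan x powr - s" and h="\<lambda>x. japan x powr - s"])
    (use assms in \<open>auto simp: integrable_japan_powr omega_def[abs_def]\<close>)

lemma omega_le_1: "0 \<le> s \<Longrightarrow> omega s Y \<le> 1"
  unfolding omega_def using japan_ge_1[of "fst Y"] japan_ge_1[of "snd Y"]
  by (intro mult_le_one) (auto simp: powr_minus_divide ge_one_powr_ge_zero)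

lemma omega_powr: "omega s Y powr r = omega (s * r) Y"
  by (simp add: omega_def powr_mult powr_powr)

text \<open>Each of the two components contributes a factor \<open>2 powr s\<close> by
  \<open>japan_add\<close>. This lets a weighted supremum absorb translations in
  \<open>self_improvement\<close>.\<close>

lemma omega_Peetre: 
  assumes s: "0 \<le> s"
  shows "omega s Z * omega s (Y - Z) \<le> 4 powr s * omega s Y"
proof -
  have *: "japan b powr - s * japan (a - b) powr - s \<le> 2 powr s * japan a powr - s" for a b :: "real^'n"
  proof -
    have "japan a \<le> 2 * japan b * japan (a - b)" using japan_add[of b "a - b"] by simp
    then have "(2 * japan b * japan (a - b)) powr - s \<le> japan a powr - s"
      using s by (intro powr_mono2') auto
    then have "2 powr - s * (japan b powr - s * japan (a - b) powr - s) \<le> japan a powr - s"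
      by (simp add: powr_mult mult.assoc)
    then have "2 powr s * (2 powr - s * (japan b powr - s * japan (a - b) powr - s)) \<le> 2 powr s * japan a powr - s"
      by (intro mult_left_mono) auto
    then show ?thesis by (simp add: mult.assoc[symmetric] powr_add[symmetric])
  qed
  have "omega s Z * omega s (Y - Z) = (japan (fst Z) powr - s * japan (fst Y - fst Z) powr - s) * (japan (snd Z) powr - s * japan (snd Y - snd Z) powr - s)"
    by (simp add: omega_def)
  also have "\<dots> \<le> (2 powr s * japan (fst Y) powr - s) * (2 powr s * japan (snd Y) powr - s)"
    by (intro mult_mono *) auto
  also have "\<dots> = (2 * 2) powr s * omega s Y" unfolding omega_def by (subst powr_mult) auto
  finally show ?thesis by simp
qed

lemma VV_le:
  assumes h: "integrable lborel h"
  shows "norm (VV h x \<xi>) \<le> (LBINT \<eta>. norm (h \<eta>))"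
  unfolding VV_def using h
  by (intro norm_integral_dominated) (auto simp: norm_mult intro!: mult_left_le window_le_1)

lemma continuous_VV:
  fixes h :: "real^'n::finite \<Rightarrow> complex"
  assumes h: "integrable lborel h"
  shows "continuous_on UNIV (\<lambda>X. VV h (fst X) (snd X))"
  unfolding VV_def
proof (rule continuous_on_integral_dominated[where w="\<lambda>\<eta>. norm (h \<eta>)"])
  have [measurable]: "h \<in> borel_measurable borel" using h by auto
  show "(\<lambda>\<eta>. h \<eta> * complex_of_real (window (\<eta> - snd X)) * ch (fst X \<bullet> \<eta>)) \<in> borel_measurable lborel" for X
    by measurable
  show "continuous_on UNIV (\<lambda>X. h \<eta> * complex_of_real (window (\<eta> - snd X)) * ch (fst X \<bullet> \<eta>))" for \<eta>
    by (intro continuous_intros)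
  show "norm (h \<eta> * complex_of_real (window (\<eta> - snd X)) * ch (fst X \<bullet> \<eta>)) \<le> norm (h \<eta>)" for X \<eta>
    by (auto simp: norm_mult intro!: mult_left_le window_le_1)
qed (use h in auto)

lemma borel_measurable_VV:
  fixes h :: "real^'n::finite \<Rightarrow> complex"
  assumes h: "integrable lborel h"
  shows "(\<lambda>X. VV h (fst X) (snd X)) \<in> borel_measurable borel"
  by (rule borel_measurable_continuous_onI[OF continuous_VV[OF h]])

text \<open>This is where compact support of the cut-off enters: off S the product vanishes whatever
  h is, so a local representation of h yields a global one of the product.\<close>

lemma rep_mult_supp:
  fixes g h :: "real^'n::finite \<Rightarrow> complex"
  assumes g: "rep s B UNIV g" and h: "rep s B' S h" and s: "real CARD('n) < s"
    and z: "\<And>x. x \<notin> S \<Longrightarrow> g x = 0"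
  shows "rep s (kconst TYPE('n) s * B * B') UNIV (\<lambda>x. g x * h x)"
proof -
  obtain G H where G: "decays s B G" "\<And>x. g x = ft G x" and H: "decays s B' H" "\<forall>x\<in>S. h x = ft H x"
    using g h by (auto simp: rep_def)
  have "g x * h x = ft (conv G H) x" for x
    using z[of x] G(2)[of x] H(2) by (cases "x \<in> S") (simp_all add: ft_conv decays_integrable[OF G(1) s] decays_integrable[OF H(1) s])
  then show ?thesis using decays_conv[OF G(1) H(1) s] by (auto simp: rep_def)
qed

lemma window_add: "window (t + m) = window m * (exp ((- 2 * pi) *\<^sub>R m \<bullet> t) * window t)"
proof -
  have "(norm (t + m))\<^sup>2 = (norm t)\<^sup>2 + 2 * (m \<bullet> t) + (norm m)\<^sup>2"
    by (simp add: power2_norm_eq_inner inner_add_left inner_add_right inner_commute)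
  then show ?thesis unfolding window_def exp_add[symmetric] by (simp add: algebra_simps)
qed

text \<open>As \<open>ft L\<close>, the local factor is a superposition of characters in \<eta>.
  Multiplying the integrand of \<open>VV\<close> by a character merely translates the first
  argument, here by y, and L supplies the weight in y. The phase at \<open>\<xi> + m\<close> is
  constant and has modulus one.\<close>

lemma kernel_piece:
  fixes h :: "real^'n::finite \<Rightarrow> complex"
  assumes h: "integrable lborel h" and s: "real CARD('n) < s" 
    and r: "rep s D UNIV (\<lambda>t. expw ((- 2 * pi) *\<^sub>R m) \<beta> t * cis (mu (\<xi> + m + t) - mu (\<xi> + m)))"
  shows "norm (LBINT \<eta>. h \<eta> * cis (mu \<eta>) * complex_of_real (window (\<eta> - \<xi>)) * ch (x \<bullet> \<eta>) * \<beta> (\<eta> - \<xi> - m))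
    \<le> window m * D * (LBINT y. japan y powr - s * norm (VV h (x + y) (\<xi> + m)))"
proof -
  obtain L where L: "decays s D L" "\<And>t. expw ((- 2 * pi) *\<^sub>R m) \<beta> t * cis (mu (\<xi> + m + t) - mu (\<xi> + m)) = ft L t"
    using r by (auto simp: rep_def)
  have [measurable]: "h \<in> borel_measurable borel" "L \<in> borel_measurable borel" using h decays_measurable[OF L(1)] by auto
  let ?z = "\<xi> + m"
  let ?c = "cis (mu ?z) * complex_of_real (window m)"
  let ?F = "\<lambda>\<eta> y. (h \<eta> * complex_of_real (window (\<eta> - ?z)) * ch (x \<bullet> \<eta>)) * (L y * ch (y \<bullet> (\<eta> - ?z)))"
  have D0: "0 \<le> D" using decays_nonneg[OF L(1)] .
  have "h \<eta> * cis (mu \<eta>) * complex_of_real (window (\<eta> - \<xi>)) * ch (x \<bullet> \<eta>) * \<beta> (\<eta> - \<xi> - m) = ?c * (LBINT y. ?F \<eta> y)" for \<eta>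
  proof -
    \<comment> \<open>Recentring the window at \<open>\<xi> + m\<close> leaves an exponential, which
      \<open>expw\<close> attaches to the cut-off, and the small factor
      \<open>window m\<close>.\<close>
    have e1: "window (\<eta> - \<xi>) = window m * (exp ((- 2 * pi) *\<^sub>R m \<bullet> (\<eta> - ?z)) * window (\<eta> - ?z))"
      using window_add[of "\<eta> - ?z" m] by simp
    have e2: "cis (mu \<eta>) = cis (mu ?z) * cis (mu (?z + (\<eta> - ?z)) - mu ?z)"
      by (simp add: cis_mult)
    have e3: "\<eta> - \<xi> - m = \<eta> - ?z" by simp
    have "h \<eta> * cis (mu \<eta>) * complex_of_real (window (\<eta> - \<xi>)) * ch (x \<bullet> \<eta>) * \<beta> (\<eta> - \<xi> - m)
      = ?c * ((h \<eta> * complex_of_real (window (\<eta> - ?z)) * ch (x \<bullet> \<eta>)) * (expw ((- 2 * pi) *\<^sub>R m) \<beta> (\<eta> - ?z) * cis (mu (?z + (\<eta> - ?z)) - mu ?z)))"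
      unfolding e3 e1 e2 expw_def by (simp only: of_real_mult mult_ac)
    also have "\<dots> = ?c * ((h \<eta> * complex_of_real (window (\<eta> - ?z)) * ch (x \<bullet> \<eta>)) * ft L (\<eta> - ?z))"
      by (simp only: L(2))
    also have "\<dots> = ?c * (LBINT y. ?F \<eta> y)"
      unfolding ft_def by (simp only: integral_mult_right_zero)
    finally show ?thesis .
  qed
  then have "(LBINT \<eta>. h \<eta> * cis (mu \<eta>) * complex_of_real (window (\<eta> - \<xi>)) * ch (x \<bullet> \<eta>) * \<beta> (\<eta> - \<xi> - m))
     = ?c * (LBINT \<eta>. (LBINT y. ?F \<eta> y))"
    by (simp only: integral_mult_right_zero)
  also have "(LBINT \<eta>. (LBINT y. ?F \<eta> y)) = (LBINT y. (LBINT \<eta>. ?F \<eta> y))"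
  proof (rule Fubini_bound[where g="\<lambda>\<eta>. norm (h \<eta>)" and h="\<lambda>y. norm (L y)"])
    show "norm (?F \<eta> y) \<le> norm (h \<eta>) * norm (L y)" for \<eta> y
      by (auto simp: norm_mult intro!: mult_right_mono mult_left_le window_le_1)
  qed (use h decays_integrable[OF L(1) s] in auto)
  also have "\<dots> = (LBINT y. L y * ch (- (y \<bullet> ?z)) * VV h (x + y) ?z)"
  proof (rule Bochner_Integration.integral_cong[OF refl])
    fix y
    have "?F \<eta> y = (L y * ch (- (y \<bullet> ?z))) * (h \<eta> * complex_of_real (window (\<eta> - ?z)) * ch ((x + y) \<bullet> \<eta>))" for \<eta>
      by (simp add: inner_add_left ch_add inner_diff_right ch_diff)
    then show "(LBINT \<eta>. ?F \<eta> y) = L y * ch (- (y \<bullet> ?z)) * VV h (x + y) ?z"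
      unfolding VV_def by (simp only: integral_mult_right_zero)
  qed
  finally have "norm (LBINT \<eta>. h \<eta> * cis (mu \<eta>) * complex_of_real (window (\<eta> - \<xi>)) * ch (x \<bullet> \<eta>) * \<beta> (\<eta> - \<xi> - m))
     = window m * norm (LBINT y. L y * ch (- (y \<bullet> ?z)) * VV h (x + y) ?z)"
    by (simp add: norm_mult)
  also have "\<dots> \<le> window m * (LBINT y. D * (japan y powr - s * norm (VV h (x + y) ?z)))"
  proof (intro mult_left_mono norm_integral_dominated integrable_mult_right)
    have [measurable]: "(\<lambda>y. VV h (x + y) ?z) \<in> borel_measurable borel"
      using measurable_compose[OF _ borel_measurable_VV[OF h], of "\<lambda>y. (x + y, ?z)"] by simp
    show "integrable lborel (\<lambda>y. japan y powr - s * norm (VV h (x + y) ?z))"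
      by (rule integrable_dominated[OF integrable_mult_left[OF integrable_japan_powr[OF s]]])
        (auto simp: abs_mult intro!: mult_left_mono VV_le[OF h])
    show "norm (L y * ch (- (y \<bullet> ?z)) * VV h (x + y) ?z) \<le> D * (japan y powr - s * norm (VV h (x + y) ?z))" for y
      using decaysD[OF L(1)] by (auto simp: norm_mult mult.assoc[symmetric] intro!: mult_right_mono)
  qed auto
  also have "\<dots> = window m * D * (LBINT y. japan y powr - s * norm (VV h (x + y) ?z))"
    by (simp only: integral_mult_right_zero mult.assoc)
  finally show ?thesis .
qed

lemma cutoff_exists:
  assumes s: "real CARD('n::finite) < s"
  obtains \<beta> :: "real^'n \<Rightarrow> complex" and R C a D where "efd s \<beta>" "continuous_on UNIV \<beta>" "(LBINT t. \<beta> t) = 1"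
    "0 < R" "0 < D" "\<And>t. norm (\<beta> t) \<le> D * indicator (cball 0 R) t"
    "0 < C" "0 < a" "\<And>c. rep s (C * exp (a * norm c)) UNIV (expw c \<beta>)"
proof -
  obtain N :: nat where N: "s \<le> real (Suc N)" using real_arch_simple[of s] by (meson le_SucI of_nat_mono order_trans le_refl lessI less_imp_le)
  obtain \<beta> :: "real^'n \<Rightarrow> complex" where \<beta>: "continuous_on UNIV \<beta>" "efd (real (Suc N)) \<beta>" "(LBINT t. \<beta> t) = 1"
    using spline_exists by blast
  have e: "efd s \<beta>"
  proof -
    obtain C a where C: "0 < C" "\<And>c y. norm (ft (expw c \<beta>) y) \<le> C * exp (a * norm c) * japan y powr - real (Suc N)"
      using efdE[OF \<beta>(2)] by metis
    have "C * exp (a * norm c) * japan y powr - real (Suc N) \<le> C * exp (a * norm c) * japan y powr - s" for c y :: "real^'n"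
      using N C(1) japan_ge_1[of y] by (intro mult_left_mono powr_mono) auto
    then show ?thesis using \<beta>(2) order_trans[OF C(2)] unfolding efd_def by blast
  qed
  obtain R D where "0 < R" "0 < D" "\<And>t. norm (\<beta> t) \<le> D * indicator (cball 0 R) t"
    using efdD[OF e] by metis
  moreover obtain C a where "0 < C" "0 < a" "\<And>c. rep s (C * exp (a * norm c)) UNIV (expw c \<beta>)"
    using efd_rep[OF \<beta>(1) e s] by metis
  ultimately show ?thesis using that[OF e \<beta>(1,3)] by blast
qed

text \<open>For fixed \<eta>, the integral of \<open>\<beta> (\<eta> - \<xi> - m)\<close> over m is
  1, so the pieces reassemble to \<open>VV\<close> after an interchange of integrals.\<close>

lemma VV_cutoff:
  fixes h :: "real^'n::finite \<Rightarrow> complex" and x \<xi> :: "real^'n"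
  assumes h: "integrable lborel h" and mu[measurable]: "mu \<in> borel_measurable borel"
    and \<beta>: "continuous_on UNIV \<beta>" "(LBINT t. \<beta> t) = 1" "0 < R" "0 < D" "\<And>t. norm (\<beta> t) \<le> D * indicator (cball 0 R) t"
  defines "I \<equiv> \<lambda>m. (LBINT \<eta>. h \<eta> * cis (mu \<eta>) * complex_of_real (window (\<eta> - \<xi>)) * ch (x \<bullet> \<eta>) * \<beta> (\<eta> - \<xi> - m))"
  shows "integrable lborel I" and "VV (\<lambda>\<eta>. h \<eta> * cis (mu \<eta>)) x \<xi> = (LBINT m. I m)"
proof -
  have [measurable]: "h \<in> borel_measurable borel" using h by auto
  have [measurable]: "\<beta> \<in> borel_measurable borel" by (rule borel_measurable_continuous_onI[OF \<beta>(1)])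
  let ?a = "\<lambda>\<eta>. h \<eta> * cis (mu \<eta>) * complex_of_real (window (\<eta> - \<xi>)) * ch (x \<bullet> \<eta>)"
  have cm[measurable]: "cis \<in> borel_measurable borel"
    by (rule borel_measurable_continuous_onI) (intro continuous_intros)
  \<comment> \<open>On the support of the cut-off, \<eta> - \<xi> is within R of m; hence the window
    there is comparable to \<open>window m\<close> up to an exponential, which gives integrability
    in m.\<close>
  have b: "norm (?a \<eta> * \<beta> (\<eta> - \<xi> - m)) \<le> norm (h \<eta>) * (D * (exp (2 * pi * R * norm m) * window m))" for \<eta> m
  proof -
    define t where "t = \<eta> - \<xi> - m"
    have "window (\<eta> - \<xi>) * norm (\<beta> t) \<le> D * (exp (2 * pi * R * norm m) * window m)"
    proof (cases "norm t \<le> R")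
      case True
      have "- (m \<bullet> t) \<le> norm m * R"
        using Cauchy_Schwarz_ineq2[of m t] mult_left_mono[OF True, of "norm m", OF norm_ge_zero] by linarith
      then have "2 * pi * (- (m \<bullet> t)) \<le> 2 * pi * (norm m * R)" by (intro mult_left_mono) auto
      then have "exp ((- 2 * pi) *\<^sub>R m \<bullet> t) \<le> exp (2 * pi * R * norm m)" by (simp add: mult_ac)
      then have "exp ((- 2 * pi) *\<^sub>R m \<bullet> t) * window t \<le> exp (2 * pi * R * norm m) * 1"
        by (intro mult_mono window_le_1) auto
      then have "window m * (exp ((- 2 * pi) *\<^sub>R m \<bullet> t) * window t) \<le> window m * (exp (2 * pi * R * norm m) * 1)"
        by (intro mult_left_mono) auto
      then have "window (\<eta> - \<xi>) \<le> exp (2 * pi * R * norm m) * window m"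
        using window_add[of t m] by (simp add: t_def mult.commute)
      moreover have "norm (\<beta> t) \<le> D" using \<beta>(5)[of t] True by simp
      ultimately have "window (\<eta> - \<xi>) * norm (\<beta> t) \<le> (exp (2 * pi * R * norm m) * window m) * D"
        by (intro mult_mono) auto
      then show ?thesis by (simp add: mult.commute)
    next
      case False
      then have "\<beta> t = 0" using \<beta>(5)[of t] by simp
      then show ?thesis using \<beta>(4) by simp
    qed
    then have "norm (h \<eta>) * (window (\<eta> - \<xi>) * norm (\<beta> t)) \<le> norm (h \<eta>) * (D * (exp (2 * pi * R * norm m) * window m))"
      by (intro mult_left_mono) auto
    then show ?thesis by (simp add: norm_mult t_def mult.assoc)
  qed
  have hi: "integrable lborel (\<lambda>\<eta>. norm (h \<eta>))" using h by simp
  have wi: "integrable lborel (\<lambda>m::real^'n. D * (exp (2 * pi * R * norm m) * window m))"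
    by (intro integrable_mult_right integrable_exp_window)
  have int: "integrable (lborel \<Otimes>\<^sub>M lborel) (\<lambda>(\<eta>, m). ?a \<eta> * \<beta> (\<eta> - \<xi> - m))"
    by (rule integrable_pair_bound[OF hi wi]) (use b in auto)
  show "integrable lborel I" unfolding I_def
    using lborel_pair.integrable_snd[OF int] by simp
  have "(LBINT m. I m) = (LBINT \<eta>. (LBINT m. ?a \<eta> * \<beta> (\<eta> - \<xi> - m)))"
    unfolding I_def by (rule lborel_pair.Fubini_integral[OF int])
  also have "\<dots> = VV (\<lambda>\<eta>. h \<eta> * cis (mu \<eta>)) x \<xi>"
    unfolding VV_def by (simp add: lborel_integral_translate(3) \<beta>(2))
  finally show "VV (\<lambda>\<eta>. h \<eta> * cis (mu \<eta>)) x \<xi> = (LBINT m. I m)" ..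
qed

text \<open>R and C depend neither on h and mu nor on the point: R can be fixed before the
  hypothesis on mu is turned into local representations, and the same pair serves mu and the zero
  phase. Representations for almost every m suffice because m is integrated out.\<close>

lemma kernel_bound:
  assumes s: "real CARD('n::finite) < s"
  obtains R :: real and C :: "real \<Rightarrow> real" where "\<And>B. 0 \<le> B \<Longrightarrow> 0 < C B"
    "\<And>(h :: real^'n \<Rightarrow> complex) mu B x \<xi>. integrable lborel h \<Longrightarrow> mu \<in> borel_measurable borel \<Longrightarrow> 0 \<le> B \<Longrightarrow>
      AE m in lborel. rep s B (cball 0 R) (\<lambda>t. cis (mu (\<xi> + m + t) - mu (\<xi> + m)) - 1) \<Longrightarrow>
      norm (VV (\<lambda>\<eta>. h \<eta> * cis (mu \<eta>)) x \<xi>) \<le> C B * (LBINT Y. omega s Y * norm (VV h (x + fst Y) (\<xi> + snd Y)))"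
proof -
  obtain \<beta> :: "real^'n \<Rightarrow> complex" and R C a D where \<beta>: "efd s \<beta>" "continuous_on UNIV \<beta>" "(LBINT t. \<beta> t) = 1"
    "0 < R" "0 < D" "\<And>t. norm (\<beta> t) \<le> D * indicator (cball 0 R) t"
    "0 < C" "0 < a" and r: "\<And>c. rep s (C * exp (a * norm c)) UNIV (expw c \<beta>)"
    using cutoff_exists[OF s] by metis
  obtain E where E: "0 < E" "\<And>z::real^'n. exp ((2 * pi * a) * norm z) * window z \<le> E * japan z powr - s"
    using exp_window_decay by blast
  let ?K = "kconst TYPE('n) s"
  have K: "0 < ?K" by (rule kconst_pos[OF s])
  \<comment> \<open>The 1 belongs to the constant term in cis = 1 + (cis - 1), \<open>?K * B\<close>
    to the represented rest; C comes from the weighted cut-off and E from the Gaussian absorbing its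
    growth in m.\<close>
  define F where "F B = (1 + ?K * B) * (C * E)" for B
  show ?thesis
  proof (rule that[of F R])
    show "0 < F B" if "0 \<le> B" for B
      unfolding F_def using that K \<beta> E(1) by (intro mult_pos_pos add_pos_nonneg) auto
    fix h :: "real^'n \<Rightarrow> complex" and mu :: "real^'n \<Rightarrow> real" and B :: real and x \<xi> :: "real^'n"
    assume h: "integrable lborel h" and mu: "mu \<in> borel_measurable borel" and B: "0 \<le> B"
      and ae: "AE m in lborel. rep s B (cball 0 R) (\<lambda>t. cis (mu (\<xi> + m + t) - mu (\<xi> + m)) - 1)"
    let ?I = "\<lambda>m. (LBINT \<eta>. h \<eta> * cis (mu \<eta>) * complex_of_real (window (\<eta> - \<xi>)) * ch (x \<bullet> \<eta>) * \<beta> (\<eta> - \<xi> - m))"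
    note cut = VV_cutoff[OF h mu \<beta>(2-6), where x=x and \<xi>=\<xi>]
    let ?J = "\<lambda>m. (LBINT y. japan y powr - s * norm (VV h (x + y) (\<xi> + m)))"
    have J0: "0 \<le> ?J m" for m by (intro integral_nonneg_AE) auto
    have piece: "norm (?I m) \<le> F B * (japan m powr - s * ?J m)"
      if m: "rep s B (cball 0 R) (\<lambda>t. cis (mu (\<xi> + m + t) - mu (\<xi> + m)) - 1)" for m
    proof -
      let ?c = "(- 2 * pi) *\<^sub>R m"
      have z: "expw ?c \<beta> t = 0" if "t \<notin> cball 0 R" for t
        using \<beta>(6)[of t] that by (simp add: expw_def)
      let ?D = "C * exp (a * norm ?c)"
      \<comment> \<open>The cut-off is represented globally and cis - 1 on its support, hence so is
        the product with 1 + (cis - 1).\<close>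
      have "rep s (?D + ?K * ?D * B) UNIV (\<lambda>t. expw ?c \<beta> t + expw ?c \<beta> t * (cis (mu (\<xi> + m + t) - mu (\<xi> + m)) - 1))"
        by (intro rep_add r rep_mult_supp[OF r m s z] s)
      then have "rep s (?D + ?K * ?D * B) UNIV (\<lambda>t. expw ?c \<beta> t * cis (mu (\<xi> + m + t) - mu (\<xi> + m)))"
        by (rule rep_cong) (simp add: algebra_simps)
      from kernel_piece[OF h s this, of x]
      have "norm (?I m) \<le> window m * (?D + ?K * ?D * B) * ?J m" .
      also have "window m * (?D + ?K * ?D * B) = (1 + ?K * B) * C * (exp ((2 * pi * a) * norm m) * window m)"
        by (simp add: algebra_simps)
      also have "\<dots> * ?J m \<le> (1 + ?K * B) * C * (E * japan m powr - s) * ?J m"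
        using K B \<beta>(7) by (intro mult_right_mono[OF _ J0] mult_left_mono E(2)) auto
      finally show ?thesis by (simp add: F_def mult_ac)
    qed
    have Fi: "integrable (lborel \<Otimes>\<^sub>M lborel) (\<lambda>(y, m). omega s (y, m) * norm (VV h (x + y) (\<xi> + m)))"
    proof (rule integrable_pair_bound)
      show "integrable lborel (\<lambda>y::real^'n. japan y powr - s * (LBINT \<eta>. norm (h \<eta>)))"
        "integrable lborel (\<lambda>y::real^'n. japan y powr - s)"
        by (intro integrable_mult_left integrable_japan_powr s)+
      have [measurable]: "(\<lambda>(y, m). VV h (x + y) (\<xi> + m)) \<in> borel_measurable (lborel \<Otimes>\<^sub>M lborel)"
        using measurable_compose[OF _ borel_measurable_VV[OF h], of "\<lambda>p. (x + fst p, \<xi> + snd p)" "lborel \<Otimes>\<^sub>M lborel"]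
        by (simp add: case_prod_beta' borel_prod[symmetric] cong: measurable_cong_sets)
      show "(\<lambda>(y, m). omega s (y, m) * norm (VV h (x + y) (\<xi> + m))) \<in> borel_measurable (lborel \<Otimes>\<^sub>M lborel)"
        unfolding omega_def by measurable
      show "norm (case (y, m) of (y, m) \<Rightarrow> omega s (y, m) * norm (VV h (x + y) (\<xi> + m))) \<le> japan y powr - s * (LBINT \<eta>. norm (h \<eta>)) * japan m powr - s" for y m
        using VV_le[OF h, of "x + y" "\<xi> + m"]
        by (auto simp: omega_def abs_mult mult.commute mult.left_commute intro!: mult_left_mono)
    qed
    have Ji: "integrable lborel (\<lambda>m. japan m powr - s * ?J m)"
    proof -
      have "(LBINT y. omega s (y, m) * norm (VV h (x + y) (\<xi> + m))) = japan m powr - s * ?J m" for m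
        unfolding omega_def by (subst integral_mult_right_zero[symmetric]) (simp add: mult_ac)
      then show ?thesis using lborel_pair.integrable_snd[OF Fi] by simp
    qed
    have "norm (VV (\<lambda>\<eta>. h \<eta> * cis (mu \<eta>)) x \<xi>) \<le> (LBINT m. norm (?I m))"
      unfolding cut(2) by (rule integral_norm_bound)
    also have "\<dots> \<le> (LBINT m. F B * (japan m powr - s * ?J m))"
    proof (rule integral_mono_AE)
      show "integrable lborel (\<lambda>m. norm (?I m))" using cut(1) by simp
      show "integrable lborel (\<lambda>m. F B * (japan m powr - s * ?J m))" using Ji by simp
      show "AE m in lborel. norm (?I m) \<le> F B * (japan m powr - s * ?J m)"
        using ae by (rule eventually_mono) (rule piece)
    qed
    also have "\<dots> = F B * (LBINT m. (LBINT y. omega s (y, m) * norm (VV h (x + y) (\<xi> + m))))"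
    proof -
      have "(LBINT y. omega s (y, m) * norm (VV h (x + y) (\<xi> + m))) = japan m powr - s * ?J m" for m
        unfolding omega_def by (subst integral_mult_right_zero[symmetric]) (simp add: mult_ac)
      then show ?thesis by simp
    qed
    also have "(LBINT m. (LBINT y. omega s (y, m) * norm (VV h (x + y) (\<xi> + m))))
      = (\<integral>(y, m). omega s (y, m) * norm (VV h (x + y) (\<xi> + m)) \<partial>(lborel \<Otimes>\<^sub>M lborel))"
      by (rule lborel_pair.integral_snd[OF Fi])
    also have "\<dots> = (LBINT Y. omega s Y * norm (VV h (x + fst Y) (\<xi> + snd Y)))"
      unfolding lborel_prod by (simp add: case_prod_beta')
    finally show "norm (VV (\<lambda>\<eta>. h \<eta> * cis (mu \<eta>)) x \<xi>) \<le> F B * (LBINT Y. omega s Y * norm (VV h (x + fst Y) (\<xi> + snd Y)))" .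
  qed
qed

text \<open>The trick of Stroemberg and Torchinsky: the power \<open>1 - r\<close> of \<open>w\<close> is estimated by the weighted
  supremum \<open>M\<close>, which the reproducing inequality then bounds by the \<open>r\<close>-average, too.\<close>

lemma self_improvement:
  fixes w :: "(real^'n::finite) \<times> (real^'n) \<Rightarrow> real"
  assumes r: "0 < r" "r \<le> 1" and s: "real CARD('n) < s * r"
    and [measurable]: "w \<in> borel_measurable borel" and w0: "\<And>X. 0 \<le> w X" and wW: "\<And>X. w X \<le> W"
    and C: "0 < C" and rp: "\<And>X. w X \<le> C * (LBINT Y. omega s Y * w (X + Y))"
    and D: "0 < D" and v: "0 \<le> v" "v \<le> D * (LBINT Y. omega s Y * w (X + Y))"
  shows "v powr r \<le> (D powr r * (C * 4 powr s) powr (1 - r)) * (LBINT Y. omega (s * r) Y * w (X + Y) powr r)"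
proof -
  have spos: "0 < s" using s r(1) by (smt (verit) mult_nonpos_nonneg of_nat_0_le_iff)
  then have sr: "s * r \<le> s" using r by (intro mult_left_le) auto
  then have s1: "real CARD('n) < s" using s by linarith
  have W0: "0 \<le> W" using w0 wW order_trans by blast
  let ?q = "\<lambda>Y. omega s Y * w (X + Y)"
  have q0: "0 \<le> ?q Y" for Y using w0 by simp
  have qW: "?q Y \<le> W" for Y
    using mult_mono[OF omega_le_1[of s Y] wW[of "X + Y"]] w0 spos by simp
  define M where "M = (SUP Y. ?q Y)"
  \<comment> \<open>Boundedness of w makes M finite; otherwise a power of M could not be divided out
    below.\<close>
  have bdd: "bdd_above (range ?q)" using qW by (intro bdd_aboveI[of _ W]) auto
  have qM: "?q Y \<le> M" for Y unfolding M_def by (rule cSUP_upper[OF _ bdd]) simp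
  have M0: "0 \<le> M" using q0 qM order_trans by blast
  define I where "I = (LBINT Y. omega (s * r) Y * w (X + Y) powr r)"
  have qr: "omega (s * r) Y * w (X + Y) powr r = ?q Y powr r" for Y
    by (simp add: powr_mult omega_powr)
  have qi: "integrable lborel (\<lambda>Y. omega s Y * w (Z + Y))" for Z
    by (rule integrable_dominated[OF integrable_mult_left[OF integrable_omega[OF s1], of W]])
      (simp_all add: abs_mult mult_left_mono w0 wW)
  have Ii: "integrable lborel (\<lambda>Y. ?q Y powr r)"
    unfolding qr[symmetric]
    by (rule integrable_dominated[OF integrable_mult_left[OF integrable_omega[OF s], of "W powr r"]])
      (use r in \<open>simp_all add: abs_mult mult_left_mono powr_mono2 w0 wW\<close>)
  have I0: "0 \<le> I" unfolding I_def by (intro integral_nonneg_AE) auto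
  have qMr: "?q Y \<le> M powr (1 - r) * ?q Y powr r" for Y
  proof (cases "?q Y = 0")
    case False
    then have "?q Y = ?q Y powr (1 - r) * ?q Y powr r" using q0[of Y] by (simp add: powr_add[symmetric])
    also have "\<dots> \<le> M powr (1 - r) * ?q Y powr r"
      using r q0 qM by (intro mult_right_mono powr_mono2) auto
    finally show ?thesis .
  next
    case True
    then show ?thesis by (simp only: powr_0)
  qed
  have int: "(LBINT Y. ?q Y) \<le> M powr (1 - r) * I"
  proof -
    have "(LBINT Y. ?q Y) \<le> (LBINT Y. M powr (1 - r) * ?q Y powr r)"
      by (intro integral_mono qi integrable_mult_right Ii qMr)
    then show ?thesis unfolding I_def qr by simp
  qed
  \<comment> \<open>The reproducing inequality at X + Z, with the translation moved onto the weight.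
    \<open>omega_Peetre\<close> trades the two weights for one that is free of Z, so the supremum
    over Z can be taken.\<close>
  have "?q Z \<le> (C * 4 powr s) * (LBINT Y. ?q Y)" for Z
  proof -
    have sh: "(LBINT Y. omega s Y * w (X + Z + Y)) = (LBINT Y. omega s (Y - Z) * w (X + Y))"
      using lborel_integral_translate(4)[of "\<lambda>Y. omega s Y * w (X + Z + Y)" Z] by (simp add: add.assoc)
    have shi: "integrable lborel (\<lambda>Y. omega s (Y - Z) * w (X + Y))"
      using lborel_integrable_translate(4)[of "\<lambda>Y. omega s Y * w (X + Z + Y)" Z] qi[of "X + Z"] by (simp add: add.assoc)
    have "?q Z \<le> omega s Z * (C * (LBINT Y. omega s (Y - Z) * w (X + Y)))"
      using rp[of "X + Z"] unfolding sh by (intro mult_left_mono) auto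
    also have "\<dots> = C * (LBINT Y. omega s Z * (omega s (Y - Z) * w (X + Y)))" by simp
    also have "\<dots> \<le> C * (LBINT Y. 4 powr s * ?q Y)"
    proof (intro mult_left_mono integral_mono integrable_mult_right shi qi)
      fix Y :: "(real^'n) \<times> (real^'n)"
      have "omega s Z * omega s (Y - Z) * w (X + Y) \<le> 4 powr s * omega s Y * w (X + Y)"
        using spos by (intro mult_right_mono omega_Peetre w0) auto
      then show "omega s Z * (omega s (Y - Z) * w (X + Y)) \<le> 4 powr s * ?q Y" by (simp add: mult.assoc)
    qed (use C in auto)
    finally show ?thesis by simp
  qed
  then have "M \<le> (C * 4 powr s) * (LBINT Y. ?q Y)"
    unfolding M_def by (intro cSUP_least) auto
  also have "\<dots> \<le> (C * 4 powr s) * (M powr (1 - r) * I)"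
    using C by (intro mult_left_mono int) auto
  finally have MI: "M \<le> (C * 4 powr s) * (M powr (1 - r) * I)" .
  show ?thesis
  proof (cases "M = 0")
    case True
    then have "?q Y = 0" for Y using q0[of Y] qM[of Y] by linarith
    then have "v = 0" using v by (simp only: integral_zero)
    then show ?thesis using I0 by (simp add: I_def)
  next
    case False
    then have M: "0 < M" using M0 by simp
    \<comment> \<open>M occurs on both sides; dividing by its power 1 - r bounds
      \<open>M powr r\<close> by the r-average.\<close>
    have "M powr r * M powr (1 - r) \<le> ((C * 4 powr s) * I) * M powr (1 - r)"
      using MI M by (simp add: powr_add[symmetric] mult_ac)
    then have Mr: "M powr r \<le> (C * 4 powr s) * I" using M by simp
    moreover have "0 < M powr r" using M by simp
    ultimately have "0 < (C * 4 powr s) * I" by linarith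
    moreover have "0 < C * 4 powr s" using C by simp
    ultimately have Ipos: "0 < I" by (rule zero_less_mult_pos)
    have "v \<le> D * (M powr (1 - r) * I)"
      by (rule order_trans[OF v(2) mult_left_mono[OF int less_imp_le[OF D]]])
    then have "v powr r \<le> (D * (M powr (1 - r) * I)) powr r"
      using v(1) r by (intro powr_mono2) auto
    also have "\<dots> = D powr r * ((M powr r) powr (1 - r) * I powr r)"
      using D M Ipos by (simp add: powr_mult powr_powr mult.commute)
    also have "\<dots> \<le> D powr r * (((C * 4 powr s) * I) powr (1 - r) * I powr r)"
      using r Mr by (intro mult_left_mono mult_right_mono powr_mono2) auto
    also have "\<dots> = D powr r * (C * 4 powr s) powr (1 - r) * (I powr (1 - r) * I powr r)"
      using C Ipos by (simp add: powr_mult)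
    also have "I powr (1 - r) * I powr r = I" using Ipos by (simp add: powr_add[symmetric])
    finally show ?thesis unfolding I_def .
  qed
qed

section \<open>Minkowski's inequality and mixed norms\<close>

lemma enn_rpow_top [simp]: "enn_rpow top r = top"
  by (simp add: enn_rpow_def)

lemma enn_rpow_ennreal: "0 \<le> x \<Longrightarrow> enn_rpow (ennreal x) r = ennreal (x powr r)"
  by (simp add: enn_rpow_def)

lemma enn_rpow_0 [simp]: "enn_rpow 0 r = 0"
  using enn_rpow_ennreal[of 0 r] by simp

lemma borel_measurable_enn_rpow [measurable (raw)]:
  assumes f[measurable]: "f \<in> borel_measurable M"
  shows "(\<lambda>x. enn_rpow (f x) r) \<in> borel_measurable M"
proof -
  have "{x \<in> space M. f x = \<infinity>} = f -` {\<infinity>} \<inter> space M" by auto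
  then have "{x \<in> space M. f x = \<infinity>} \<in> sets M" using measurable_sets[OF f] by simp
  then show ?thesis unfolding enn_rpow_def by (intro measurable_If) measurable
qed

lemma enn_rpow_mono: "x \<le> y \<Longrightarrow> 0 \<le> r \<Longrightarrow> enn_rpow x r \<le> enn_rpow y r"
  by (cases x; cases y) (auto simp: enn_rpow_ennreal powr_mono2 top_unique)

lemma enn_rpow_rpow: "0 < a \<Longrightarrow> enn_rpow (enn_rpow x a) b = enn_rpow x (a * b)"
  by (cases x) (auto simp: enn_rpow_ennreal powr_powr)

lemma enn_rpow_1 [simp]: "enn_rpow x 1 = x"
  by (cases x) (auto simp: enn_rpow_ennreal)

lemma enn_rpow_mult: "0 < r \<Longrightarrow> enn_rpow (x * y) r = enn_rpow x r * enn_rpow y r"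
proof (cases x; cases y)
  fix a b :: real assume "0 \<le> a" "x = ennreal a" "0 \<le> b" "y = ennreal b"
  then show ?thesis by (simp add: enn_rpow_ennreal powr_mult ennreal_mult[symmetric])
next
  fix a :: real assume "0 \<le> a" "x = ennreal a" "y = top"
  then show ?thesis by (cases "a = 0") (auto simp: enn_rpow_ennreal ennreal_mult_top)
next
  fix b :: real assume "x = top" "0 \<le> b" "y = ennreal b"
  then show ?thesis by (cases "b = 0") (auto simp: enn_rpow_ennreal ennreal_top_mult)
qed auto

lemma enn_rpow_eq_top_iff [simp]: "enn_rpow x r = top \<longleftrightarrow> x = top"
  by (cases x) (auto simp: enn_rpow_ennreal)

lemma enn_rpow_le_iff: "0 < r \<Longrightarrow> enn_rpow x r \<le> y \<longleftrightarrow> x \<le> enn_rpow y (1 / r)"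
  using enn_rpow_mono[of "enn_rpow x r" y "1 / r"] enn_rpow_mono[of x "enn_rpow y (1 / r)" r]
  by (auto simp: enn_rpow_rpow)

text \<open>The tangent inequality at b for the convex function t powr P, obtained from Young's
  inequality with exponents P and P / (P - 1).\<close>

lemma powr_Young:
  fixes f b P :: real
  assumes P: "1 \<le> P" and f: "0 \<le> f" and b: "0 < b"
  shows "P * b powr (P - 1) * f \<le> f powr P + (P - 1) * b powr P"
proof (cases "P = 1")
  case False
  then have P1: "1 < P" using P by simp
  define Q where "Q = P / (P - 1)"
  have Q: "1 < Q" "1 / P + 1 / Q = 1" using P1 by (auto simp: Q_def field_simps)
  have "f * b powr (P - 1) \<le> f powr P / P + (b powr (P - 1)) powr Q / Q"
    by (rule Youngs_inequality) (use P1 Q f in auto)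
  also have "(b powr (P - 1)) powr Q = b powr P" using P1 by (simp add: powr_powr Q_def)
  also have "b powr P / Q = (P - 1) * b powr P / P" by (simp add: Q_def)
  finally have "P * (f * b powr (P - 1)) \<le> P * (f powr P / P + (P - 1) * b powr P / P)"
    using P1 by (intro mult_left_mono) auto
  then show ?thesis using P1 by (simp add: distrib_left mult_ac)
qed (use f b in auto)

text \<open>Jensen's inequality for f / g under the measure with density g. Integrating the tangent
  inequality at an arbitrary point b and choosing b afterwards also covers infinite values.\<close>

lemma weighted_Jensen:
  fixes f :: "'y \<Rightarrow> ennreal" and g :: "'y \<Rightarrow> real"
  assumes P: "1 \<le> P" and [measurable]: "f \<in> borel_measurable M" "g \<in> borel_measurable M"
    and g: "\<And>Y. 0 < g Y" and S: "0 < S" "(\<integral>\<^sup>+Y. ennreal (g Y) \<partial>M) \<le> ennreal S"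
  shows "enn_rpow (\<integral>\<^sup>+Y. f Y \<partial>M) P \<le> ennreal (S powr (P - 1)) * (\<integral>\<^sup>+Y. ennreal (g Y powr (1 - P)) * enn_rpow (f Y) P \<partial>M)"
proof -
  define U where "U = (\<integral>\<^sup>+Y. f Y \<partial>M)"
  define R where "R = (\<integral>\<^sup>+Y. ennreal (g Y powr (1 - P)) * enn_rpow (f Y) P \<partial>M)"
  have young: "ennreal (P * b powr (P - 1)) * U \<le> R + ennreal ((P - 1) * b powr P * S)" if b: "0 < b" for b
  proof -
    have pw: "ennreal (P * b powr (P - 1)) * f Y \<le> ennreal (g Y powr (1 - P)) * enn_rpow (f Y) P + ennreal ((P - 1) * b powr P) * ennreal (g Y)" for Y
    proof (cases "f Y")
      case (real x)
      have gp: "g Y * (x / g Y) powr P = g Y powr (1 - P) * x powr P"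
        using g[of Y] real(1) by (simp add: powr_divide powr_diff)
      have "g Y * (P * b powr (P - 1) * (x / g Y)) \<le> g Y * ((x / g Y) powr P + (P - 1) * b powr P)"
        using g[of Y] real(1) b P by (intro mult_left_mono powr_Young) auto
      then have "P * b powr (P - 1) * x \<le> g Y powr (1 - P) * x powr P + (P - 1) * b powr P * g Y"
        using g[of Y] gp by (simp add: distrib_left mult_ac)
      then have "ennreal (P * b powr (P - 1) * x) \<le> ennreal (g Y powr (1 - P) * x powr P + (P - 1) * b powr P * g Y)"
        by (rule ennreal_leI)
      also have "\<dots> = ennreal (g Y powr (1 - P)) * ennreal (x powr P) + ennreal ((P - 1) * b powr P) * ennreal (g Y)"
        using g[of Y] P by (simp add: ennreal_plus ennreal_mult)
      finally show ?thesis using real P by (simp add: enn_rpow_ennreal ennreal_mult)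
    next
      case top
      then show ?thesis using g[of Y] by (simp add: ennreal_mult_top)
    qed
    have "ennreal (P * b powr (P - 1)) * U = (\<integral>\<^sup>+Y. ennreal (P * b powr (P - 1)) * f Y \<partial>M)"
      unfolding U_def by (rule nn_integral_cmult[symmetric]) measurable
    also have "\<dots> \<le> (\<integral>\<^sup>+Y. ennreal (g Y powr (1 - P)) * enn_rpow (f Y) P + ennreal ((P - 1) * b powr P) * ennreal (g Y) \<partial>M)"
      by (intro nn_integral_mono pw)
    also have "\<dots> = R + ennreal ((P - 1) * b powr P) * (\<integral>\<^sup>+Y. ennreal (g Y) \<partial>M)"
      unfolding R_def by (subst nn_integral_add) (auto simp: nn_integral_cmult)
    also have "\<dots> \<le> R + ennreal ((P - 1) * b powr P) * ennreal S"
      by (intro add_left_mono mult_left_mono S) auto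
    finally show ?thesis using P S(1) by (simp add: ennreal_mult)
  qed
  have "enn_rpow U P \<le> ennreal (S powr (P - 1)) * R"
  proof (cases U)
    case top
    have "ennreal (P * 1 powr (P - 1)) * U = top" using P top by (simp add: ennreal_mult_top)
    then have "R = top" using young[of 1] by (simp add: top_unique)
    then show ?thesis using S(1) by (simp add: ennreal_mult_top)
  next
    case (real u)
    show ?thesis
    proof (cases "u = 0")
      case True
      then show ?thesis using real by simp
    next
      case False
      then have u: "0 < u" using real by simp
      show ?thesis
      proof (cases R)
        case top
        then show ?thesis using S(1) by (simp add: ennreal_mult_top)
      next
        case (real \<rho>)
        \<comment> \<open>With equality in the bound S, this is the g-weighted mean of f / g, the
          optimal point of tangency.\<close>
        define b where "b = u / S"
        have b: "0 < b" using u S(1) by (simp add: b_def)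
        have bS: "b powr P * S = b powr (P - 1) * u"
          using b S(1) u by (simp add: powr_diff b_def)
        have "ennreal (P * b powr (P - 1) * u) \<le> ennreal (\<rho> + (P - 1) * b powr P * S)"
          using young[OF b] real \<open>U = ennreal u\<close> u P S(1) by (simp add: ennreal_mult[symmetric] ennreal_plus[symmetric] del: ennreal_plus)
        then have "P * b powr (P - 1) * u \<le> \<rho> + (P - 1) * (b powr P * S)"
          using real(1) P S(1) by (subst (asm) ennreal_le_iff) (auto simp: mult.assoc)
        then have "b powr (P - 1) * u \<le> \<rho>" unfolding bS by (simp add: algebra_simps)
        then have "S powr (P - 1) * (b powr (P - 1) * u) \<le> S powr (P - 1) * \<rho>" by (intro mult_left_mono) auto
        also have "S powr (P - 1) * (b powr (P - 1) * u) = u powr P"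
          using u S(1) by (simp add: b_def powr_divide powr_diff)
        finally have "ennreal (u powr P) \<le> ennreal (S powr (P - 1) * \<rho>)" by (rule ennreal_leI)
        then show ?thesis using real \<open>U = ennreal u\<close> u by (simp add: enn_rpow_ennreal ennreal_mult)
      qed
    qed
  qed
  then show ?thesis unfolding U_def R_def .
qed

text \<open>The function \<open>h\<close> only serves to make the weight \<open>g\<close> in \<open>weighted_Jensen\<close> strictly positive.\<close>

lemma Minkowski_nn_integral:
  fixes f :: "'y \<Rightarrow> 'a \<Rightarrow> ennreal" and h :: "'y \<Rightarrow> real"
  assumes sf: "sigma_finite_measure M" "sigma_finite_measure N"
    and P: "1 \<le> P" and [measurable]: "(\<lambda>(Y, a). f Y a) \<in> borel_measurable (M \<Otimes>\<^sub>M N)" "h \<in> borel_measurable M"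
    and h: "\<And>Y. 0 < h Y" "(\<integral>\<^sup>+Y. ennreal (h Y) \<partial>M) < \<infinity>"
  shows "enn_rpow (\<integral>\<^sup>+a. enn_rpow (\<integral>\<^sup>+Y. f Y a \<partial>M) P \<partial>N) (1 / P) \<le> (\<integral>\<^sup>+Y. enn_rpow (\<integral>\<^sup>+a. enn_rpow (f Y a) P \<partial>N) (1 / P) \<partial>M)"
    (is "?L \<le> ?A")
proof (cases "?A = top")
  case False
  interpret M: sigma_finite_measure M by fact
  interpret N: sigma_finite_measure N by fact
  interpret MN: pair_sigma_finite M N ..
  let ?n = "\<lambda>Y. enn_rpow (\<integral>\<^sup>+a. enn_rpow (f Y a) P \<partial>N) (1 / P)"
  have nm[measurable]: "?n \<in> borel_measurable M" by measurable
  have fin: "AE Y in M. ?n Y \<noteq> \<infinity>"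
    using False by (intro nn_integral_PInf_AE nm) simp
  obtain A where A: "?A = ennreal A" "0 \<le> A" using False by (cases ?A) auto
  define H where "H = enn2real (\<integral>\<^sup>+Y. ennreal (h Y) \<partial>M)"
  have H: "(\<integral>\<^sup>+Y. ennreal (h Y) \<partial>M) = ennreal H" "0 \<le> H" using h(2) by (auto simp: H_def)
  have main: "?L \<le> ennreal (A + \<delta> * (H + 1))" if \<delta>: "0 < \<delta>" for \<delta>
  proof -
    \<comment> \<open>The norm of the slice is the weight that makes \<open>weighted_Jensen\<close>
      sharp; the perturbation disappears as \<delta> tends to 0.\<close>
    define g where "g Y = enn2real (?n Y) + \<delta> * h Y" for Y
    have [measurable]: "g \<in> borel_measurable M" unfolding g_def by measurable
    have g: "0 < g Y" for Y using \<delta> h(1)[of Y] by (simp add: g_def add_nonneg_pos)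
    define S where "S = A + \<delta> * (H + 1)"
    have S: "0 < S" using A(2) H(2) \<delta> by (simp add: S_def add_nonneg_pos)
    have gint: "(\<integral>\<^sup>+Y. ennreal (g Y) \<partial>M) \<le> ennreal S"
    proof -
      have "(\<integral>\<^sup>+Y. ennreal (g Y) \<partial>M) \<le> (\<integral>\<^sup>+Y. ?n Y + ennreal \<delta> * ennreal (h Y) \<partial>M)"
      proof (intro nn_integral_mono)
        fix Y
        have "ennreal (g Y) = ennreal (enn2real (?n Y)) + ennreal \<delta> * ennreal (h Y)"
          unfolding g_def using \<delta> h(1)[of Y] by (simp add: ennreal_plus ennreal_mult)
        also have "\<dots> \<le> ?n Y + ennreal \<delta> * ennreal (h Y)"
          by (intro add_right_mono) (simp add: ennreal_enn2real_if)
        finally show "ennreal (g Y) \<le> ?n Y + ennreal \<delta> * ennreal (h Y)" .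
      qed
      also have "\<dots> = ?A + ennreal \<delta> * (\<integral>\<^sup>+Y. ennreal (h Y) \<partial>M)"
        by (subst nn_integral_add) (auto simp: nn_integral_cmult)
      also have "\<dots> = ennreal (A + \<delta> * H)"
        unfolding A H(1) using A(2) H(2) \<delta> by (simp add: ennreal_plus ennreal_mult)
      also have "\<dots> \<le> ennreal S" using \<delta> by (intro ennreal_leI) (simp add: S_def algebra_simps)
      finally show ?thesis .
    qed
    have ng: "AE Y in M. (\<integral>\<^sup>+a. enn_rpow (f Y a) P \<partial>N) \<le> ennreal (g Y powr P)"
      using fin
    proof (rule eventually_mono)
      fix Y assume "?n Y \<noteq> \<infinity>"
      then have "?n Y \<le> ennreal (g Y)"
        using \<delta> h(1)[of Y] by (cases "?n Y") (auto simp: g_def)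
      then have "(\<integral>\<^sup>+a. enn_rpow (f Y a) P \<partial>N) \<le> enn_rpow (ennreal (g Y)) P"
        using P enn_rpow_mono[of "?n Y" "ennreal (g Y)" P] by (simp add: enn_rpow_rpow)
      then show "(\<integral>\<^sup>+a. enn_rpow (f Y a) P \<partial>N) \<le> ennreal (g Y powr P)"
        using g[of Y] by (simp add: enn_rpow_ennreal)
    qed
    have "(\<integral>\<^sup>+a. enn_rpow (\<integral>\<^sup>+Y. f Y a \<partial>M) P \<partial>N)
        \<le> (\<integral>\<^sup>+a. ennreal (S powr (P - 1)) * (\<integral>\<^sup>+Y. ennreal (g Y powr (1 - P)) * enn_rpow (f Y a) P \<partial>M) \<partial>N)"
      using g by (intro nn_integral_mono weighted_Jensen P S gint) auto
    also have "\<dots> = ennreal (S powr (P - 1)) * (\<integral>\<^sup>+a. (\<integral>\<^sup>+Y. ennreal (g Y powr (1 - P)) * enn_rpow (f Y a) P \<partial>M) \<partial>N)"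
      by (rule nn_integral_cmult) measurable
    also have "(\<integral>\<^sup>+a. (\<integral>\<^sup>+Y. ennreal (g Y powr (1 - P)) * enn_rpow (f Y a) P \<partial>M) \<partial>N)
        = (\<integral>\<^sup>+Y. (\<integral>\<^sup>+a. ennreal (g Y powr (1 - P)) * enn_rpow (f Y a) P \<partial>N) \<partial>M)"
      by (rule MN.Fubini') measurable
    also have "\<dots> = (\<integral>\<^sup>+Y. ennreal (g Y powr (1 - P)) * (\<integral>\<^sup>+a. enn_rpow (f Y a) P \<partial>N) \<partial>M)"
      by (intro nn_integral_cong nn_integral_cmult) measurable
    \<comment> \<open>Each slice contributes at most g^(1-P) * g^P = g, and this is why the weight
      was chosen as the slice norm.\<close>
    also have "\<dots> \<le> (\<integral>\<^sup>+Y. ennreal (g Y) \<partial>M)"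
    proof (intro nn_integral_mono_AE)
      show "AE Y in M. ennreal (g Y powr (1 - P)) * (\<integral>\<^sup>+a. enn_rpow (f Y a) P \<partial>N) \<le> ennreal (g Y)"
        using ng
      proof (rule eventually_mono)
        fix Y assume "(\<integral>\<^sup>+a. enn_rpow (f Y a) P \<partial>N) \<le> ennreal (g Y powr P)"
        then have "ennreal (g Y powr (1 - P)) * (\<integral>\<^sup>+a. enn_rpow (f Y a) P \<partial>N) \<le> ennreal (g Y powr (1 - P)) * ennreal (g Y powr P)"
          by (intro mult_left_mono) auto
        also have "\<dots> = ennreal (g Y)"
          using g[of Y] by (simp add: ennreal_mult[symmetric] powr_add[symmetric])
        finally show "ennreal (g Y powr (1 - P)) * (\<integral>\<^sup>+a. enn_rpow (f Y a) P \<partial>N) \<le> ennreal (g Y)" .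
      qed
    qed
    also have "\<dots> \<le> ennreal S" by (rule gint)
    finally have "(\<integral>\<^sup>+a. enn_rpow (\<integral>\<^sup>+Y. f Y a \<partial>M) P \<partial>N) \<le> ennreal (S powr (P - 1)) * ennreal S"
      by (simp add: mult_left_mono)
    also have "\<dots> = enn_rpow (ennreal S) P"
      using S by (simp add: enn_rpow_ennreal ennreal_mult[symmetric] powr_diff)
    finally have "?L \<le> enn_rpow (enn_rpow (ennreal S) P) (1 / P)"
      using P by (intro enn_rpow_mono) auto
    then show ?thesis using P by (simp add: enn_rpow_rpow S_def)
  qed
  have "?L \<le> ennreal A"
  proof (rule ennreal_le_epsilon)
    fix e :: real assume e: "0 < e"
    have "?L \<le> ennreal (A + e / (H + 1) * (H + 1))" using e H(2) by (intro main) (simp add: add_nonneg_pos)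
    also have "\<dots> = ennreal A + ennreal e" using e A(2) H(2) by (simp add: ennreal_plus)
    finally show "?L \<le> ennreal A + ennreal e" .
  qed
  then show ?thesis using A by simp
qed simp

lemma Lp_qnorm_finite:
  assumes "p \<noteq> \<infinity>" shows "Lp_qnorm p F = enn_rpow (\<integral>\<^sup>+x. enn_rpow (F x) (enn2real p) \<partial>lborel) (1 / enn2real p)"
  using assms by (simp add: Lp_qnorm_def)

text \<open>The r-th power of an L^p quasi-norm is the L^(p/r) norm of the r-th power, and p/r \<ge>
  1; so Minkowski's integral inequality applies to r-th powers even when p < 1.\<close>

lemma Lp_Minkowski:
  fixes V :: "real^'n::finite \<Rightarrow> ennreal" and F :: "'y::euclidean_space \<Rightarrow> real^'n \<Rightarrow> ennreal" and k :: "'y \<Rightarrow> real"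
  assumes r: "0 < r" "ennreal r \<le> p" and [measurable]: "V \<in> borel_measurable borel"
    "(\<lambda>(Y, a). F Y a) \<in> borel_measurable (lborel \<Otimes>\<^sub>M lborel)" "k \<in> borel_measurable borel" 
    and N[measurable]: "(\<lambda>Y. Lp_qnorm p (F Y)) \<in> borel_measurable borel"
    and k: "\<And>Y. 0 < k Y" "(\<integral>\<^sup>+Y. ennreal (k Y) \<partial>lborel) < \<infinity>"
    and V: "AE a in lborel. enn_rpow (V a) r \<le> (\<integral>\<^sup>+Y. ennreal (k Y) * enn_rpow (F Y a) r \<partial>lborel)"
  shows "enn_rpow (Lp_qnorm p V) r \<le> (\<integral>\<^sup>+Y. ennreal (k Y) * enn_rpow (Lp_qnorm p (F Y)) r \<partial>lborel)"
proof (cases "p = \<infinity>")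
  case True
  have "\<forall>Y. AE a in lborel. F Y a \<le> Lp_qnorm p (F Y)"
    unfolding True Lp_qnorm_inf using esssup_AE by blast
  \<comment> \<open>Each Y has its own null set of points a; Fubini for null sets replaces this by a
    null set of Y for almost every a, as needed under the integral over Y.\<close>
  then have "AE Y in lborel. AE a in lborel. F Y a \<le> Lp_qnorm p (F Y)" by simp
  then have "AE a in lborel. AE Y in lborel. F Y a \<le> Lp_qnorm p (F Y)"
    by (subst (asm) lborel_pair.AE_commute) measurable
  with V have "AE a in lborel. V a \<le> enn_rpow (\<integral>\<^sup>+Y. ennreal (k Y) * enn_rpow (Lp_qnorm p (F Y)) r \<partial>lborel) (1 / r)"
  proof eventually_elim
    case (elim a)
    have "enn_rpow (V a) r \<le> (\<integral>\<^sup>+Y. ennreal (k Y) * enn_rpow (F Y a) r \<partial>lborel)" by (rule elim)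
    also have "\<dots> \<le> (\<integral>\<^sup>+Y. ennreal (k Y) * enn_rpow (Lp_qnorm p (F Y)) r \<partial>lborel)"
      using elim(2) r(1) by (intro nn_integral_mono_AE) (auto elim!: eventually_mono intro!: mult_left_mono enn_rpow_mono)
    finally show ?case using r(1) by (simp add: enn_rpow_le_iff)
  qed
  then have "Lp_qnorm p V \<le> enn_rpow (\<integral>\<^sup>+Y. ennreal (k Y) * enn_rpow (Lp_qnorm p (F Y)) r \<partial>lborel) (1 / r)"
    unfolding True Lp_qnorm_inf[of V] by (intro esssup_I) measurable
  then show ?thesis using r(1) by (simp add: enn_rpow_le_iff)
next
  case False
  define p' where "p' = enn2real p"
  have pp: "p = ennreal p'" using False by (simp add: p'_def less_top)
  have rp: "r \<le> p'" using r(2) unfolding pp by (simp add: ennreal_le_iff2) (use r(1) in linarith)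
  define P where "P = p' / r"
  have P: "1 \<le> P" using rp r(1) by (simp add: P_def)
  have p'0: "0 < p'" using rp r(1) by simp
  let ?f = "\<lambda>Y a. ennreal (k Y) * enn_rpow (F Y a) r"
  have e1: "enn_rpow (enn_rpow (V a) r) P = enn_rpow (V a) p'" for a
    using r(1) by (simp add: enn_rpow_rpow P_def)
  have "enn_rpow (Lp_qnorm p V) r = enn_rpow (\<integral>\<^sup>+a. enn_rpow (V a) p' \<partial>lborel) (1 / P)"
    unfolding Lp_qnorm_finite[OF False] p'_def[symmetric] using p'0 by (simp add: enn_rpow_rpow P_def)
  also have "\<dots> \<le> enn_rpow (\<integral>\<^sup>+a. enn_rpow (\<integral>\<^sup>+Y. ?f Y a \<partial>lborel) P \<partial>lborel) (1 / P)"
    using V P by (intro enn_rpow_mono nn_integral_mono_AE) (auto simp: e1[symmetric] elim!: eventually_mono intro!: enn_rpow_mono)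
  also have "\<dots> \<le> (\<integral>\<^sup>+Y. enn_rpow (\<integral>\<^sup>+a. enn_rpow (?f Y a) P \<partial>lborel) (1 / P) \<partial>lborel)"
    by (rule Minkowski_nn_integral[where h=k, OF _ _ P _ _ k]) (auto intro: sigma_finite_lborel)
  also have "\<dots> = (\<integral>\<^sup>+Y. ennreal (k Y) * enn_rpow (Lp_qnorm p (F Y)) r \<partial>lborel)"
  proof (rule nn_integral_cong)
    fix Y
    have [measurable]: "F Y \<in> borel_measurable borel"
      using measurable_Pair2[of "\<lambda>(Y, a). F Y a" lborel lborel borel Y] by simp
    have "(\<integral>\<^sup>+a. enn_rpow (?f Y a) P \<partial>lborel) = (\<integral>\<^sup>+a. enn_rpow (ennreal (k Y)) P * enn_rpow (F Y a) p' \<partial>lborel)"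
      using P r(1) by (simp add: enn_rpow_mult enn_rpow_rpow P_def)
    also have "\<dots> = enn_rpow (ennreal (k Y)) P * (\<integral>\<^sup>+a. enn_rpow (F Y a) p' \<partial>lborel)"
      by (rule nn_integral_cmult) measurable
    finally have "enn_rpow (\<integral>\<^sup>+a. enn_rpow (?f Y a) P \<partial>lborel) (1 / P)
        = ennreal (k Y) * enn_rpow (\<integral>\<^sup>+a. enn_rpow (F Y a) p' \<partial>lborel) (1 / P)"
      using P by (simp add: enn_rpow_mult enn_rpow_rpow)
    also have "enn_rpow (\<integral>\<^sup>+a. enn_rpow (F Y a) p' \<partial>lborel) (1 / P) = enn_rpow (Lp_qnorm p (F Y)) r"
      unfolding Lp_qnorm_finite[OF False] p'_def[symmetric] using p'0 by (simp add: enn_rpow_rpow P_def)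
    finally show "enn_rpow (\<integral>\<^sup>+a. enn_rpow (?f Y a) P \<partial>lborel) (1 / P) = ennreal (k Y) * enn_rpow (Lp_qnorm p (F Y)) r" .
  qed
  finally show ?thesis .
qed

section \<open>Translations and slices in mixed norms\<close>

lemma AE_lborel_translate:
  fixes P :: "'a::euclidean_space \<Rightarrow> bool"
  assumes "AE x in lborel. P x"
  shows "AE x in lborel. P (b + x)"
proof -
  obtain N where N: "N \<in> null_sets lborel" "\<And>x. x \<notin> N \<Longrightarrow> P x"
    using assms by (auto elim!: AE_E3)
  have [measurable]: "N \<in> sets borel" using N(1) by auto
  have "AE x in lborel. x \<notin> N" using N(1) by (rule AE_not_in)
  then have "AE x in distr lborel borel ((+) b). x \<notin> N" unfolding lborel_distr_plus .
  then have "AE x in lborel. b + x \<notin> N" by (subst (asm) AE_distr_iff) auto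
  then show ?thesis by (rule eventually_mono) (use N in auto)
qed

lemma continuous_le_esssup:
  fixes u :: "'a::euclidean_space \<Rightarrow> real"
  assumes u: "continuous_on UNIV u" "\<And>x. 0 \<le> u x"
  shows "ennreal (u x) \<le> esssup lborel (\<lambda>x. ennreal (u x))"
proof (cases "esssup lborel (\<lambda>x. ennreal (u x))")
  case (real c)
  have "AE x in lborel. ennreal (u x) \<le> ennreal c"
    using esssup_AE[of "\<lambda>x. ennreal (u x)" lborel] real(2) by simp
  then have "AE x in lborel. u x \<le> c" using real(1) by simp
  then have "u x \<le> c" using AE_le_continuous[OF u(1), of "\<lambda>_. c" x] by simp
  then show ?thesis using real by (simp add: ennreal_leI)
qed simp

lemma Lp_qnorm_translate:
  fixes F :: "real^'n::finite \<Rightarrow> ennreal"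
  assumes [measurable]: "F \<in> borel_measurable borel"
  shows "Lp_qnorm p (\<lambda>a. F (b + a)) = Lp_qnorm p F"
proof (cases "p = \<infinity>")
  case True
  have le: "esssup lborel (\<lambda>a. G (c + a)) \<le> esssup lborel G" if [measurable]: "G \<in> borel_measurable borel" for G :: "real^'n \<Rightarrow> ennreal" and c
    by (intro esssup_I AE_lborel_translate[OF esssup_AE]) measurable
  have "(\<lambda>a. F (b + a)) \<in> borel_measurable borel" by measurable
  from le[OF this, of "- b"] le[OF assms, of b] show ?thesis
    unfolding True Lp_qnorm_inf by (intro antisym) auto
next
  case False
  then show ?thesis
    by (simp add: Lp_qnorm_finite lborel_nn_integral_translate[of "\<lambda>x. enn_rpow (F x) (enn2real p)"])
qed

text \<open>For infinite q, continuity turns the essential supremum into a supremum over a countable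
  dense set, which is measurable in the remaining variable.\<close>

lemma borel_measurable_Lp_slice:
  fixes w :: "(real^'n::finite) \<times> (real^'n) \<Rightarrow> real"
  assumes w: "continuous_on UNIV w" "\<And>X. 0 \<le> w X"
  shows "(\<lambda>x. Lp_qnorm q (\<lambda>\<xi>. ennreal (w (x, \<xi>)))) \<in> borel_measurable borel"
proof (cases "q = \<infinity>")
  case True
  obtain D :: "(real^'n) set" where D: "countable D" "\<And>X. open X \<Longrightarrow> X \<noteq> {} \<Longrightarrow> \<exists>d\<in>D. d \<in> X"
    using countable_dense_exists[where 'a="real^'n"] by metis
  have c2: "continuous_on UNIV (\<lambda>\<xi>. w (x, \<xi>))" for x
    by (intro continuous_on_compose2[OF w(1)] continuous_intros) auto
  have "esssup lborel (\<lambda>\<xi>. ennreal (w (x, \<xi>))) = (SUP d\<in>D. ennreal (w (x, d)))" for x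
  proof (rule antisym)
    show "(SUP d\<in>D. ennreal (w (x, d))) \<le> esssup lborel (\<lambda>\<xi>. ennreal (w (x, \<xi>)))"
      by (intro SUP_least continuous_le_esssup c2 w)
    have m: "(\<lambda>\<xi>. ennreal (w (x, \<xi>))) \<in> borel_measurable lborel"
      using borel_measurable_continuous_onI[OF c2] by simp
    have "ennreal (w (x, \<xi>)) \<le> (SUP d\<in>D. ennreal (w (x, d)))" for \<xi>
    proof (rule ccontr)
      assume n: "\<not> ?thesis"
      have op: "open {\<xi>. (SUP d\<in>D. ennreal (w (x, d))) < ennreal (w (x, \<xi>))}"
        by (intro open_Collect_less continuous_on_ennreal c2 continuous_on_const)
      then obtain d where "d \<in> D" "(SUP d\<in>D. ennreal (w (x, d))) < ennreal (w (x, d))"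
        using D(2)[OF op] n by (auto simp: not_le)
      then show False using SUP_upper[of d D "\<lambda>d. ennreal (w (x, d))"] by simp
    qed
    then show "esssup lborel (\<lambda>\<xi>. ennreal (w (x, \<xi>))) \<le> (SUP d\<in>D. ennreal (w (x, d)))"
      by (intro esssup_I m) auto
  qed
  moreover have "continuous_on UNIV (\<lambda>x. w (x, d))" for d
    by (intro continuous_on_compose2[OF w(1)] continuous_intros) auto
  then have "(\<lambda>x. w (x, d)) \<in> borel_measurable borel" for d
    by (rule borel_measurable_continuous_onI)
  then have "(\<lambda>x. SUP d\<in>D. ennreal (w (x, d))) \<in> borel_measurable borel"
    by (intro borel_measurable_SUP D(1)) simp
  ultimately show ?thesis unfolding True Lp_qnorm_inf by simp
next
  case False
  have [measurable]: "w \<in> borel_measurable (lborel \<Otimes>\<^sub>M lborel)"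
    using borel_measurable_continuous_onI[OF w(1)] by (simp add: lborel_prod)
  have "(\<lambda>x. \<integral>\<^sup>+\<xi>. enn_rpow (ennreal (w (x, \<xi>))) (enn2real q) \<partial>lborel) \<in> borel_measurable lborel"
    by measurable
  then show ?thesis unfolding Lp_qnorm_finite[OF False] by measurable
qed

text \<open>\<open>Lp_Minkowski\<close> is applied twice: in \<xi>, where the translation by
  \<open>snd Y\<close> does not change the norm, and then in x, where the one by
  \<open>fst Y\<close> disappears likewise. Afterwards only the weight depends on Y and integrates
  to a constant.\<close>

lemma mixed_norm_bound:
  fixes v w :: "(real^'n::finite) \<times> (real^'n) \<Rightarrow> real"
  assumes r: "0 < r" "ennreal r \<le> p" "ennreal r \<le> q" and \<sigma>: "real CARD('n) < \<sigma>" and K: "0 < K"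
    and v: "continuous_on UNIV v" "\<And>X. 0 \<le> v X"
    and w: "continuous_on UNIV w" "\<And>X. 0 \<le> w X" "\<And>X. w X \<le> W"
    and vw: "\<And>X. v X powr r \<le> K * (LBINT Y. omega \<sigma> Y * w (X + Y) powr r)"
  shows "Lp_qnorm p (\<lambda>x. Lp_qnorm q (\<lambda>\<xi>. ennreal (v (x, \<xi>))))
    \<le> ennreal ((K * (LBINT Y. omega \<sigma> (Y :: (real^'n) \<times> (real^'n)))) powr (1 / r)) * Lp_qnorm p (\<lambda>x. Lp_qnorm q (\<lambda>\<xi>. ennreal (w (x, \<xi>))))"
proof -
  let ?k = "\<lambda>Y::(real^'n) \<times> (real^'n). K * omega \<sigma> Y"
  let ?Nv = "\<lambda>x. Lp_qnorm q (\<lambda>\<xi>. ennreal (v (x, \<xi>)))" and ?Nw = "\<lambda>x. Lp_qnorm q (\<lambda>\<xi>. ennreal (w (x, \<xi>)))"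
  have mv[measurable]: "v \<in> borel_measurable borel" and mw[measurable]: "w \<in> borel_measurable borel"
    using v(1) w(1) by (auto intro: borel_measurable_continuous_onI)
  have mNv[measurable]: "?Nv \<in> borel_measurable borel" by (rule borel_measurable_Lp_slice[OF v])
  have mNw[measurable]: "?Nw \<in> borel_measurable borel" by (rule borel_measurable_Lp_slice[OF w(1,2)])
  have W0: "0 \<le> W" using w(2,3) order_trans by blast
  have kpos: "0 < ?k Y" for Y using K by simp
  have ki: "(\<integral>\<^sup>+Y. ennreal (?k Y) \<partial>lborel) = ennreal (K * (LBINT Y. omega \<sigma> (Y :: (real^'n) \<times> (real^'n))))"
    using K integrable_omega[OF \<sigma>] by (subst nn_integral_eq_integral) auto
  then have kfin: "(\<integral>\<^sup>+Y. ennreal (?k Y) \<partial>lborel) < \<infinity>" by simp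
  have km: "?k \<in> borel_measurable borel" by measurable
  have vw': "enn_rpow (ennreal (v X)) r \<le> (\<integral>\<^sup>+Y. ennreal (?k Y) * enn_rpow (ennreal (w (X + Y))) r \<partial>lborel)" for X
  proof -
    have int: "integrable lborel (\<lambda>Y. ?k Y * w (X + Y) powr r)"
      by (rule integrable_dominated[OF integrable_mult_left[OF integrable_mult_right[OF integrable_omega[OF \<sigma>], of K], of "W powr r"]])
        (use K r(1) in \<open>simp_all add: abs_mult mult_left_mono powr_mono2 w\<close>)
    have "enn_rpow (ennreal (v X)) r = ennreal (v X powr r)" using v(2) by (rule enn_rpow_ennreal)
    also have "\<dots> \<le> ennreal (LBINT Y. ?k Y * w (X + Y) powr r)"
      using vw[of X] by (intro ennreal_leI) (simp add: mult.assoc)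
    also have "\<dots> = (\<integral>\<^sup>+Y. ennreal (?k Y * w (X + Y) powr r) \<partial>lborel)"
      using K by (intro nn_integral_eq_integral[symmetric] int) auto
    also have "\<dots> = (\<integral>\<^sup>+Y. ennreal (?k Y) * enn_rpow (ennreal (w (X + Y))) r \<partial>lborel)"
      using K w(2) by (intro nn_integral_cong) (simp only: enn_rpow_ennreal ennreal_mult less_imp_le[OF kpos] powr_ge_zero)
    finally show ?thesis .
  qed
  have tr: "Lp_qnorm q (\<lambda>\<xi>. ennreal (w ((x, \<xi>) + Y))) = ?Nw (x + fst Y)" for x Y
    using Lp_qnorm_translate[of "\<lambda>\<xi>. ennreal (w (x + fst Y, \<xi>))" q "snd Y"]
    by (simp add: plus_prod_def add.commute measurable_compose[OF borel_measurable_Pair])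
  have inner: "enn_rpow (?Nv x) r \<le> (\<integral>\<^sup>+Y. ennreal (?k Y) * enn_rpow (?Nw (fst Y + x)) r \<partial>lborel)" for x
  proof -
    have "enn_rpow (?Nv x) r \<le> (\<integral>\<^sup>+Y. ennreal (?k Y) * enn_rpow (Lp_qnorm q (\<lambda>\<xi>. ennreal (w ((x, \<xi>) + Y)))) r \<partial>lborel)"
    proof (rule Lp_Minkowski[OF r(1,3) _ _ km _ kpos kfin])
      show "(\<lambda>\<xi>. ennreal (v (x, \<xi>))) \<in> borel_measurable borel" by measurable
      have "(\<lambda>p. w ((x, snd p) + fst p)) \<in> borel_measurable borel"
        by (intro borel_measurable_continuous_onI continuous_on_compose2[OF w(1)] continuous_intros) auto
      then show "(\<lambda>(Y, \<xi>). ennreal (w ((x, \<xi>) + Y))) \<in> borel_measurable (lborel \<Otimes>\<^sub>M lborel)"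
        unfolding lborel_prod case_prod_beta' by measurable
      show "(\<lambda>Y. Lp_qnorm q (\<lambda>\<xi>. ennreal (w ((x, \<xi>) + Y)))) \<in> borel_measurable borel"
        unfolding tr
      proof (rule measurable_compose[OF _ mNw])
        show "(\<lambda>Y. x + fst Y) \<in> borel_measurable (borel :: ((real^'n) \<times> (real^'n)) measure)"
          by (intro borel_measurable_continuous_onI continuous_intros)
      qed
      show "AE \<xi> in lborel. enn_rpow (ennreal (v (x, \<xi>))) r \<le> (\<integral>\<^sup>+Y. ennreal (?k Y) * enn_rpow (ennreal (w ((x, \<xi>) + Y))) r \<partial>lborel)"
        by (intro always_eventually allI vw')
    qed
    then show ?thesis unfolding tr by (simp add: add.commute)
  qed
  have tr2: "Lp_qnorm p (\<lambda>x. ?Nw (b + x)) = Lp_qnorm p ?Nw" for b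
    by (rule Lp_qnorm_translate[OF mNw])
  have "enn_rpow (Lp_qnorm p ?Nv) r \<le> (\<integral>\<^sup>+Y. ennreal (?k Y) * enn_rpow (Lp_qnorm p (\<lambda>x. ?Nw (fst Y + x))) r \<partial>lborel)"
  proof (rule Lp_Minkowski[OF r(1,2) mNv _ km _ kpos kfin])
    show "(\<lambda>(Y, x). ?Nw (fst Y + x)) \<in> borel_measurable (lborel \<Otimes>\<^sub>M lborel)"
      unfolding case_prod_beta' lborel_prod
      by (rule measurable_compose[where f="\<lambda>p. fst (fst p) + snd p" and N=borel, OF _ mNw])
        (simp, intro borel_measurable_continuous_onI continuous_intros)
    show "(\<lambda>Y. Lp_qnorm p (\<lambda>x. ?Nw (fst Y + x))) \<in> borel_measurable borel" unfolding tr2 by simp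
  qed (intro always_eventually allI inner)
  also have "\<dots> = ennreal (K * (LBINT Y. omega \<sigma> (Y :: (real^'n) \<times> (real^'n)))) * enn_rpow (Lp_qnorm p ?Nw) r"
    unfolding tr2 ki[symmetric] by (rule nn_integral_multc) simp
  finally have "Lp_qnorm p ?Nv \<le> enn_rpow (ennreal (K * (LBINT Y. omega \<sigma> (Y :: (real^'n) \<times> (real^'n)))) * enn_rpow (Lp_qnorm p ?Nw) r) (1 / r)"
    using r(1) by (simp add: enn_rpow_le_iff)
  also have "\<dots> = ennreal ((K * (LBINT Y. omega \<sigma> (Y :: (real^'n) \<times> (real^'n)))) powr (1 / r)) * Lp_qnorm p ?Nw"
    using r(1) K by (simp add: enn_rpow_mult enn_rpow_rpow enn_rpow_ennreal integral_nonneg_AE)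
  finally show ?thesis .
qed

section \<open>Schwartz functions\<close>

text \<open>Instead of following boundary terms to infinity, the derivative is integrated over a
  unit step: the integral of G (x + e_j) - G x vanishes by translation invariance, and by Fubini it
  equals the integral of the derivative.\<close>

lemma integral_partial_eq_0:
  fixes G :: "real^'n::finite \<Rightarrow> complex"
  assumes d: "\<And>x. G differentiable (at x)" and Gi: "integrable lborel G"
    and c: "continuous_on UNIV (partial j G)" and Di: "integrable lborel (partial j G)"
  shows "(LBINT x. partial j G x) = 0"
proof -
  let ?t = "axis j 1 :: real^'n" and ?D = "partial j G"
  let ?i = "\<lambda>\<tau>. indicator {0..1::real} \<tau> :: real"
  have [measurable]: "?D \<in> borel_measurable borel" using Di by auto
  have sum: "(\<Sum>i\<in>UNIV. (?t $ i) *\<^sub>R partial i G x) = ?D x" for x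
    by (simp add: axis_def if_distrib[of "\<lambda>c. c *\<^sub>R _"] cong: if_cong)
  have ftc: "G (x + ?t) - G x = (LBINT \<tau>. ?i \<tau> *\<^sub>R ?D (x + \<tau> *\<^sub>R ?t))" for x
  proof -
    have "(LBINT \<tau>. ?i \<tau> *\<^sub>R ?D (x + \<tau> *\<^sub>R ?t)) = G (x + 1 *\<^sub>R ?t) - G (x + 0 *\<^sub>R ?t)"
    proof (rule integral_FTC_Icc)
      show "((\<lambda>\<tau>. G (x + \<tau> *\<^sub>R ?t)) has_vector_derivative ?D (x + \<tau> *\<^sub>R ?t)) (at \<tau> within {0..1})" for \<tau>
        using has_vector_derivative_ray[OF d, of x ?t \<tau> "{0..1}"] unfolding sum .
      show "continuous_on {0..1} (\<lambda>\<tau>. ?D (x + \<tau> *\<^sub>R ?t))"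
        by (intro continuous_on_compose2[OF c] continuous_intros) auto
    qed simp
    then show ?thesis by simp
  qed
  have i01: "integrable lborel ?i" by simp
  have int: "integrable (lborel \<Otimes>\<^sub>M lborel) (\<lambda>(\<tau>, x). ?i \<tau> *\<^sub>R ?D (x + \<tau> *\<^sub>R ?t))"
  proof (rule lborel_pair.Fubini_integrable)
    have n: "(LBINT x. norm (?i \<tau> *\<^sub>R ?D (x + \<tau> *\<^sub>R ?t))) = ?i \<tau> * (LBINT x. norm (?D x))" for \<tau>
      by (simp add: lborel_integral_translate(2)[of "\<lambda>x. norm (?D x)"])
    show "integrable lborel (\<lambda>\<tau>. \<integral>x. norm (case (\<tau>, x) of (\<tau>, x) \<Rightarrow> ?i \<tau> *\<^sub>R ?D (x + \<tau> *\<^sub>R ?t)) \<partial>lborel)"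
      unfolding prod.case n using i01 by simp
    show "AE \<tau> in lborel. integrable lborel (\<lambda>x. case (\<tau>, x) of (\<tau>, x) \<Rightarrow> ?i \<tau> *\<^sub>R ?D (x + \<tau> *\<^sub>R ?t))"
      using Di by (auto simp: lborel_integrable_translate(2))
  qed measurable
  have "0 = (LBINT x. G (x + ?t) - G x)"
    using Gi by (simp add: lborel_integrable_translate(2) lborel_integral_translate(2))
  also have "\<dots> = (LBINT x. (LBINT \<tau>. ?i \<tau> *\<^sub>R ?D (x + \<tau> *\<^sub>R ?t)))" unfolding ftc ..
  also have "\<dots> = (LBINT \<tau>. (LBINT x. ?i \<tau> *\<^sub>R ?D (x + \<tau> *\<^sub>R ?t)))"
    using lborel_pair.Fubini_integral[OF int] by simp
  also have "\<dots> = (LBINT \<tau>. ?i \<tau> *\<^sub>R (LBINT x. ?D x))"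
    by (simp add: lborel_integral_translate(2))
  also have "\<dots> = (LBINT x. ?D x)" by simp
  finally show ?thesis ..
qed

lemma fourier_eq: "fourier f \<xi> = (LBINT x. f x * ch (- (x \<bullet> \<xi>)))"
  by (simp add: fourier_def ch_def)

lemma has_derivative_ch:
  "((\<lambda>x. ch (- (x \<bullet> \<xi>))) has_derivative (\<lambda>h. ch (- (x \<bullet> \<xi>)) * (- (2 * pi * \<i>) * of_real (h \<bullet> \<xi>)))) (at x)"
proof -
  have "((\<lambda>x. \<i> * complex_of_real (2 * pi * - (x \<bullet> \<xi>))) has_derivative (\<lambda>h. \<i> * complex_of_real (2 * pi * - (h \<bullet> \<xi>)))) (at x)"
    by (auto intro!: derivative_eq_intros)
  from has_derivative_compose[OF this DERIV_exp[unfolded has_field_derivative_def]] show ?thesis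
    by (simp add: ch_def cis_conv_exp mult_ac)
qed

text \<open>The product rule for g times the character, whose derivative has integral 0.\<close>

lemma fourier_partial:
  fixes g :: "real^'n::finite \<Rightarrow> complex"
  assumes d: "\<And>x. g differentiable (at x)" and gi: "integrable lborel g"
    and c: "continuous_on UNIV (partial j g)" and Di: "integrable lborel (partial j g)"
  shows "fourier (partial j g) \<xi> = 2 * pi * \<i> * of_real (\<xi> $ j) * fourier g \<xi>"
proof -
  let ?G = "\<lambda>x. g x * ch (- (x \<bullet> \<xi>))"
  have der: "(?G has_derivative (\<lambda>h. g x * (ch (- (x \<bullet> \<xi>)) * (- (2 * pi * \<i>) * of_real (h \<bullet> \<xi>))) + frechet_derivative g (at x) h * ch (- (x \<bullet> \<xi>)))) (at x)" for x
    by (intro has_derivative_mult has_derivative_ch) (use d frechet_derivative_works in blast)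
  have pd: "partial j ?G = (\<lambda>x. partial j g x * ch (- (x \<bullet> \<xi>)) - (2 * pi * \<i> * of_real (\<xi> $ j)) * (g x * ch (- (x \<bullet> \<xi>))))"
  proof
    fix x
    have "frechet_derivative ?G (at x) = (\<lambda>h. g x * (ch (- (x \<bullet> \<xi>)) * (- (2 * pi * \<i>) * of_real (h \<bullet> \<xi>))) + frechet_derivative g (at x) h * ch (- (x \<bullet> \<xi>)))"
      using frechet_derivative_at[OF der] by simp
    then show "partial j ?G x = partial j g x * ch (- (x \<bullet> \<xi>)) - (2 * pi * \<i> * of_real (\<xi> $ j)) * (g x * ch (- (x \<bullet> \<xi>)))"
      unfolding partial_def[of j ?G] by (simp add: inner_axis' partial_def algebra_simps)
  qed
  have cg: "continuous_on UNIV g"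
    using d by (simp add: continuous_on_eq_continuous_at differentiable_imp_continuous_within)
  have i1: "integrable lborel (\<lambda>x. partial j g x * ch (- (x \<bullet> \<xi>)))" and i2: "integrable lborel ?G"
    by (auto intro!: integrable_mult_ch Di gi)
  have "(LBINT x. partial j ?G x) = 0"
  proof (rule integral_partial_eq_0)
    show "?G differentiable (at x)" for x using der differentiable_def by blast
    show "continuous_on UNIV (partial j ?G)" unfolding pd by (intro continuous_intros c cg)
    show "integrable lborel (partial j ?G)"
      unfolding pd by (intro Bochner_Integration.integrable_diff i1 integrable_mult_right i2)
  qed (rule i2)
  then have "(LBINT x. partial j g x * ch (- (x \<bullet> \<xi>))) - (2 * pi * \<i> * of_real (\<xi> $ j)) * (LBINT x. ?G x) = 0"
    unfolding pd by (subst (asm) Bochner_Integration.integral_diff[OF i1 integrable_mult_right[OF i2]]) simp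
  then show ?thesis by (simp add: fourier_eq)
qed

lemma norm_fourier_le: "norm (fourier f \<xi>) \<le> (LBINT x. norm (f x))"
  unfolding fourier_eq by (rule order_trans[OF integral_norm_bound]) (simp add: norm_mult)

lemma schwartz_pderivs:
  fixes f :: "real^'n::finite \<Rightarrow> complex"
  assumes "schwartz f"
  shows "pderivs js f differentiable (at x)" and "continuous_on UNIV (pderivs js f)" and "integrable lborel (pderivs js f)"
proof -
  show d: "pderivs js f differentiable (at x)" for x using assms by (simp add: schwartz_def)
  then show c: "continuous_on UNIV (pderivs js f)"
    by (simp add: continuous_on_eq_continuous_at differentiable_imp_continuous_within)
  let ?k = "Suc CARD('n)"
  have "bounded (range (\<lambda>x. (1 + norm x) ^ ?k * norm (pderivs js f x)))"
    using assms unfolding schwartz_def by blast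
  then obtain B where B: "\<And>x. (1 + norm x) ^ ?k * norm (pderivs js f x) \<le> B"
    unfolding bounded_iff by (auto simp del: power_Suc)
  have "norm (pderivs js f x) \<le> B * japan x powr - real ?k" for x
  proof -
    have "japan x powr real ?k * norm (pderivs js f x) \<le> (1 + norm x) ^ ?k * norm (pderivs js f x)"
      using japan_le[of x] by (intro mult_right_mono) (simp_all only: powr_realpow[OF japan_pos] power_mono japan_nonneg norm_ge_zero)
    also note B
    finally show ?thesis by (rule le_japan_powrI)
  qed
  then have "decays (real ?k) B (pderivs js f)"
    using borel_measurable_continuous_onI[OF c] by (auto simp: decays_def)
  then show "integrable lborel (pderivs js f)" by (rule decays_integrable) simp
qed

lemma fourier_pderivs:
  fixes f :: "real^'n::finite \<Rightarrow> complex"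
  assumes f: "schwartz f"
  shows "fourier (pderivs (replicate k j) f) \<xi> = (2 * pi * \<i> * of_real (\<xi> $ j)) ^ k * fourier f \<xi>"
proof (induction k)
  case (Suc k)
  let ?js = "replicate k j"
  have "fourier (partial j (pderivs ?js f)) \<xi> = 2 * pi * \<i> * of_real (\<xi> $ j) * fourier (pderivs ?js f) \<xi>"
    using schwartz_pderivs[OF f, of "j # ?js"] by (intro fourier_partial schwartz_pderivs[OF f]) auto
  then show ?case using Suc by simp
qed simp

text \<open>Decay of order n + 1 suffices. It follows from n + 1 derivatives in one coordinate
  direction, chosen for each \<xi> as the direction of its largest component.\<close>

lemma integrable_fourier:
  fixes f :: "real^'n::finite \<Rightarrow> complex"
  assumes f: "schwartz f"
  shows "integrable lborel (fourier f)"
proof -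
  let ?n = "CARD('n)" and ?k = "Suc CARD('n)"
  have fi: "integrable lborel f" using schwartz_pderivs(3)[OF f, of "[]"] by simp
  then have [measurable]: "f \<in> borel_measurable borel" by auto
  have m: "fourier f \<in> borel_measurable borel" unfolding fourier_eq[abs_def] by measurable
  define B where "B j = (LBINT x. norm (pderivs (replicate ?k j) f x))" for j
  define B0 where "B0 = (LBINT x. norm (f x))"
  have B: "\<bar>\<xi> $ j\<bar> ^ ?k * norm (fourier f \<xi>) \<le> B j" for \<xi> j
  proof -
    have "(2 * pi * \<bar>\<xi> $ j\<bar>) ^ ?k * norm (fourier f \<xi>) = norm (fourier (pderivs (replicate ?k j) f) \<xi>)"
      unfolding fourier_pderivs[OF f] by (simp add: norm_mult norm_power)
    also have "\<dots> \<le> B j" unfolding B_def by (rule norm_fourier_le)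
    finally have "(2 * pi * \<bar>\<xi> $ j\<bar>) ^ ?k * norm (fourier f \<xi>) \<le> B j" .
    moreover have "1 * \<bar>\<xi> $ j\<bar> \<le> 2 * pi * \<bar>\<xi> $ j\<bar>" using pi_gt3 by (intro mult_right_mono) auto
    then have "\<bar>\<xi> $ j\<bar> ^ ?k * norm (fourier f \<xi>) \<le> (2 * pi * \<bar>\<xi> $ j\<bar>) ^ ?k * norm (fourier f \<xi>)"
      by (intro mult_right_mono power_mono) auto
    ultimately show ?thesis by (rule order_trans[rotated])
  qed
  have B0: "norm (fourier f \<xi>) \<le> B0" for \<xi> unfolding B0_def by (rule norm_fourier_le)
  have Bj: "0 \<le> B j" for j unfolding B_def by (intro integral_nonneg_AE) auto
  define D where "D = 2 ^ ?k * (B0 + real ?n ^ ?k * (\<Sum>j\<in>UNIV. B j))"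
  have "norm (fourier f \<xi>) \<le> D * japan \<xi> powr - real ?k" for \<xi>
  proof -
    \<comment> \<open>With the largest component, norm \<xi> is at most n times \<bar>\<xi> $
      j\<bar>, so powers of that component control the full weight.\<close>
    obtain j where j: "\<And>i. \<bar>\<xi> $ i\<bar> \<le> \<bar>\<xi> $ j\<bar>"
    proof -
      have "Max (range (\<lambda>i. \<bar>\<xi> $ i\<bar>)) \<in> range (\<lambda>i. \<bar>\<xi> $ i\<bar>)" by (rule Max_in) auto
      then obtain j where j: "Max (range (\<lambda>i. \<bar>\<xi> $ i\<bar>)) = \<bar>\<xi> $ j\<bar>" by blast
      have "\<bar>\<xi> $ i\<bar> \<le> \<bar>\<xi> $ j\<bar>" for i unfolding j[symmetric] by (rule Max_ge) auto
      then show ?thesis by (rule that)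
    qed
    have "norm \<xi> \<le> (\<Sum>i\<in>UNIV. \<bar>\<xi> $ i\<bar>)" by (rule norm_le_l1_cart)
    also have "\<dots> \<le> real ?n * \<bar>\<xi> $ j\<bar>" using sum_bounded_above[of UNIV "\<lambda>i. \<bar>\<xi> $ i\<bar>", OF j] by simp
    finally have n: "norm \<xi> \<le> real ?n * \<bar>\<xi> $ j\<bar>" .
    have "japan \<xi> ^ ?k \<le> (2 * max 1 (norm \<xi>)) ^ ?k"
      using japan_le[of \<xi>] by (intro power_mono) (auto simp: max_def)
    also have "\<dots> \<le> 2 ^ ?k * (1 + (real ?n * \<bar>\<xi> $ j\<bar>) ^ ?k)"
    proof -
      have "(max 1 (norm \<xi>)) ^ ?k \<le> 1 + norm \<xi> ^ ?k" by (auto simp: max_def)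
      also have "\<dots> \<le> 1 + (real ?n * \<bar>\<xi> $ j\<bar>) ^ ?k" by (intro add_left_mono power_mono n) auto
      finally show ?thesis unfolding power_mult_distrib[of 2] by (intro mult_left_mono) auto
    qed
    finally have "japan \<xi> ^ ?k * norm (fourier f \<xi>) \<le> 2 ^ ?k * (1 + (real ?n * \<bar>\<xi> $ j\<bar>) ^ ?k) * norm (fourier f \<xi>)"
      by (intro mult_right_mono) auto
    also have "\<dots> = 2 ^ ?k * (norm (fourier f \<xi>) + real ?n ^ ?k * (\<bar>\<xi> $ j\<bar> ^ ?k * norm (fourier f \<xi>)))"
      by (simp add: power_mult_distrib algebra_simps del: power_Suc)
    also have "\<dots> \<le> 2 ^ ?k * (B0 + real ?n ^ ?k * (\<Sum>j\<in>UNIV. B j))"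
    proof (intro mult_left_mono add_mono B0)
      show "\<bar>\<xi> $ j\<bar> ^ ?k * norm (fourier f \<xi>) \<le> (\<Sum>j\<in>UNIV. B j)"
        using B[of \<xi> j] member_le_sum[of j UNIV B] Bj by (simp del: power_Suc)
    qed auto
    finally have "japan \<xi> powr real ?k * norm (fourier f \<xi>) \<le> D" by (simp add: D_def powr_realpow del: power_Suc of_nat_Suc)
    then show ?thesis by (rule le_japan_powrI)
  qed
  then have "decays (real ?k) D (fourier f)" using m by (auto simp: decays_def)
  then show ?thesis by (rule decays_integrable) simp
qed

section \<open>Transfer of both short-time transforms to the Fourier side\<close>

lemma integral_window_shift:
  "(LBINT \<eta>. complex_of_real (window (\<eta> - \<xi>)) * ch (\<eta> \<bullet> z)) = ch (\<xi> \<bullet> z) * complex_of_real (window z)"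
proof -
  have "(LBINT \<eta>. complex_of_real (window (\<eta> - \<xi>)) * ch (\<eta> \<bullet> z)) = (LBINT \<eta>. complex_of_real (window \<eta>) * ch ((\<eta> + \<xi>) \<bullet> z))"
    using lborel_integral_translate(2)[of "\<lambda>\<eta>. complex_of_real (window (\<eta> - \<xi>)) * ch (\<eta> \<bullet> z)" \<xi>] by simp
  also have "\<dots> = (LBINT \<eta>. ch (\<xi> \<bullet> z) * (complex_of_real (window \<eta>) * ch (\<eta> \<bullet> z)))"
    by (simp add: inner_add_left ch_add mult_ac)
  also have "\<dots> = ch (\<xi> \<bullet> z) * complex_of_real (window z)"
    by (simp only: integral_mult_right_zero integral_window_ch(2))
  finally show ?thesis .
qed

lemma integrable_window_shift: "integrable lborel (\<lambda>\<eta>::real^'n::finite. window (\<eta> - \<xi>))"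
  using lborel_integrable_translate(4)[of "window :: real^'n \<Rightarrow> real" \<xi>] integrable_window by simp

text \<open>The Gaussian is its own transform, so the same window reappears on the frequency side;
  the two expressions differ by the phase \<open>ch (x \<bullet> \<xi>)\<close>, hence the
  norms.\<close>

lemma norm_stft_eq_VV:
  fixes f :: "real^'n::finite \<Rightarrow> complex"
  assumes f: "integrable lborel f"
  shows "norm (stft f x \<xi>) = norm (VV (fourier f) x \<xi>)"
proof -
  have [measurable]: "f \<in> borel_measurable borel" using f by auto
  let ?F = "\<lambda>\<eta> y. f y * ch (- (y \<bullet> \<eta>)) * (complex_of_real (window (\<eta> - \<xi>)) * ch (x \<bullet> \<eta>))"
  have "VV (fourier f) x \<xi> = (LBINT \<eta>. (LBINT y. ?F \<eta> y))"
    unfolding VV_def fourier_eq integral_mult_left_zero by (simp only: mult.assoc)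
  also have "\<dots> = (LBINT y. (LBINT \<eta>. ?F \<eta> y))"
    by (rule Fubini_bound[where g="\<lambda>\<eta>. window (\<eta> - \<xi>)" and h="\<lambda>y. norm (f y)"])
      (use f integrable_window_shift in \<open>auto simp: norm_mult\<close>)
  also have "\<dots> = (LBINT y. ch (x \<bullet> \<xi>) * stft_integrand f x \<xi> y)"
  proof (rule Bochner_Integration.integral_cong[OF refl])
    fix y
    have "?F \<eta> y = f y * (complex_of_real (window (\<eta> - \<xi>)) * ch (\<eta> \<bullet> (x - y)))" for \<eta>
      by (simp add: inner_diff_right ch_diff inner_commute mult_ac)
    then have "(LBINT \<eta>. ?F \<eta> y) = f y * (ch (\<xi> \<bullet> (x - y)) * complex_of_real (window (x - y)))"
      by (simp only: integral_mult_right_zero integral_window_shift)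
    also have "window (x - y) = window (y - x)" using window_minus[of "y - x"] by simp
    finally show "(LBINT \<eta>. ?F \<eta> y) = ch (x \<bullet> \<xi>) * stft_integrand f x \<xi> y"
      by (simp add: stft_eq inner_diff_right ch_diff inner_commute mult_ac)
  qed
  also have "\<dots> = ch (x \<bullet> \<xi>) * stft f x \<xi>" unfolding stft_def by (rule integral_mult_right_zero)
  finally show ?thesis by (simp add: norm_mult)
qed

text \<open>Interchanging the frequency integral of the multiplier with the integral of the
  short-time transform gives the formula directly, without computing the Fourier transform of the
  image.\<close>

lemma norm_stft_fourier_mult:
  fixes f :: "real^'n::finite \<Rightarrow> complex"
  assumes f: "integrable lborel (fourier f)" and [measurable]: "mu \<in> borel_measurable borel"
  shows "norm (stft (fourier_mult mu f) x \<xi>) = norm (VV (\<lambda>\<eta>. fourier f \<eta> * cis (mu \<eta>)) x \<xi>)"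
proof -
  have [measurable]: "fourier f \<in> borel_measurable borel" using f by auto
  have [measurable]: "cis \<in> borel_measurable borel"
    by (rule borel_measurable_continuous_onI) (intro continuous_intros)
  let ?h = "\<lambda>\<eta>. fourier f \<eta> * cis (mu \<eta>)"
  let ?F = "\<lambda>y \<eta>. ?h \<eta> * ch (y \<bullet> \<eta>) * (complex_of_real (window (y - x)) * ch (- (y \<bullet> \<xi>)))"
  have hi: "integrable lborel (\<lambda>\<eta>. norm (fourier f \<eta>))" using f by simp
  have Tf: "fourier_mult mu f y = (LBINT \<eta>. ?h \<eta> * ch (y \<bullet> \<eta>))" for y
    unfolding fourier_mult_def by (simp add: ch_def mult_ac)
  have "stft (fourier_mult mu f) x \<xi> = (LBINT y. (LBINT \<eta>. ?F y \<eta>))"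
    unfolding stft_def stft_eq Tf integral_mult_left_zero by (simp only: mult.assoc)
  also have "\<dots> = (LBINT \<eta>. (LBINT y. ?F y \<eta>))"
    by (rule Fubini_bound[where g="\<lambda>y. window (y - x)" and h="\<lambda>\<eta>. norm (fourier f \<eta>)"])
      (use hi integrable_window_shift in \<open>auto simp: norm_mult\<close>)
  also have "\<dots> = (LBINT \<eta>. ch (- (x \<bullet> \<xi>)) * (?h \<eta> * complex_of_real (window (\<eta> - \<xi>)) * ch (x \<bullet> \<eta>)))"
  proof (rule Bochner_Integration.integral_cong[OF refl])
    fix \<eta>
    have "?F y \<eta> = ?h \<eta> * (complex_of_real (window (y - x)) * ch (y \<bullet> (\<eta> - \<xi>)))" for y
      by (simp add: inner_diff_right ch_diff mult_ac)
    then have "(LBINT y. ?F y \<eta>) = ?h \<eta> * (ch (x \<bullet> (\<eta> - \<xi>)) * complex_of_real (window (\<eta> - \<xi>)))"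
      by (simp only: integral_mult_right_zero integral_window_shift)
    then show "(LBINT y. ?F y \<eta>) = ch (- (x \<bullet> \<xi>)) * (?h \<eta> * complex_of_real (window (\<eta> - \<xi>)) * ch (x \<bullet> \<eta>))"
      by (simp add: inner_diff_right ch_diff mult_ac)
  qed
  also have "\<dots> = ch (- (x \<bullet> \<xi>)) * VV ?h x \<xi>" unfolding VV_def by (rule integral_mult_right_zero)
  finally show ?thesis by (simp add: norm_mult)
qed

lemma wa_norm_0: "wa_norm p q 0 f = Lp_qnorm p (\<lambda>x. Lp_qnorm q (\<lambda>\<xi>. ennreal (norm (stft f x \<xi>))))"
  by (simp add: wa_norm_def)

theorem theorem1p1:
  fixes p q :: ennreal and mu :: "real^'n::finite \<Rightarrow> real" and \<epsilon> :: real
  assumes "0 < p" and "0 < q"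
    and "C1_fun mu"
    and "\<epsilon> > 0"
    and "\<forall>j::'n. in_W \<infinity> \<infinity> (real CARD('n) / pq_dot p q + \<epsilon>)
                     (\<lambda>x. complex_of_real (partial j mu x))"
  shows "\<exists>C>0. \<forall>f. schwartz f \<longrightarrow> wa_norm p q 0 (fourier_mult mu f) \<le> ennreal C * wa_norm p q 0 f"
proof -
  define r where "r = pq_dot p q"
  \<comment> \<open>The minimum with 1 keeps r finite when both p and q are infinite, so that
    \<open>enn2real\<close> does not fall back to 0.\<close>
  have "min 1 (min p q) \<noteq> top" by (auto simp: min_def top_unique)
  then have rm: "ennreal r = min 1 (min p q)" by (simp add: r_def pq_dot_def less_top)
  have "0 < ennreal r" unfolding rm using assms(1,2) by simp
  then have r0: "0 < r" by simp
  have "ennreal r \<le> ennreal 1" unfolding rm by simp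
  then have r1: "r \<le> 1" by (subst (asm) ennreal_le_iff) auto
  have rp: "ennreal r \<le> p" "ennreal r \<le> q" unfolding rm by (auto intro: min.coboundedI2)
  define s where "s = real CARD('n) / r + \<epsilon>"
  \<comment> \<open>Here s r = n + \<epsilon> r: this is where a positive \<epsilon> yields
    integrability of the r-th power of the weight.\<close>
  have sr: "real CARD('n) < s * r" using r0 assms(4) by (simp add: s_def distrib_right)
  have "real CARD('n) \<le> real CARD('n) / r" using r0 r1 by (simp add: le_divide_eq mult_left_le)
  then have s: "real CARD('n) < s" using assms(4) by (simp add: s_def)
  obtain R :: real and c :: "real \<Rightarrow> real" where c: "\<And>B. 0 \<le> B \<Longrightarrow> 0 < c B" and
    kb: "\<And>(h :: real^'n \<Rightarrow> complex) mu B x \<xi>. integrable lborel h \<Longrightarrow> mu \<in> borel_measurable borel \<Longrightarrow> 0 \<le> B \<Longrightarrow>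
      AE m in lborel. rep s B (cball 0 R) (\<lambda>t. cis (mu (\<xi> + m + t) - mu (\<xi> + m)) - 1) \<Longrightarrow>
      norm (VV (\<lambda>\<eta>. h \<eta> * cis (mu \<eta>)) x \<xi>) \<le> c B * (LBINT Y. omega s Y * norm (VV h (x + fst Y) (\<xi> + snd Y)))"
    apply (rule kernel_bound[OF s])
    subgoal premises prems by (rule prems(1)[OF prems(2,3)])
    done
  have W: "in_W \<infinity> \<infinity> s (\<lambda>x. complex_of_real (partial j mu x))" for j
    using assms(5) by (simp add: s_def r_def)
  obtain B0 where "AE x in lborel. rep s B0 (cball 0 R) (\<lambda>t. cis (mu (x + t) - mu x) - 1)"
    by (rule local_phase_rep[OF assms(3) s W])
  \<comment> \<open>The absolute value supplies the nonnegativity that \<open>kb\<close> requires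
    even if no point satisfies the representation.\<close>
  then have ae: "AE x in lborel. rep s \<bar>B0\<bar> (cball 0 R) (\<lambda>t. cis (mu (x + t) - mu x) - 1)"
    by (rule eventually_mono) (auto intro: rep_mono)
  have "continuous_on UNIV mu"
    using assms(3) by (simp add: C1_fun_def continuous_on_eq_continuous_at differentiable_imp_continuous_within)
  then have mum: "mu \<in> borel_measurable borel" by (rule borel_measurable_continuous_onI)
  define K where "K = c \<bar>B0\<bar> powr r * (c 0 * 4 powr s) powr (1 - r)"
  have K: "0 < K" using c[of "\<bar>B0\<bar>"] c[of 0] by (simp add: K_def)
  define A where "A = (K * (LBINT Y. omega (s * r) (Y :: (real^'n) \<times> (real^'n)))) powr (1 / r)"
  \<comment> \<open>A is only known to be nonnegative; adding 1 provides the strictly positive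
    constant.\<close>
  have "wa_norm p q 0 (fourier_mult mu f) \<le> ennreal (A + 1) * wa_norm p q 0 f" if f: "schwartz f" for f :: "real^'n \<Rightarrow> complex"
  proof -
    have fi: "integrable lborel f" using schwartz_pderivs(3)[OF f, of "[]"] by simp
    have Fi: "integrable lborel (fourier f)" by (rule integrable_fourier[OF f])
    have [measurable]: "cis \<in> borel_measurable borel"
      by (rule borel_measurable_continuous_onI) (intro continuous_intros)
    have Ti: "integrable lborel (\<lambda>\<eta>. fourier f \<eta> * cis (mu \<eta>))"
      by (rule integrable_dominated[OF integrable_norm[OF Fi]]) (use Fi mum in \<open>auto simp: norm_mult\<close>)
    define w where "w X = norm (VV (fourier f) (fst X) (snd X))" for X
    define v where "v X = norm (VV (\<lambda>\<eta>. fourier f \<eta> * cis (mu \<eta>)) (fst X) (snd X))" for X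
    have cw: "continuous_on UNIV w" and cv: "continuous_on UNIV v"
      unfolding w_def v_def by (intro continuous_intros continuous_VV Fi Ti)+
    have wW: "w X \<le> (LBINT \<eta>. norm (fourier f \<eta>))" for X unfolding w_def by (rule VV_le[OF Fi])
    \<comment> \<open>For the zero phase, cis - 1 vanishes and is represented with bound 0, which
      gives the reproducing inequality.\<close>
    have rpw: "w X \<le> c 0 * (LBINT Y. omega s Y * w (X + Y))" for X
      using kb[OF Fi, of "\<lambda>_. 0" 0 "snd X" "fst X"] by (simp add: w_def rep_zero)
    have vb: "v X \<le> c \<bar>B0\<bar> * (LBINT Y. omega s Y * w (X + Y))" for X
      using kb[OF Fi mum _ AE_lborel_translate[OF ae], of "fst X" "snd X"] by (simp add: w_def v_def)
    have "v X powr r \<le> K * (LBINT Y. omega (s * r) Y * w (X + Y) powr r)" for X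
      unfolding K_def
      by (rule self_improvement[OF r0 r1 sr borel_measurable_continuous_onI[OF cw] _ wW _ rpw _ _ vb])
        (use c in \<open>auto simp: w_def v_def\<close>)
    then have "Lp_qnorm p (\<lambda>x. Lp_qnorm q (\<lambda>\<xi>. ennreal (v (x, \<xi>)))) \<le> ennreal A * Lp_qnorm p (\<lambda>x. Lp_qnorm q (\<lambda>\<xi>. ennreal (w (x, \<xi>))))"
      unfolding A_def by (intro mixed_norm_bound[OF r0 rp sr K cv _ cw _ wW]) (auto simp: w_def v_def)
    also have "\<dots> \<le> ennreal (A + 1) * Lp_qnorm p (\<lambda>x. Lp_qnorm q (\<lambda>\<xi>. ennreal (w (x, \<xi>))))"
      by (intro mult_right_mono ennreal_leI) auto
    finally show ?thesis
      unfolding wa_norm_0 norm_stft_fourier_mult[OF Fi mum] norm_stft_eq_VV[OF fi] by (simp add: v_def w_def)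
  qed
  moreover have "0 < A + 1" by (simp add: A_def add_nonneg_pos)
  ultimately show ?thesis by blast
qed

end
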